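(* Let $(M,\hat{J},\hat{\theta})$ and $(N,\widetilde{J},\widetilde{\theta})$ be two simply connected pseudohermitian submanifolds of $H_{n}$ with CR dimension $m$. Suppose that they have the same (induced) pseudohermitian structures, the same second fundamental forms, the same normal connections and the same fundamental vector fields, in the following sense: there exists a vector bundle isomorphism $F:\hat{\xi}^{\perp}_{1,0}\rightarrow\widetilde{\xi}^{\perp}_{1,0}$, preserving the hermitian structures induced from the Levi metric and covering a map $\varphi:M\rightarrow N$, such that $\varphi_{*}\circ\hat{J}=\widetilde{J}\circ\varphi_{*}$ and $\varphi^{*}\widetilde{\theta}=\hat{\theta}$; $\langle II,V\rangle=\varphi^{*}\langle\widetilde{II},FV\rangle$ for all $V\in\hat{\xi}^{\perp}_{1,0}$; $F(\nabla^{\perp}_{X}V)=\widetilde{\nabla}^{\perp}_{\varphi_{*}X}(FV)$ for all $X\in TM$, $V\in\hat{\xi}^{\perp}_{1,0}$; and $F\nu=\widetilde{\nu}$. Then $M$ and $N$ differ by a Heisenberg rigid motion (an element of $PSH(n)$).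
   Context: $H_{n}$ is the Heisenberg group with coordinates $(x_\beta,y_\beta,t)$, contact form $\Theta=dt+\sum_{\beta}(x_\beta dy_\beta-y_\beta dx_\beta)$, contact bundle $\xi=\ker\Theta$, standard CR structure $J\mathring{e}_\beta=\mathring{e}_{n+\beta}$, $J\mathring{e}_{n+\beta}=-\mathring{e}_\beta$, with $\mathring{e}_{\beta}=\partial_{x_\beta}+y_\beta\partial_t$, $\mathring{e}_{n+\beta}=\partial_{y_\beta}-x_\beta\partial_t$, Reeb field $T=\partial_t$, and Levi metric $\langle\ ,\ \rangle$. A Heisenberg rigid motion is an element of the symmetry group $PSH(n)$ of pseudohermitian transformations of $H_n$ (each is a left translation composed with a rotation around the $t$-axis). A $(2m+1)$-dimensional pseudohermitian manifold $(M,\hat{J},\hat{\theta})$ is a pseudohermitian submanifold of $H_{n}$ ($1\le m\le n$) if $\hat{\xi}=TM\cap\xi$, $\hat{J}=J|_{\hat{\xi}}$ and $\hat{\theta}=\Theta|_{M}$, where $\hat\xi=\ker\hat\theta$. The fundamental vector field $\nu$ is the unique horizontal vector field in $\hat{\xi}^{\perp}$ (the Levi-orthogonal complement of $\hat\xi$ in $\xi$) with $T+\nu\in TM$; $\hat T=T+\nu$ is the Reeb field of $\hat\theta$. Choose a Darboux frame $\{Z_\beta,T\}$ along $M$ with $Z_{j}\in\hat{\xi}_{1,0}$ ($1\le j\le m$) and $Z_{a}\in\hat{\xi}^{\perp}_{1,0}$ ($m+1\le a\le n$), dual coframe $\{\theta^\beta,\theta\}$, and pseudohermitian connection forms $\theta_\gamma{}^\beta$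 of $H_n$ ($\nabla Z_\gamma=\theta_\gamma{}^\beta\otimes Z_\beta$). The normal connection is $\nabla^{\perp}Z_{a}=\theta_{a}{}^{b}\otimes Z_{b}$, the orthogonal projection of $\nabla Z_a$ onto $\hat{\xi}^{\perp}_{1,0}$. The second fundamental form is $II=\theta^{j}\otimes\theta_{j}{}^{a}\otimes Z_{a}:\hat{\xi}_{1,0}\times\hat{\xi}_{1,0}\rightarrow\hat{\xi}^{\perp}_{1,0}$. Tilded objects are the corresponding ones for $N$. *)

theory Defs
  imports "HOL-Analysis.Analysis"
begin

fun Ck :: "nat \<Rightarrow> ('a::euclidean_space \<Rightarrow> 'b::real_normed_vector) \<Rightarrow> 'a set \<Rightarrow> bool" where
  "Ck 0 f S = continuous_on S f"
| "Ck (Suc k) f S = ((\<forall>x\<in>S. f differentiable (at x)) \<and>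
                     (\<forall>i\<in>Basis. Ck k (\<lambda>x. frechet_derivative f (at x) i) S))"

definition smooth_on :: "'a::euclidean_space set \<Rightarrow> ('a \<Rightarrow> 'b::real_normed_vector) \<Rightarrow> bool" where
  "smooth_on S f \<longleftrightarrow> open S \<and> (\<forall>k. Ck k f S)"

definition msmooth :: "'e::euclidean_space set \<Rightarrow> ('e \<Rightarrow> 'b::real_normed_vector) \<Rightarrow> bool" where
  "msmooth M f \<longleftrightarrow> (\<forall>p\<in>M. \<exists>U g. open U \<and> p \<in> U \<and> smooth_on U g \<and> (\<forall>q\<in>M \<inter> U. g q = f q))"

definition submanifold :: "nat \<Rightarrow> 'e::euclidean_space set \<Rightarrow> bool" where
  "submanifold k M \<longleftrightarrow> (\<forall>p\<in>M. \<exists>U V (\<Phi>::'e \<Rightarrow> 'e) S. open U \<and> p \<in> U \<and> open V \<and> smooth_on U \<Phi> \<and>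
      smooth_on V (inv_into U \<Phi>) \<and> bij_betw \<Phi> U V \<and> subspace S \<and> dim S = k \<and>
      \<Phi> ` (M \<inter> U) = V \<inter> S)"

definition tangent :: "'e::euclidean_space set \<Rightarrow> 'e \<Rightarrow> 'e set" where
  "tangent M p = {v. \<exists>\<gamma> e. e > 0 \<and> \<gamma> 0 = p \<and> \<gamma> ` {-e<..<e} \<subseteq> M \<and>
      smooth_on {-e<..<e} \<gamma> \<and> (\<gamma> has_vector_derivative v) (at 0)}"

definition mdiff :: "'e::euclidean_space set \<Rightarrow> ('e \<Rightarrow> 'b::real_normed_vector) \<Rightarrow> 'e \<Rightarrow> 'e \<Rightarrow> 'b" where
  "mdiff M f p v = (SOME d. \<exists>U g. open U \<and> p \<in> U \<and> smooth_on U g \<and>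
      (\<forall>q\<in>M \<inter> U. g q = f q) \<and> frechet_derivative g (at p) v = d)"

definition section_of :: "'e::euclidean_space set \<Rightarrow> ('e \<Rightarrow> 'e set) \<Rightarrow> ('e \<Rightarrow> 'e) \<Rightarrow> bool" where
  "section_of M E V \<longleftrightarrow> msmooth M V \<and> (\<forall>q\<in>M. V q \<in> E q)"

section \<open>The Heisenberg group H_n, points (x, y, t); tangent vectors have the same type\<close>

type_synonym 'n heis = "(real^'n) \<times> (real^'n) \<times> real"

definition hx :: "'n heis \<Rightarrow> real^'n" where "hx q = fst q"
definition hy :: "'n heis \<Rightarrow> real^'n" where "hy q = fst (snd q)"
definition ht :: "'n heis \<Rightarrow> real" where "ht q = snd (snd q)"

definition Theta :: "('n::finite) heis \<Rightarrow> 'n heis \<Rightarrow> real" where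
  "Theta q v = ht v + (hx q \<bullet> hy v - hy q \<bullet> hx v)"

definition xi :: "('n::finite) heis \<Rightarrow> 'n heis set" where
  "xi q = {v. Theta q v = 0}"

text \<open>Horizontal vector at q with components (a,b) in the frame e_beta, e_(n+beta).\<close>
definition hvec :: "('n::finite) heis \<Rightarrow> (real^'n) \<times> (real^'n) \<Rightarrow> 'n heis" where
  "hvec q c = (fst c, snd c, hy q \<bullet> fst c - hx q \<bullet> snd c)"

definition comps :: "('n::finite) heis \<Rightarrow> (real^'n) \<times> (real^'n)" where
  "comps v = (hx v, hy v)"

definition Jst :: "('n::finite) heis \<Rightarrow> 'n heis \<Rightarrow> 'n heis" where
  "Jst q v = hvec q (- hy v, hx v)"

text \<open>Levi metric on horizontal vectors (frame e_beta, e_(n+beta) orthonormal).\<close>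
definition levi :: "('n::finite) heis \<Rightarrow> 'n heis \<Rightarrow> real" where
  "levi v w = hx v \<bullet> hx w + hy v \<bullet> hy w"

definition Treeb :: "('n::finite) heis" where "Treeb = (0, 0, 1)"

definition xihat :: "('n::finite) heis set \<Rightarrow> 'n heis \<Rightarrow> 'n heis set" where
  "xihat M q = tangent M q \<inter> xi q"

definition xiperp :: "('n::finite) heis set \<Rightarrow> 'n heis \<Rightarrow> 'n heis set" where
  "xiperp M q = {v \<in> xi q. \<forall>w\<in>xihat M q. levi v w = 0}"

definition psh_submanifold :: "nat \<Rightarrow> ('n::finite) heis set \<Rightarrow> bool" where
  "psh_submanifold m M \<longleftrightarrow> submanifold (2*m+1) M \<and>
     (\<forall>q\<in>M. dim (xihat M q) = 2*m \<and> (\<forall>v\<in>xihat M q. Jst q v \<in> tangent M q))"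

definition nu :: "('n::finite) heis set \<Rightarrow> 'n heis \<Rightarrow> 'n heis" where
  "nu M q = (THE v. v \<in> xiperp M q \<and> Treeb + v \<in> tangent M q)"

definition pi_perp :: "('n::finite) heis set \<Rightarrow> 'n heis \<Rightarrow> 'n heis \<Rightarrow> 'n heis" where
  "pi_perp M q v = (THE w. w \<in> xiperp M q \<and> (\<forall>s\<in>xiperp M q. levi (v - w) s = 0))"

text \<open>Pseudohermitian (Tanaka-Webster) connection of H_n on a horizontal field V along M:
  the standard frame is parallel, so one differentiates the frame components.\<close>
definition nabla :: "('n::finite) heis set \<Rightarrow> ('n heis \<Rightarrow> 'n heis) \<Rightarrow> 'n heis \<Rightarrow> 'n heis \<Rightarrow> 'n heis" where
  "nabla M V q X = hvec q (mdiff M (\<lambda>r. comps (V r)) q X)"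

definition nabla_perp :: "('n::finite) heis set \<Rightarrow> ('n heis \<Rightarrow> 'n heis) \<Rightarrow> 'n heis \<Rightarrow> 'n heis \<Rightarrow> 'n heis" where
  "nabla_perp M V q X = pi_perp M q (nabla M V q X)"

text \<open>Second fundamental form II(Z_X, Z_Y) = projection of nabla_(Z_X) Z_Y onto xiperp_(1,0),
  written through the real representatives X, Y of Z_X = (X - iJX)/2, Z_Y = (Y - iJY)/2;
  the real representative of the result is (1/2) pi_perp (nabla_X Y - J nabla_(JX) Y).
  Y is extended to a smooth section of xihat (the result is tensorial).\<close>
definition II :: "('n::finite) heis set \<Rightarrow> 'n heis \<Rightarrow> 'n heis \<Rightarrow> 'n heis \<Rightarrow> 'n heis" where
  "II M q X Y = (let Yh = (SOME Yh. section_of M (xihat M) Yh \<and> Yh q = Y) in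
      (1/2) *\<^sub>R pi_perp M q (nabla M Yh q X - Jst q (nabla M Yh q (Jst q X))))"

definition heis_mult :: "('n::finite) heis \<Rightarrow> 'n heis \<Rightarrow> 'n heis" where
  "heis_mult a q = (hx a + hx q, hy a + hy q, ht a + ht q + (hy a \<bullet> hx q - hx a \<bullet> hy q))"

definition unitary_mat :: "complex^'n^'n \<Rightarrow> bool" where
  "unitary_mat U \<longleftrightarrow> (\<chi> i j. cnj (U $ j $ i)) ** U = mat 1"

definition rot :: "complex^('n::finite)^'n \<Rightarrow> 'n heis \<Rightarrow> 'n heis" where
  "rot U q = (let w = U *v (\<chi> b. Complex (hx q $ b) (hy q $ b)) in
      (\<chi> b. Re (w $ b), \<chi> b. Im (w $ b), ht q))"

definition PSH :: "(('n::finite) heis \<Rightarrow> 'n heis) set" where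
  "PSH = {g. \<exists>a U. unitary_mat U \<and> g = (\<lambda>q. heis_mult a (rot U q))}"

end

theory Submission
  imports Defs
begin

text \<open>
  The standard frame of the Heisenberg group is parallel, so horizontal vectors are identified with
  their components in \<open>\<complex>\<^sup>n\<close>. At \<open>p \<in> M\<close> let \<open>A p\<close> be the differential of \<open>\<phi>\<close> on the contact
  space of \<open>M\<close> and \<open>F p\<close> on its complement. Since \<open>\<phi>\<close> preserves the contact forms, it preserves
  their differentials, hence the Levi metrics and the Reeb fields; so \<open>A p\<close> is unitary and
  \<open>d(z \<circ> \<phi>) = A dz\<close> on \<open>TM\<close>, where \<open>z\<close> denotes the horizontal coordinates.
  Symmetry of second derivatives gives \<open>dA \<and> dz = 0\<close>. The skew-hermitian form \<open>A\<^sup>-\<^sup>1 dA\<close> then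
  vanishes: its normal block by equality of the normal connections, its mixed block by equality of the
  second fundamental forms, and its contact block because it is symmetric in the first two arguments
  and skew in the last two. Hence \<open>A\<close> is constant, \<open>z \<circ> \<phi>\<close> is a unitary map of \<open>z\<close> plus a
  constant, and the last coordinate is recovered from the contact form.
\<close>

subsection \<open>Calculus of smooth maps\<close>

text \<open>The notions \<open>mdiff\<close>, \<open>nu\<close>, \<open>pi_perp\<close> and
  \<open>II\<close> rest on choice or description operators, and a derivative within
  \<open>M\<close> is determined only along \<open>tangent M p\<close>. Identities are therefore
  differentiated within \<open>M\<close> and compared on tangent vectors alone, and arbitrary fields
  give way to explicit ones: constant vectors projected to the contact spaces or to their
  complements. \<open>A p\<close> acts on the whole component space, not on a subspace varying with
  \<open>p\<close>, so that \<open>dA\<close> is a derivative in a fixed vector space. The price is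
  smoothness of the projection in \<open>p\<close>, which comes from a local Gram-Schmidt frame. The
  second fundamental form controls only half of the mixed block, namely the part that is complex
  linear in the direction of differentiation. The antilinear half vanishes because symmetry carries
  complex linearity from the second argument over to the direction. The Reeb direction needs no
  equation of its own: \<open>dA_symmetric\<close> exchanges it with a contact direction.\<close>

lemma has_derivative_frechet:
  assumes "f differentiable (at x)"
  shows "(f has_derivative frechet_derivative f (at x)) (at x)"
  using assms by (simp add: frechet_derivative_works)

lemma frechet_derivative_cong:
  assumes "open S" "x \<in> S" "\<And>y. y \<in> S \<Longrightarrow> f y = g y"
  shows "frechet_derivative f (at x) = frechet_derivative g (at x)"
proof -
  have "(f has_derivative D) (at x) \<longleftrightarrow> (g has_derivative D) (at x)" for D
    using has_derivative_transform_within_open[OF _ assms(1,2)] assms(3) by metis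
  then show ?thesis unfolding frechet_derivative_def by simp
qed

lemma differentiable_cong:
  assumes "open S" "x \<in> S" "\<And>y. y \<in> S \<Longrightarrow> f y = g y" "f differentiable (at x)"
  shows "g differentiable (at x)"
  using assms has_derivative_transform_within_open[OF _ assms(1,2)]
  unfolding differentiable_def by metis

text \<open>Openness is what makes this true: \<open>frechet_derivative\<close> at a point sees a
  whole neighbourhood, not only the values on \<open>S\<close>.\<close>

lemma Ck_cong:
  assumes "open S" "\<And>y. y \<in> S \<Longrightarrow> f y = g y" "Ck k f S"
  shows "Ck k g S"
  using assms(2,3)
proof (induction k arbitrary: f g)
  case 0
  then show ?case by (metis Ck.simps(1) continuous_on_cong)
next
  case (Suc k)
  have "Ck k (\<lambda>x. frechet_derivative g (at x) i) S" if "i \<in> Basis" for i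
    using Suc.IH[of "\<lambda>x. frechet_derivative f (at x) i" "\<lambda>x. frechet_derivative g (at x) i"] Suc.prems that
      frechet_derivative_cong[OF assms(1), of _ f g] by auto
  moreover have "g differentiable (at x)" if "x \<in> S" for x
    using differentiable_cong[OF assms(1) that, of f g] Suc.prems that by auto
  ultimately show ?case by simp
qed

lemma Ck_SucD: "Ck (Suc k) f S \<Longrightarrow> Ck k f S"
proof (induction k arbitrary: f)
  case 0
  then show ?case
    by (auto intro!: differentiable_imp_continuous_on simp: differentiable_on_def differentiable_at_withinI)
next
  case (Suc k)
  then show ?case by (metis Ck.simps(2))
qed

lemma Ck_subset: "Ck k f S \<Longrightarrow> T \<subseteq> S \<Longrightarrow> Ck k f T"
proof (induction k arbitrary: f)
  case 0
  then show ?case using continuous_on_subset by auto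
next
  case (Suc k)
  then show ?case by auto
qed

lemma Ck_const: "Ck k (\<lambda>x. c) S"
proof (induction k arbitrary: c)
  case (Suc k)
  then show ?case by (simp add: frechet_derivative_const)
qed simp

text \<open>Pattern of the closure lemmas: each directional derivative of the result is again an
  expression of the same kind in \<open>f\<close> and its directional derivatives, so induction on
  \<open>k\<close> with \<open>f\<close> arbitrary closes.\<close>

lemma Ck_bounded_linear:
  assumes "open S" "bounded_linear L" "Ck k f S"
  shows "Ck k (\<lambda>x. L (f x)) S"
  using assms(3)
proof (induction k arbitrary: f)
  case 0
  then show ?case using bounded_linear.continuous_on[OF assms(2)] by simp
next
  case (Suc k)
  have D: "((\<lambda>x. L (f x)) has_derivative (\<lambda>i. L (frechet_derivative f (at x) i))) (at x)" if "x \<in> S" for x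
    using Suc.prems that by (auto intro!: bounded_linear.has_derivative[OF assms(2)] has_derivative_frechet)
  have "Ck k (\<lambda>x. frechet_derivative (\<lambda>x. L (f x)) (at x) i) S" if "i \<in> Basis" for i
    by (rule Ck_cong[OF assms(1) _ Suc.IH[of "\<lambda>x. frechet_derivative f (at x) i"]])
       (use frechet_derivative_at[OF D] Suc.prems that in \<open>auto dest: fun_cong\<close>)
  then show ?case using D unfolding Ck.simps by (auto simp: differentiable_def)
qed

lemma Ck_add:
  assumes "open S" "Ck k f S" "Ck k g S"
  shows "Ck k (\<lambda>x. f x + g x) S"
  using assms(2,3)
proof (induction k arbitrary: f g)
  case 0
  then show ?case by (simp add: continuous_on_add)
next
  case (Suc k)
  have D: "((\<lambda>x. f x + g x) has_derivative
      (\<lambda>i. frechet_derivative f (at x) i + frechet_derivative g (at x) i)) (at x)" if "x \<in> S" for x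
    using Suc.prems that by (auto intro!: has_derivative_add has_derivative_frechet)
  have "Ck k (\<lambda>x. frechet_derivative (\<lambda>x. f x + g x) (at x) i) S" if "i \<in> Basis" for i
    by (rule Ck_cong[OF assms(1) _ Suc.IH[of "\<lambda>x. frechet_derivative f (at x) i" "\<lambda>x. frechet_derivative g (at x) i"]])
       (use frechet_derivative_at[OF D] Suc.prems that in \<open>auto dest: fun_cong\<close>)
  then show ?case using D unfolding Ck.simps by (auto simp: differentiable_def)
qed

lemma Ck_sum:
  assumes "open S" "\<And>i. i \<in> I \<Longrightarrow> Ck k (f i) S"
  shows "Ck k (\<lambda>x. \<Sum>i\<in>I. f i x) S"
proof (cases "finite I")
  case True
  then show ?thesis using assms(2)
    by (induction I rule: finite_induct) (auto intro: Ck_const Ck_add[OF assms(1)])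
qed (simp add: Ck_const)

text \<open>The Leibniz rule leaves one factor undifferentiated in each term; \<open>Ck_SucD\<close>
  lowers its order so that the induction hypothesis applies to both terms.\<close>

lemma Ck_bounded_bilinear:
  assumes "open S" "bounded_bilinear B" "Ck k f S" "Ck k g S"
  shows "Ck k (\<lambda>x. B (f x) (g x)) S"
  using assms(3,4)
proof (induction k arbitrary: f g)
  case 0
  then show ?case using bounded_bilinear.continuous_on[OF assms(2)] by simp
next
  case (Suc k)
  have D: "((\<lambda>x. B (f x) (g x)) has_derivative
      (\<lambda>i. B (f x) (frechet_derivative g (at x) i) + B (frechet_derivative f (at x) i) (g x))) (at x)"
    if "x \<in> S" for x
    using Suc.prems that by (auto intro!: bounded_bilinear.FDERIV[OF assms(2)] has_derivative_frechet)
  have "Ck k (\<lambda>x. frechet_derivative (\<lambda>x. B (f x) (g x)) (at x) i) S" if "i \<in> Basis" for i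
    by (rule Ck_cong[OF assms(1) _ Ck_add[OF assms(1)
            Suc.IH[of f "\<lambda>x. frechet_derivative g (at x) i"] Suc.IH[of "\<lambda>x. frechet_derivative f (at x) i" g]]])
       (use frechet_derivative_at[OF D] Suc.prems Ck_SucD that in \<open>auto dest: fun_cong\<close>)
  then show ?case using D unfolding Ck.simps by (auto simp: differentiable_def)
qed

lemma linear_basis_expansion:
  fixes x :: "'a::euclidean_space"
  assumes "linear L"
  shows "L x = (\<Sum>j\<in>Basis. (x \<bullet> j) *\<^sub>R L j)"
proof -
  have "L x = L (\<Sum>j\<in>Basis. (x \<bullet> j) *\<^sub>R j)" by (simp add: euclidean_representation)
  also have "\<dots> = (\<Sum>j\<in>Basis. (x \<bullet> j) *\<^sub>R L j)"
    using assms by (simp add: linear_sum linear_cmul o_def)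
  finally show ?thesis .
qed

text \<open>By the chain rule \<open>f\<close> is differentiated in a direction that varies with
  \<open>x\<close>, whereas \<open>Ck\<close> knows only fixed basis directions. Expanding that
  direction in \<open>Basis\<close> gives a sum of scalar functions times composites of partial
  derivatives with \<open>g\<close>.\<close>

lemma Ck_compose:
  fixes f :: "'b::euclidean_space \<Rightarrow> 'c::real_normed_vector" and g :: "'a::euclidean_space \<Rightarrow> 'b"
  assumes "open S" "Ck k f T" "Ck k g S" "g ` S \<subseteq> T"
  shows "Ck k (\<lambda>x. f (g x)) S"
  using assms(2,3)
proof (induction k arbitrary: f)
  case 0
  then show ?case using continuous_on_compose2[of T f S g] assms(4) by simp
next
  case (Suc k)
  have D: "((\<lambda>x. f (g x)) has_derivative (\<lambda>i. frechet_derivative f (at (g x)) (frechet_derivative g (at x) i))) (at x)"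
    if "x \<in> S" for x
    using Suc.prems that assms(4) diff_chain_at[OF has_derivative_frechet has_derivative_frechet, of g x f]
    by (auto simp: o_def image_subset_iff)
  have lin: "linear (frechet_derivative f (at (g x)))" if "x \<in> S" for x
    using Suc.prems that assms(4) by (intro linear_frechet_derivative) (auto simp: image_subset_iff)
  have "Ck k (\<lambda>x. frechet_derivative (\<lambda>x. f (g x)) (at x) i) S" if i: "i \<in> Basis" for i
  proof (rule Ck_cong[OF assms(1)])
    show "(\<Sum>j\<in>Basis. (frechet_derivative g (at x) i \<bullet> j) *\<^sub>R frechet_derivative f (at (g x)) j)
        = frechet_derivative (\<lambda>x. f (g x)) (at x) i" if "x \<in> S" for x
      unfolding linear_basis_expansion[OF lin[OF that], of "frechet_derivative g (at x) i", symmetric]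
        frechet_derivative_at[OF D[OF that], symmetric] ..
    show "Ck k (\<lambda>x. \<Sum>j\<in>Basis. (frechet_derivative g (at x) i \<bullet> j) *\<^sub>R frechet_derivative f (at (g x)) j) S"
      using Suc.prems i Suc.IH[of "\<lambda>y. frechet_derivative f (at y) _"] Ck_SucD[of k g]
      by (intro Ck_sum assms(1) Ck_bounded_bilinear[OF _ bounded_bilinear_scaleR]
          Ck_bounded_linear[OF _ bounded_linear_inner_left]) auto
  qed
  then show ?case using D unfolding Ck.simps by (auto simp: differentiable_def)
qed

text \<open>The derivative is minus a product of \<open>inverse\<close> with itself, hence of the
  same order by the bilinear closure lemma.\<close>

lemma Ck_inverse: "Ck k (inverse :: real \<Rightarrow> real) (- {0})"
proof (induction k)
  case 0
  show ?case by (auto intro!: continuous_intros)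
next
  case (Suc k)
  have D: "(inverse has_derivative (\<lambda>h. - (inverse x * h * inverse x))) (at x)" if "x \<in> -{0}" for x :: real
    using that by (auto intro!: has_derivative_inverse')
  have op: "open (- {0::real})" by auto
  have "Ck k (\<lambda>x. - (inverse x * inverse x)) (- {0::real})"
    by (intro Ck_bounded_linear[OF op bounded_linear_minus[OF bounded_linear_ident]]
        Ck_bounded_bilinear[OF op bounded_bilinear_mult] Suc)
  then have "Ck k (\<lambda>x. frechet_derivative inverse (at x) i) (- {0::real})" if "i \<in> Basis" for i
    by (rule Ck_cong[OF op, rotated]) (use that in \<open>auto simp: frechet_derivative_at[OF D, symmetric]\<close>)
  then show ?case using D unfolding Ck.simps by (auto simp: differentiable_def)
qed

section \<open>Closure properties of smooth maps on open sets\<close>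

lemma smooth_on_open: "smooth_on S f \<Longrightarrow> open S"
  by (simp add: smooth_on_def)

lemma smooth_on_cong:
  "smooth_on S f \<Longrightarrow> (\<And>y. y \<in> S \<Longrightarrow> f y = g y) \<Longrightarrow> smooth_on S g"
  unfolding smooth_on_def using Ck_cong by metis

lemma smooth_on_subset: "smooth_on S f \<Longrightarrow> open T \<Longrightarrow> T \<subseteq> S \<Longrightarrow> smooth_on T f"
  unfolding smooth_on_def using Ck_subset by metis

lemma smooth_on_const: "open S \<Longrightarrow> smooth_on S (\<lambda>x. c)"
  by (simp add: smooth_on_def Ck_const)

lemma smooth_on_bounded_linear:
  "bounded_linear L \<Longrightarrow> smooth_on S f \<Longrightarrow> smooth_on S (\<lambda>x. L (f x))"
  by (simp add: smooth_on_def Ck_bounded_linear)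

lemma smooth_on_bounded_bilinear:
  "bounded_bilinear B \<Longrightarrow> smooth_on S f \<Longrightarrow> smooth_on S g \<Longrightarrow> smooth_on S (\<lambda>x. B (f x) (g x))"
  by (simp add: smooth_on_def Ck_bounded_bilinear)

lemma smooth_on_add: "smooth_on S f \<Longrightarrow> smooth_on S g \<Longrightarrow> smooth_on S (\<lambda>x. f x + g x)"
  by (simp add: smooth_on_def Ck_add)

lemma smooth_on_uminus: "smooth_on S f \<Longrightarrow> smooth_on S (\<lambda>x. - f x)"
  by (rule smooth_on_bounded_linear[OF bounded_linear_minus[OF bounded_linear_ident]])

lemma smooth_on_diff: "smooth_on S f \<Longrightarrow> smooth_on S g \<Longrightarrow> smooth_on S (\<lambda>x. f x - g x)"
  using smooth_on_add[OF _ smooth_on_uminus] by force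

lemma smooth_on_sum:
  "open S \<Longrightarrow> (\<And>i. i \<in> I \<Longrightarrow> smooth_on S (f i)) \<Longrightarrow> smooth_on S (\<lambda>x. \<Sum>i\<in>I. f i x)"
  by (simp add: smooth_on_def Ck_sum)

lemma smooth_on_inner: "smooth_on S f \<Longrightarrow> smooth_on S g \<Longrightarrow> smooth_on S (\<lambda>x. f x \<bullet> g x)"
  by (rule smooth_on_bounded_bilinear[OF bounded_bilinear_inner])

lemma smooth_on_scaleR: "smooth_on S f \<Longrightarrow> smooth_on S g \<Longrightarrow> smooth_on S (\<lambda>x. f x *\<^sub>R g x)"
  by (rule smooth_on_bounded_bilinear[OF bounded_bilinear_scaleR])

lemma smooth_on_compose:
  "smooth_on T f \<Longrightarrow> smooth_on S g \<Longrightarrow> g ` S \<subseteq> T \<Longrightarrow> smooth_on S (\<lambda>x. f (g x))"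
  unfolding smooth_on_def using Ck_compose by blast

lemma smooth_on_divide:
  fixes f g :: "'a::euclidean_space \<Rightarrow> real"
  assumes "smooth_on S f" "smooth_on S g" "\<And>x. x \<in> S \<Longrightarrow> g x \<noteq> 0"
  shows "smooth_on S (\<lambda>x. f x / g x)"
proof -
  have "smooth_on (- {0}) (inverse :: real \<Rightarrow> real)" by (auto simp: smooth_on_def Ck_inverse)
  then have "smooth_on S (\<lambda>x. inverse (g x))"
    by (rule smooth_on_compose) (use assms in auto)
  from smooth_on_bounded_bilinear[OF bounded_bilinear_mult assms(1) this]
  show ?thesis by (simp add: divide_inverse)
qed

lemma smooth_on_ident: "open S \<Longrightarrow> smooth_on S (\<lambda>x. x)"
proof -
  have "Ck k (\<lambda>x::'a. x) S" if "open S" for k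
    by (cases k) (use that in \<open>auto simp: frechet_derivative_ident Ck_const\<close>)
  then show "open S \<Longrightarrow> smooth_on S (\<lambda>x. x)" by (simp add: smooth_on_def)
qed

lemma smooth_on_differentiable: "smooth_on S f \<Longrightarrow> x \<in> S \<Longrightarrow> f differentiable (at x)"
  using Ck.simps(2) unfolding smooth_on_def by metis

lemma smooth_on_has_derivative:
  "smooth_on S f \<Longrightarrow> x \<in> S \<Longrightarrow> (f has_derivative frechet_derivative f (at x)) (at x)"
  by (rule has_derivative_frechet[OF smooth_on_differentiable])

lemma smooth_on_linear: "smooth_on S f \<Longrightarrow> x \<in> S \<Longrightarrow> linear (frechet_derivative f (at x))"
  by (rule linear_frechet_derivative[OF smooth_on_differentiable])

lemma smooth_on_continuous_on: "smooth_on S f \<Longrightarrow> continuous_on S f"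
  using Ck.simps(1) unfolding smooth_on_def by metis

lemma smooth_on_open_vimage:
  assumes "smooth_on S f" "open T"
  shows "open {x \<in> S. f x \<in> T}"
  using continuous_open_preimage[OF smooth_on_continuous_on[OF assms(1)] smooth_on_open[OF assms(1)] assms(2)]
  by (simp add: vimage_def Int_def)

lemma smooth_on_derivative:
  assumes "smooth_on S f" "smooth_on S V"
  shows "smooth_on S (\<lambda>x. frechet_derivative f (at x) (V x))"
proof (rule smooth_on_cong)
  have "smooth_on S (\<lambda>x. frechet_derivative f (at x) j)" if "j \<in> Basis" for j
    using assms(1) that Ck.simps(2) unfolding smooth_on_def by metis
  then show "smooth_on S (\<lambda>x. \<Sum>j\<in>Basis. (V x \<bullet> j) *\<^sub>R frechet_derivative f (at x) j)"
    using assms by (intro smooth_on_sum smooth_on_scaleR smooth_on_inner smooth_on_const) (auto dest: smooth_on_open)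
  show "(\<Sum>j\<in>Basis. (V x \<bullet> j) *\<^sub>R frechet_derivative f (at x) j) = frechet_derivative f (at x) (V x)"
    if "x \<in> S" for x
    using linear_basis_expansion[OF smooth_on_linear[OF assms(1) that]] by metis
qed

text \<open>Two mean value theorems turn the second difference over the parallelogram with sides
  \<open>h *\<^sub>R a\<close> and \<open>h *\<^sub>R b\<close> into \<open>h * h\<close> times a
  mixed derivative at one of its points, and continuity moves that point to \<open>x\<close>. Since
  the second difference is symmetric in \<open>a\<close> and \<open>b\<close>, this estimate is what
  symmetry of the Hessian follows from.\<close>

lemma mixed_derivatives_real:
  fixes f :: "'a::real_normed_vector \<Rightarrow> real"
  assumes "open S" "x \<in> S"
    and f: "\<And>y. y \<in> S \<Longrightarrow> (f has_derivative f' y) (at y)"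
    and fa: "\<And>y. y \<in> S \<Longrightarrow> ((\<lambda>z. f' z a) has_derivative fa y) (at y)"
    and cont: "continuous (at x) (\<lambda>y. fa y b)"
    and e: "e > 0"
  shows "\<exists>d>0. \<forall>h. 0 < h \<and> h < d \<longrightarrow>
    \<bar>f (x + h *\<^sub>R a + h *\<^sub>R b) - f (x + h *\<^sub>R a) - f (x + h *\<^sub>R b) + f x - h * h * fa x b\<bar> < h * h * e"
proof -
  obtain r where r: "r > 0" "ball x r \<subseteq> S" using assms(1,2) open_contains_ball by blast
  obtain r' where r': "r' > 0" "\<And>y. dist y x < r' \<Longrightarrow> dist (fa y b) (fa x b) < e"
    using cont e unfolding continuous_at_eps_delta by blast
  \<comment> \<open>Scaled so that every parallelogram with \<open>h < d\<close> stays in both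
    balls; the \<open>+ 1\<close> keeps the denominator positive when \<open>a\<close> and
    \<open>b\<close> vanish.\<close>
  define d where "d = min r r' / (norm a + norm b + 1)"
  have pos: "0 < norm a + norm b + 1" by (smt (verit) norm_ge_zero)
  have d: "d > 0" using r(1) r'(1) pos by (simp add: d_def)
  have near: "dist (x + s *\<^sub>R a + t *\<^sub>R b) x < min r r'" if "0 \<le> s" "s \<le> h" "0 \<le> t" "t \<le> h" "h < d" for s t h
  proof -
    have "dist (x + s *\<^sub>R a + t *\<^sub>R b) x \<le> norm (s *\<^sub>R a) + norm (t *\<^sub>R b)"
      by (simp add: dist_norm add.assoc norm_triangle_ineq del: norm_scaleR)
    also have "\<dots> \<le> h * (norm a + norm b + 1)"
      using that mult_right_mono[OF that(2), of "norm a"] mult_right_mono[OF that(4), of "norm b"] by (simp add: algebra_simps)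
    also have "\<dots> < d * (norm a + norm b + 1)" using that pos by simp
    also have "\<dots> = min r r'" using pos by (simp add: d_def)
    finally show ?thesis .
  qed
  have inS: "x + s *\<^sub>R a + t *\<^sub>R b \<in> S" if "0 \<le> s" "s \<le> h" "0 \<le> t" "t \<le> h" "h < d" for s t h
    using near[OF that] r(2) by (auto simp: dist_commute)
  show ?thesis
  proof (intro exI[of _ d] conjI allI impI d)
    fix h assume h: "0 < h \<and> h < d"
    \<comment> \<open>The vacuous \<open>0 *\<^sub>R b\<close> puts both terms into the shape that
      \<open>line\<close> differentiates.\<close>
    define g where "g s = f (x + s *\<^sub>R a + h *\<^sub>R b) - f (x + s *\<^sub>R a + 0 *\<^sub>R b)" for s
    define g' where "g' s = f' (x + s *\<^sub>R a + h *\<^sub>R b) a - f' (x + s *\<^sub>R a + 0 *\<^sub>R b) a" for s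
    have line: "((\<lambda>s. f (x + s *\<^sub>R a + t *\<^sub>R b)) has_real_derivative f' (x + s *\<^sub>R a + t *\<^sub>R b) a) (at s)"
      if "0 \<le> s" "s \<le> h" "0 \<le> t" "t \<le> h" for s t
    proof -
      have F: "(f has_derivative f' (x + s *\<^sub>R a + t *\<^sub>R b)) (at (x + s *\<^sub>R a + t *\<^sub>R b))"
        using f inS that h by blast
      have "((\<lambda>s. x + s *\<^sub>R a + t *\<^sub>R b) has_derivative (\<lambda>k. k *\<^sub>R a)) (at s)"
        by (auto intro!: derivative_eq_intros)
      from diff_chain_at[OF this F] linear_cmul[OF has_derivative_linear[OF F]]
      show ?thesis by (simp add: has_field_derivative_def o_def mult.commute[of _ "f' _ a"])
    qed
    have "\<exists>s. 0 < s \<and> s < h \<and> g h - g 0 = (h - 0) * g' s"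
      by (rule MVT2) (use h in \<open>auto simp: g_def[abs_def] g'_def intro!: DERIV_diff line\<close>, 
        use line[of _ 0] in simp)
    then obtain s where s: "0 < s" "s < h" "g h - g 0 = h * g' s" by auto
    have line2: "((\<lambda>t. f' (x + s *\<^sub>R a + t *\<^sub>R b) a) has_real_derivative fa (x + s *\<^sub>R a + t *\<^sub>R b) b) (at t)"
      if "0 \<le> t" "t \<le> h" for t
    proof -
      have F: "((\<lambda>z. f' z a) has_derivative fa (x + s *\<^sub>R a + t *\<^sub>R b)) (at (x + s *\<^sub>R a + t *\<^sub>R b))"
        using that h s by (intro fa inS[of s h t]) auto
      have "((\<lambda>t. x + s *\<^sub>R a + t *\<^sub>R b) has_derivative (\<lambda>k. k *\<^sub>R b)) (at t)"
        by (auto intro!: derivative_eq_intros)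
      from diff_chain_at[OF this F] linear_cmul[OF has_derivative_linear[OF F]]
      show ?thesis by (simp add: has_field_derivative_def o_def mult.commute[of _ "fa _ b"])
    qed
    have "\<exists>t. 0 < t \<and> t < h \<and> f' (x + s *\<^sub>R a + h *\<^sub>R b) a - f' (x + s *\<^sub>R a + 0 *\<^sub>R b) a
        = (h - 0) * fa (x + s *\<^sub>R a + t *\<^sub>R b) b"
      by (rule MVT2) (use h line2 in auto)
    then obtain t where t: "0 < t" "t < h" "g' s = h * fa (x + s *\<^sub>R a + t *\<^sub>R b) b"
      by (auto simp: g'_def)
    have "\<bar>fa (x + s *\<^sub>R a + t *\<^sub>R b) b - fa x b\<bar> < e"
      using r'(2)[of "x + s *\<^sub>R a + t *\<^sub>R b"] near[of s h t] s t h by (auto simp: dist_real_def)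
    then have "h * h * \<bar>fa (x + s *\<^sub>R a + t *\<^sub>R b) b - fa x b\<bar> < h * h * e" using h by simp
    moreover have "f (x + h *\<^sub>R a + h *\<^sub>R b) - f (x + h *\<^sub>R a) - f (x + h *\<^sub>R b) + f x
        = h * h * fa (x + s *\<^sub>R a + t *\<^sub>R b) b"
      using s(3) t(3) by (simp add: g_def)
    ultimately show "\<bar>f (x + h *\<^sub>R a + h *\<^sub>R b) - f (x + h *\<^sub>R a) - f (x + h *\<^sub>R b) + f x - h * h * fa x b\<bar> < h * h * e"
      using h by (simp add: abs_mult flip: right_diff_distrib)
  qed
qed

lemma second_derivative_symmetric_real:
  fixes f :: "'a::euclidean_space \<Rightarrow> real"
  assumes "smooth_on S f" "x \<in> S"
  shows "frechet_derivative (\<lambda>y. frechet_derivative f (at y) a) (at x) b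
       = frechet_derivative (\<lambda>y. frechet_derivative f (at y) b) (at x) a" (is "?H a b = ?H b a")
proof (rule ccontr)
  let ?h = "\<lambda>y a b. frechet_derivative (\<lambda>y. frechet_derivative f (at y) a) (at y) b"
  assume ne: "?H a b \<noteq> ?H b a"
  \<comment> \<open>Half of the gap: two estimates with error strictly below \<open>e\<close> then
    force the gap to be smaller than itself.\<close>
  define e where "e = \<bar>?H a b - ?H b a\<bar> / 2"
  have e: "e > 0" using ne by (simp add: e_def)
  have op: "open S" using assms(1) by (rule smooth_on_open)
  have sm: "smooth_on S (\<lambda>y. frechet_derivative f (at y) a)" for a
    by (rule smooth_on_derivative[OF assms(1) smooth_on_const[OF op]])
  have cont: "continuous (at x) (\<lambda>y. ?h y a b)" for a b
    using smooth_on_continuous_on[OF smooth_on_derivative[OF sm[of a] smooth_on_const[OF op, of b]]] op assms(2)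
    by (simp add: continuous_on_eq_continuous_at)
  note * = mixed_derivatives_real[OF op assms(2) smooth_on_has_derivative[OF assms(1)]
      smooth_on_has_derivative[OF sm] cont e]
  obtain d1 where d1: "d1 > 0" "\<And>h. 0 < h \<and> h < d1 \<Longrightarrow> 
    \<bar>f (x + h *\<^sub>R a + h *\<^sub>R b) - f (x + h *\<^sub>R a) - f (x + h *\<^sub>R b) + f x - h * h * ?H a b\<bar> < h * h * e"
    using *[of a b] by blast
  obtain d2 where d2: "d2 > 0" "\<And>h. 0 < h \<and> h < d2 \<Longrightarrow> 
    \<bar>f (x + h *\<^sub>R b + h *\<^sub>R a) - f (x + h *\<^sub>R b) - f (x + h *\<^sub>R a) + f x - h * h * ?H b a\<bar> < h * h * e"
    using *[of b a] by blast
  define h where "h = min d1 d2 / 2"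
  have h: "0 < h" "h < d1" "h < d2" using d1 d2 by (auto simp: h_def)
  have "x + h *\<^sub>R b + h *\<^sub>R a = x + h *\<^sub>R a + h *\<^sub>R b" by simp
  then have "\<bar>h * h * ?H a b - h * h * ?H b a\<bar> < h * h * e + h * h * e"
    using d1(2)[of h] d2(2)[of h] h by (smt (verit))
  then have "h * h * \<bar>?H a b - ?H b a\<bar> < h * h * (2 * e)"
    by (simp add: abs_mult mult_ac flip: right_diff_distrib)
  then show False using h by (simp add: e_def)
qed

lemma second_derivative_symmetric:
  fixes f :: "'a::euclidean_space \<Rightarrow> 'b::euclidean_space"
  assumes "smooth_on S f" "x \<in> S"
  shows "frechet_derivative (\<lambda>y. frechet_derivative f (at y) a) (at x) b
       = frechet_derivative (\<lambda>y. frechet_derivative f (at y) b) (at x) a"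
proof (rule euclidean_eqI)
  fix j :: 'b assume "j \<in> Basis"
  have op: "open S" using assms(1) by (rule smooth_on_open)
  have comp: "frechet_derivative (\<lambda>y. g y \<bullet> j) (at y) c = frechet_derivative g (at y) c \<bullet> j"
    if "smooth_on S g" "y \<in> S" for g :: "'a \<Rightarrow> 'b" and y c
    using frechet_derivative_at[OF has_derivative_inner_left[OF smooth_on_has_derivative[OF that]], of j]
    by metis
  have "frechet_derivative (\<lambda>y. frechet_derivative f (at y) a) (at x) b \<bullet> j
    = frechet_derivative (\<lambda>y. frechet_derivative (\<lambda>y. f y \<bullet> j) (at y) a) (at x) b" for a b
  proof -
    have "frechet_derivative (\<lambda>y. frechet_derivative f (at y) a) (at x) b \<bullet> j
      = frechet_derivative (\<lambda>y. frechet_derivative f (at y) a \<bullet> j) (at x) b"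
      by (rule comp[symmetric]) (use assms op in \<open>auto intro: smooth_on_derivative smooth_on_const\<close>)
    also have "\<dots> = frechet_derivative (\<lambda>y. frechet_derivative (\<lambda>y. f y \<bullet> j) (at y) a) (at x) b"
      by (rule fun_cong[OF frechet_derivative_cong[OF op assms(2)]]) (simp add: comp[OF assms(1)])
    finally show ?thesis .
  qed
  then show "frechet_derivative (\<lambda>y. frechet_derivative f (at y) a) (at x) b \<bullet> j
    = frechet_derivative (\<lambda>y. frechet_derivative f (at y) b) (at x) a \<bullet> j"
    by (simp add: second_derivative_symmetric_real[OF smooth_on_inner[OF assms(1) smooth_on_const[OF op]] assms(2), of _ a b])
qed

subsection \<open>Submanifolds and derivatives along them\<close>

text \<open>Passes from a local ambient extension to the derivative within \<open>M\<close>, a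
  notion that does not mention the extension.\<close>

lemma has_derivative_extension:
  assumes "smooth_on U g" "p \<in> M" "p \<in> U" "\<And>q. q \<in> M \<inter> U \<Longrightarrow> g q = f q"
  shows "(f has_derivative frechet_derivative g (at p)) (at p within M)"
proof -
  have "(g has_derivative frechet_derivative g (at p)) (at p within M)"
    using smooth_on_has_derivative[OF assms(1,3)] has_derivative_at_withinI by blast
  moreover have "\<forall>\<^sub>F q in at p within M. g q = f q"
    using assms(3,4) smooth_on_open[OF assms(1)] unfolding eventually_at_topological by blast
  ultimately show ?thesis
    using has_derivative_transform_eventually assms by (metis IntI)
qed

text \<open>As linear maps on the ambient space, derivatives within \<open>M\<close> need not be
  unique. On the velocity of a curve in \<open>M\<close> they are, because both values are the
  ordinary derivative of \<open>f\<close> along the curve.\<close>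

lemma tangent_derivative_unique:
  assumes "v \<in> tangent M p" "(f has_derivative D1) (at p within M)" "(f has_derivative D2) (at p within M)"
  shows "D1 v = D2 v"
proof -
  obtain \<gamma> e where \<gamma>: "e > 0" "\<gamma> 0 = p" "\<gamma> ` {-e<..<e} \<subseteq> M" "(\<gamma> has_vector_derivative v) (at 0)"
    using assms(1) unfolding tangent_def by auto
  have *: "((\<lambda>t. f (\<gamma> t)) has_vector_derivative D v) (at 0)" if "(f has_derivative D) (at p within M)" for D
  proof -
    have 1: "(\<gamma> has_derivative (\<lambda>t. t *\<^sub>R v)) (at 0 within {-e<..<e})"
      using \<gamma>(4) by (simp add: has_vector_derivative_def has_derivative_at_withinI)
    have 2: "(f has_derivative D) (at (\<gamma> 0) within \<gamma> ` {-e<..<e})"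
      using that \<gamma>(2,3) has_derivative_subset by metis
    have "((\<lambda>t. f (\<gamma> t)) has_derivative (\<lambda>t. t *\<^sub>R D v)) (at 0 within {-e<..<e})"
      using diff_chain_within[OF 1 2] linear_cmul[OF has_derivative_linear[OF that]] by (simp add: o_def)
    moreover have "at 0 within {-e<..<e} = at 0" using \<gamma>(1) by (intro at_within_open) auto
    ultimately show ?thesis by (simp only: has_vector_derivative_def)
  qed
  show ?thesis using *[OF assms(2)] *[OF assms(3)] by (rule vector_derivative_unique_at)
qed

text \<open>Frees \<open>mdiff\<close> from its choice operator: whichever extension was chosen
  yields a derivative within \<open>M\<close>, and these agree on tangent vectors.\<close>

lemma mdiff_eqI:
  assumes "msmooth M f" "p \<in> M" "(f has_derivative D) (at p within M)" "v \<in> tangent M p"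
  shows "mdiff M f p v = D v"
proof -
  let ?P = "\<lambda>d. \<exists>U g. open U \<and> p \<in> U \<and> smooth_on U g \<and>
      (\<forall>q\<in>M \<inter> U. g q = f q) \<and> frechet_derivative g (at p) v = d"
  have "\<exists>d. ?P d" using assms(1,2) unfolding msmooth_def by metis
  then have "?P (mdiff M f p v)" unfolding mdiff_def by (rule someI_ex)
  then obtain U g where "open U" "p \<in> U" "smooth_on U g" "\<And>q. q\<in>M \<inter> U \<Longrightarrow> g q = f q"
     and eq: "frechet_derivative g (at p) v = mdiff M f p v" by auto
  then have "(f has_derivative frechet_derivative g (at p)) (at p within M)"
    using has_derivative_extension assms(2) by metis
  from tangent_derivative_unique[OF assms(4,3) this] eq show ?thesis by simp
qed

lemma msmooth_has_derivative:
  assumes "msmooth M f" "p \<in> M"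
  obtains D where "(f has_derivative D) (at p within M)" "\<And>v. v \<in> tangent M p \<Longrightarrow> mdiff M f p v = D v"
proof -
  obtain U g where "open U" "p \<in> U" "smooth_on U g" "\<And>q. q\<in>M \<inter> U \<Longrightarrow> g q = f q"
    using assms unfolding msmooth_def by metis
  then have "(f has_derivative frechet_derivative g (at p)) (at p within M)"
    using has_derivative_extension assms(2) by metis
  then show ?thesis using that mdiff_eqI[OF assms] by blast
qed

lemma mdiff_extension:
  assumes "smooth_on U g" "p \<in> M" "p \<in> U" "\<And>q. q \<in> M \<inter> U \<Longrightarrow> g q = f q" "msmooth M f" "v \<in> tangent M p"
  shows "mdiff M f p v = frechet_derivative g (at p) v"
  by (rule mdiff_eqI[OF assms(5,2) has_derivative_extension[OF assms(1-4)] assms(6)])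

section \<open>Smooth maps on subsets and their differentials\<close>

lemma msmoothE:
  assumes "msmooth M f" "p \<in> M"
  obtains U g where "open U" "p \<in> U" "smooth_on U g" "\<And>q. q \<in> M \<Longrightarrow> q \<in> U \<Longrightarrow> g q = f q"
  using assms unfolding msmooth_def by (metis IntI)

lemma msmoothI:
  assumes "\<And>p. p \<in> M \<Longrightarrow> \<exists>U g. p \<in> U \<and> smooth_on U g \<and> (\<forall>q\<in>M \<inter> U. g q = f q)"
  shows "msmooth M f"
  using assms smooth_on_open unfolding msmooth_def by metis

lemma msmooth_cong: "msmooth M f \<Longrightarrow> (\<And>q. q \<in> M \<Longrightarrow> f q = g q) \<Longrightarrow> msmooth M g"
  unfolding msmooth_def by (metis IntD1)

lemma msmooth_smooth_on: "smooth_on UNIV f \<Longrightarrow> msmooth M f"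
  unfolding msmooth_def by blast

lemma msmooth_const: "msmooth M (\<lambda>x. c)"
  by (simp add: msmooth_smooth_on smooth_on_const)

lemma msmooth_ident: "msmooth M (\<lambda>x. x)"
  by (simp add: msmooth_smooth_on smooth_on_ident)

lemma msmooth_bounded_linear:
  assumes "bounded_linear L" "msmooth M f"
  shows "msmooth M (\<lambda>x. L (f x))"
  using assms smooth_on_bounded_linear[OF assms(1)] unfolding msmooth_def by metis

lemma msmooth_combine:
  fixes M :: "'a::euclidean_space set"
  assumes "msmooth M f" "msmooth M g"
    and "\<And>(U::'a::euclidean_space set) f g. smooth_on U f \<Longrightarrow> smooth_on U g \<Longrightarrow> smooth_on U (\<lambda>x. B (f x) (g x))"
  shows "msmooth M (\<lambda>x. B (f x) (g x))"
proof (rule msmoothI)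
  fix p assume p: "p \<in> M"
  obtain U f' where U: "open U" "p \<in> U" "smooth_on U f'" "\<And>q. q \<in> M \<Longrightarrow> q \<in> U \<Longrightarrow> f' q = f q"
    using msmoothE[OF assms(1) p] by blast
  obtain V g' where V: "open V" "p \<in> V" "smooth_on V g'" "\<And>q. q \<in> M \<Longrightarrow> q \<in> V \<Longrightarrow> g' q = g q"
    using msmoothE[OF assms(2) p] by blast
  have "smooth_on (U \<inter> V) (\<lambda>x. B (f' x) (g' x))"
    using U V by (intro assms(3)) (auto intro: smooth_on_subset)
  then show "\<exists>U h. p \<in> U \<and> smooth_on U h \<and> (\<forall>q\<in>M \<inter> U. h q = B (f q) (g q))"
    using U V by (intro exI[of _ "U \<inter> V"] exI[of _ "\<lambda>x. B (f' x) (g' x)"]) auto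
qed

lemma msmooth_add: "msmooth M f \<Longrightarrow> msmooth M g \<Longrightarrow> msmooth M (\<lambda>x. f x + g x)"
  by (rule msmooth_combine[OF _ _ smooth_on_add])

lemma msmooth_diff: "msmooth M f \<Longrightarrow> msmooth M g \<Longrightarrow> msmooth M (\<lambda>x. f x - g x)"
  by (rule msmooth_combine[OF _ _ smooth_on_diff])

lemma msmooth_inner: "msmooth M f \<Longrightarrow> msmooth M g \<Longrightarrow> msmooth M (\<lambda>x. f x \<bullet> g x)"
  by (rule msmooth_combine[OF _ _ smooth_on_inner])

lemma msmooth_compose:
  assumes "msmooth N g" "msmooth M f" "f ` M \<subseteq> N"
  shows "msmooth M (\<lambda>x. g (f x))"
proof (rule msmoothI)
  fix p assume p: "p \<in> M"
  obtain U f' where U: "open U" "p \<in> U" "smooth_on U f'" "\<And>q. q \<in> M \<Longrightarrow> q \<in> U \<Longrightarrow> f' q = f q"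
    using msmoothE[OF assms(2) p] by blast
  have "f p \<in> N" using assms(3) p by blast
  then obtain V g' where V: "open V" "f p \<in> V" "smooth_on V g'" "\<And>q. q \<in> N \<Longrightarrow> q \<in> V \<Longrightarrow> g' q = g q"
    using msmoothE[OF assms(1)] by blast
  let ?W = "{x \<in> U. f' x \<in> V}"
  have "open ?W" by (rule smooth_on_open_vimage[OF U(3) V(1)])
  then have "smooth_on ?W (\<lambda>x. g' (f' x))"
    by (intro smooth_on_compose[OF V(3)] smooth_on_subset[OF U(3)]) auto
  moreover have "p \<in> ?W" using U p V by auto
  moreover have "\<forall>q\<in>M \<inter> ?W. g' (f' q) = g (f q)" using U(4) V(4) assms(3) by auto
  ultimately show "\<exists>U h. p \<in> U \<and> smooth_on U h \<and> (\<forall>q\<in>M \<inter> U. h q = g (f q))"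
    by (intro exI[of _ ?W] exI[of _ "\<lambda>x. g' (f' x)"] conjI)
qed

lemma mdiff_in_tangent:
  assumes "msmooth M f" "f ` M \<subseteq> N" "p \<in> M" "v \<in> tangent M p"
  shows "mdiff M f p v \<in> tangent N (f p)"
proof -
  obtain U g where U: "open U" "p \<in> U" "smooth_on U g" "\<And>q. q \<in> M \<Longrightarrow> q \<in> U \<Longrightarrow> g q = f q"
    using msmoothE[OF assms(1,3)] by blast
  obtain \<gamma> e where \<gamma>: "e > 0" "\<gamma> 0 = p" "\<gamma> ` {-e<..<e} \<subseteq> M" "smooth_on {-e<..<e} \<gamma>"
      "(\<gamma> has_vector_derivative v) (at 0)"
    using assms(4) unfolding tangent_def by auto
  let ?I = "{t \<in> {-e<..<e}. \<gamma> t \<in> U}"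
  have "open ?I" by (rule smooth_on_open_vimage[OF \<gamma>(4) U(1)])
  moreover have "0 \<in> ?I" using \<gamma> U by auto
  ultimately obtain d where d: "d > 0" "ball 0 d \<subseteq> ?I" using open_contains_ball by blast
  then have I: "{-d<..<d} \<subseteq> ?I" by (auto simp: ball_eq_greaterThanLessThan)
  have "smooth_on {-d<..<d} (\<lambda>t. g (\<gamma> t))"
    using I by (intro smooth_on_compose[OF U(3)] smooth_on_subset[OF \<gamma>(4)]) auto
  moreover have "(\<lambda>t. g (\<gamma> t)) ` {-d<..<d} \<subseteq> N" using I U(4) \<gamma>(3) assms(2) by fastforce
  moreover have "((\<lambda>t. g (\<gamma> t)) has_vector_derivative frechet_derivative g (at p) v) (at 0)"
  proof -
    have G: "(g has_derivative frechet_derivative g (at p)) (at (\<gamma> 0))"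
      using smooth_on_has_derivative[OF U(3,2)] \<gamma>(2) by simp
    from diff_chain_at[OF \<gamma>(5)[unfolded has_vector_derivative_def] G]
    show ?thesis using linear_cmul[OF has_derivative_linear[OF G]]
      by (simp add: has_vector_derivative_def o_def)
  qed
  moreover have "g (\<gamma> 0) = f p" using \<gamma>(2) U(2,4) assms(3) by simp
  ultimately have "frechet_derivative g (at p) v \<in> tangent N (f p)"
    unfolding tangent_def mem_Collect_eq using d(1)
    by (intro exI[of _ "\<lambda>t. g (\<gamma> t)"] exI[of _ d] conjI)
  then show ?thesis using mdiff_extension[OF U(3) assms(3) U(2) _ assms(1,4)] U(4) by simp
qed

lemma mdiff_compose:
  assumes "msmooth N g" "msmooth M f" "f ` M \<subseteq> N" "p \<in> M" "v \<in> tangent M p"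
  shows "mdiff M (\<lambda>x. g (f x)) p v = mdiff N g (f p) (mdiff M f p v)"
proof -
  obtain D where D: "(f has_derivative D) (at p within M)" "mdiff M f p v = D v"
    using msmooth_has_derivative[OF assms(2,4)] assms(5) by metis
  have fp: "f p \<in> N" using assms(3,4) by auto
  obtain E where E: "(g has_derivative E) (at (f p) within N)" "mdiff N g (f p) (mdiff M f p v) = E (mdiff M f p v)"
    using msmooth_has_derivative[OF assms(1) fp] mdiff_in_tangent[OF assms(2-5)] by metis
  have "((\<lambda>x. g (f x)) has_derivative (\<lambda>x. E (D x))) (at p within M)"
    using diff_chain_within[OF D(1) has_derivative_subset[OF E(1) assms(3)]] by (simp add: o_def)
  from mdiff_eqI[OF msmooth_compose[OF assms(1-3)] assms(4) this assms(5)] D(2) E(2) show ?thesis by simp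
qed

lemma mdiff_ident: "p \<in> M \<Longrightarrow> v \<in> tangent M p \<Longrightarrow> mdiff M (\<lambda>x. x) p v = v"
  using mdiff_eqI[OF msmooth_ident] has_derivative_ident by metis

lemma msmooth_mdiff_field:
  assumes "msmooth M f" "msmooth M V" "\<And>q. q \<in> M \<Longrightarrow> V q \<in> tangent M q"
  shows "msmooth M (\<lambda>q. mdiff M f q (V q))"
proof (rule msmoothI)
  fix p assume p: "p \<in> M"
  obtain U f' where U: "open U" "p \<in> U" "smooth_on U f'" "\<And>q. q \<in> M \<Longrightarrow> q \<in> U \<Longrightarrow> f' q = f q"
    using msmoothE[OF assms(1) p] by blast
  obtain W V' where W: "open W" "p \<in> W" "smooth_on W V'" "\<And>q. q \<in> M \<Longrightarrow> q \<in> W \<Longrightarrow> V' q = V q"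
    using msmoothE[OF assms(2) p] by blast
  have "smooth_on (U \<inter> W) (\<lambda>x. frechet_derivative f' (at x) (V' x))"
    using U W by (intro smooth_on_derivative) (auto intro: smooth_on_subset)
  moreover have "frechet_derivative f' (at q) (V' q) = mdiff M f q (V q)" if "q \<in> M \<inter> (U \<inter> W)" for q
    using mdiff_extension[OF U(3), of q M f "V q"] that U W assms by auto
  ultimately show "\<exists>U h. p \<in> U \<and> smooth_on U h \<and> (\<forall>q\<in>M \<inter> U. h q = mdiff M f q (V q))"
    using U W by (intro exI[of _ "U \<inter> W"] exI[of _ "\<lambda>x. frechet_derivative f' (at x) (V' x)"]) auto
qed

section \<open>Charts that flatten a submanifold to a linear subspace\<close>

locale slice_chart =
  fixes M U V S :: "'e::euclidean_space set" and \<Phi> \<Psi> :: "'e \<Rightarrow> 'e"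
  assumes smooth_Phi: "smooth_on U \<Phi>" and smooth_Psi: "smooth_on V \<Psi>"
    and Phi_mem: "q \<in> U \<Longrightarrow> \<Phi> q \<in> V" and Psi_mem: "y \<in> V \<Longrightarrow> \<Psi> y \<in> U"
    and Psi_Phi: "q \<in> U \<Longrightarrow> \<Psi> (\<Phi> q) = q" and Phi_Psi: "y \<in> V \<Longrightarrow> \<Phi> (\<Psi> y) = y"
    and subspace_S: "subspace S" and slice: "q \<in> U \<Longrightarrow> \<Phi> q \<in> S \<longleftrightarrow> q \<in> M"
begin

lemma derivative_Psi_Phi:
  assumes "q \<in> U"
  shows "frechet_derivative \<Psi> (at (\<Phi> q)) (frechet_derivative \<Phi> (at q) v) = v"
proof -
  have "((\<lambda>x. \<Psi> (\<Phi> x)) has_derivative (\<lambda>v. frechet_derivative \<Psi> (at (\<Phi> q)) (frechet_derivative \<Phi> (at q) v))) (at q)"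
    using diff_chain_at[OF smooth_on_has_derivative[OF smooth_Phi assms]
        smooth_on_has_derivative[OF smooth_Psi Phi_mem[OF assms]]] by (simp add: o_def)
  then have "((\<lambda>x. x) has_derivative (\<lambda>v. frechet_derivative \<Psi> (at (\<Phi> q)) (frechet_derivative \<Phi> (at q) v))) (at q)"
    using has_derivative_transform_within_open[OF _ smooth_on_open[OF smooth_Phi] assms] Psi_Phi by metis
  from has_derivative_unique[OF this has_derivative_ident] show ?thesis by meson
qed

lemma derivative_Phi_Psi:
  assumes "q \<in> U"
  shows "frechet_derivative \<Phi> (at q) (frechet_derivative \<Psi> (at (\<Phi> q)) v) = v"
proof -
  have "((\<lambda>x. \<Phi> (\<Psi> x)) has_derivative (\<lambda>v. frechet_derivative \<Phi> (at q) (frechet_derivative \<Psi> (at (\<Phi> q)) v))) (at (\<Phi> q))"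
    using diff_chain_at[OF smooth_on_has_derivative[OF smooth_Psi Phi_mem[OF assms]], of \<Phi>]
      smooth_on_has_derivative[OF smooth_Phi assms] Psi_Phi[OF assms] by (simp add: o_def)
  then have "((\<lambda>x. x) has_derivative (\<lambda>v. frechet_derivative \<Phi> (at q) (frechet_derivative \<Psi> (at (\<Phi> q)) v))) (at (\<Phi> q))"
    using has_derivative_transform_within_open[OF _ smooth_on_open[OF smooth_Psi] Phi_mem[OF assms]] Phi_Psi by metis
  from has_derivative_unique[OF this has_derivative_ident] show ?thesis by meson
qed

text \<open>A curve in \<open>M\<close> read in the chart stays in \<open>S\<close>, and so does its
  velocity; conversely the straight line through \<open>\<Phi> p\<close> in direction
  \<open>a \<in> S\<close> pulls back to a curve in \<open>M\<close>.\<close>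

lemma tangent_slice:
  assumes "p \<in> M" "p \<in> U"
  shows "tangent M p = frechet_derivative \<Psi> (at (\<Phi> p)) ` S"
proof (intro equalityI subsetI)
  fix v assume "v \<in> tangent M p"
  then obtain \<gamma> e where \<gamma>: "e > 0" "\<gamma> 0 = p" "\<gamma> ` {-e<..<e} \<subseteq> M" "smooth_on {-e<..<e} \<gamma>"
      "(\<gamma> has_vector_derivative v) (at 0)"
    unfolding tangent_def by auto
  have D: "(\<Phi> has_derivative frechet_derivative \<Phi> (at p)) (at (\<gamma> 0))"
    using smooth_on_has_derivative[OF smooth_Phi assms(2)] \<gamma>(2) by simp
  from diff_chain_at[OF \<gamma>(5)[unfolded has_vector_derivative_def] D]
  have "((\<lambda>t. \<Phi> (\<gamma> t)) has_vector_derivative frechet_derivative \<Phi> (at p) v) (at 0)"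
    using linear_cmul[OF has_derivative_linear[OF D]] by (simp add: has_vector_derivative_def o_def)
  note D\<gamma> = this
  let ?I = "{t \<in> {-e<..<e}. \<gamma> t \<in> U}"
  have opI: "open ?I" by (rule smooth_on_open_vimage[OF \<gamma>(4) smooth_on_open[OF smooth_Phi]])
  have 0: "0 \<in> ?I" using \<gamma> assms by auto
  \<comment> \<open>Membership in \<open>S\<close> is tested against vectors orthogonal to
    \<open>S\<close>, where the curve has a constant zero inner product.\<close>
  have orth: "frechet_derivative \<Phi> (at p) v \<bullet> w = 0" if w: "\<And>s. s \<in> S \<Longrightarrow> s \<bullet> w = 0" for w
  proof -
    have "((\<lambda>t. \<Phi> (\<gamma> t) \<bullet> w) has_vector_derivative frechet_derivative \<Phi> (at p) v \<bullet> w) (at 0)"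
      by (rule bounded_linear.has_vector_derivative[OF bounded_linear_inner_left D\<gamma>])
    moreover have "\<Phi> (\<gamma> t) \<bullet> w = 0" if "t \<in> ?I" for t
      using w[of "\<Phi> (\<gamma> t)"] slice[of "\<gamma> t"] \<gamma>(3) that by (auto simp: image_subset_iff)
    ultimately have "((\<lambda>t. 0) has_vector_derivative frechet_derivative \<Phi> (at p) v \<bullet> w) (at 0)"
      by (rule has_vector_derivative_transform_within_open[OF _ opI 0])
    from vector_derivative_unique_at[OF this has_vector_derivative_const] show ?thesis .
  qed
  obtain y z where yz: "y \<in> span S" "\<And>w. w \<in> span S \<Longrightarrow> orthogonal z w"
      "frechet_derivative \<Phi> (at p) v = y + z"
    using orthogonal_subspace_decomp_exists[of S "frechet_derivative \<Phi> (at p) v"] by metis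
  have "z \<bullet> z = 0"
    using orth[of z] yz(2)[OF yz(1)] yz(2)[OF span_base] unfolding yz(3)
    by (simp add: orthogonal_def inner_commute inner_add_right)
  moreover have "span S = S" using subspace_S by (simp only: span_eq_iff)
  ultimately have "frechet_derivative \<Phi> (at p) v \<in> S"
    using yz(1,3) by (metis add.right_neutral inner_eq_zero_iff)
  then show "v \<in> frechet_derivative \<Psi> (at (\<Phi> p)) ` S"
    using derivative_Psi_Phi[OF assms(2), of v] by (metis imageI)
next
  fix v assume "v \<in> frechet_derivative \<Psi> (at (\<Phi> p)) ` S"
  then obtain a where a: "a \<in> S" "v = frechet_derivative \<Psi> (at (\<Phi> p)) a" by auto
  have lin: "smooth_on UNIV (\<lambda>t::real. \<Phi> p + t *\<^sub>R a)"
    by (intro smooth_on_add smooth_on_const smooth_on_scaleR smooth_on_ident) auto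
  let ?I = "{t \<in> UNIV. \<Phi> p + t *\<^sub>R a \<in> V}"
  have "open ?I" by (rule smooth_on_open_vimage[OF lin smooth_on_open[OF smooth_Psi]])
  moreover have "0 \<in> ?I" using Phi_mem assms by auto
  ultimately obtain d where d: "d > 0" "ball 0 d \<subseteq> ?I" using open_contains_ball by blast
  then have I: "{-d<..<d} \<subseteq> ?I" by (auto simp: ball_eq_greaterThanLessThan)
  have "smooth_on {-d<..<d} (\<lambda>t. \<Psi> (\<Phi> p + t *\<^sub>R a))"
    using I by (intro smooth_on_compose[OF smooth_Psi] smooth_on_subset[OF lin]) auto
  moreover have "(\<lambda>t. \<Psi> (\<Phi> p + t *\<^sub>R a)) ` {-d<..<d} \<subseteq> M"
  proof clarify
    fix t :: real assume "t \<in> {-d<..<d}"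
    then have "\<Phi> p + t *\<^sub>R a \<in> V" using I by auto
    moreover have "\<Phi> p + t *\<^sub>R a \<in> S" using subspace_S a slice assms by (simp add: subspace_add subspace_scale)
    ultimately show "\<Psi> (\<Phi> p + t *\<^sub>R a) \<in> M" using slice Phi_Psi Psi_mem by metis
  qed
  moreover have "((\<lambda>t. \<Psi> (\<Phi> p + t *\<^sub>R a)) has_vector_derivative v) (at 0)"
  proof -
    have D: "(\<Psi> has_derivative frechet_derivative \<Psi> (at (\<Phi> p))) (at (\<Phi> p + 0 *\<^sub>R a))"
      using smooth_on_has_derivative[OF smooth_Psi Phi_mem[OF assms(2)]] by simp
    have "((\<lambda>t. \<Phi> p + t *\<^sub>R a) has_derivative (\<lambda>k. k *\<^sub>R a)) (at 0)"
      by (auto intro!: derivative_eq_intros)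
    from diff_chain_at[OF this D] show ?thesis
      using linear_cmul[OF has_derivative_linear[OF D]] by (simp add: a(2) has_vector_derivative_def o_def)
  qed
  ultimately show "v \<in> tangent M p"
    unfolding tangent_def mem_Collect_eq using d(1) Psi_Phi[OF assms(2)]
    by (intro exI[of _ "\<lambda>t. \<Psi> (\<Phi> p + t *\<^sub>R a)"] exI[of _ d] conjI) auto
qed

lemma linear_Psi: "q \<in> U \<Longrightarrow> linear (frechet_derivative \<Psi> (at (\<Phi> q)))"
  using smooth_on_linear[OF smooth_Psi Phi_mem] .

lemma subspace_tangent_slice: "p \<in> M \<Longrightarrow> p \<in> U \<Longrightarrow> subspace (tangent M p)"
  using tangent_slice linear_Psi subspace_S linear_subspace_image by metis

lemma dim_tangent_slice: "p \<in> M \<Longrightarrow> p \<in> U \<Longrightarrow> dim (tangent M p) = dim S"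
proof -
  assume p: "p \<in> M" "p \<in> U"
  have "inj (frechet_derivative \<Psi> (at (\<Phi> p)))"
    using derivative_Phi_Psi[OF p(2)] by (metis injI)
  then show "dim (tangent M p) = dim S"
    using tangent_slice[OF p] dim_image_eq[OF linear_Psi[OF p(2)]] inj_on_subset by (metis subset_UNIV)
qed

text \<open>Since \<open>\<Psi>\<close> inverts an ambient diffeomorphism, coordinate fields are
  smooth on the open set \<open>U\<close> and not merely along \<open>M\<close>.\<close>

lemma smooth_coordinate_field: "smooth_on U (\<lambda>q. frechet_derivative \<Psi> (at (\<Phi> q)) a)"
  by (rule smooth_on_compose[OF smooth_on_derivative[OF smooth_Psi smooth_on_const[OF smooth_on_open[OF smooth_Psi]]]
        smooth_Phi]) (auto simp: Phi_mem)

text \<open>Differentiating \<open>f\<close> along a coordinate field is taking a partial derivative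
  of \<open>g\<close> composed with \<open>\<Psi>\<close>. A second differentiation along
  \<open>M\<close> thus becomes a second partial derivative on an open set, where symmetry is
  available.\<close>

lemma coordinate_derivative:
  fixes g :: "'e \<Rightarrow> 'b::euclidean_space"
  assumes p: "p \<in> M" "p \<in> U" and f: "msmooth M f"
    and g: "open W" "p \<in> W" "smooth_on W g" "\<And>q. q \<in> M \<Longrightarrow> q \<in> W \<Longrightarrow> g q = f q"
    and a: "a \<in> S" and b: "b \<in> S"
  obtains D where
    "((\<lambda>q. mdiff M f q (frechet_derivative \<Psi> (at (\<Phi> q)) a)) has_derivative D) (at p within M)"
    "D (frechet_derivative \<Psi> (at (\<Phi> p)) b)
      = frechet_derivative (\<lambda>y. frechet_derivative (\<lambda>y. g (\<Psi> y)) (at y) a) (at (\<Phi> p)) b"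
proof -
  let ?V = "{y \<in> V. \<Psi> y \<in> W}"
  let ?h = "\<lambda>y. g (\<Psi> y)"
  have opV: "open ?V" by (rule smooth_on_open_vimage[OF smooth_Psi g(1)])
  have h: "smooth_on ?V ?h"
    using opV by (intro smooth_on_compose[OF g(3)] smooth_on_subset[OF smooth_Psi]) auto
  have dh: "smooth_on ?V (\<lambda>y. frechet_derivative ?h (at y) a)"
    by (rule smooth_on_derivative[OF h smooth_on_const[OF opV]])
  have mem: "\<Phi> q \<in> ?V" if "q \<in> U \<inter> W" for q using that Phi_mem Psi_Phi by auto
  have eq: "mdiff M f q (frechet_derivative \<Psi> (at (\<Phi> q)) a) = frechet_derivative ?h (at (\<Phi> q)) a"
    if q: "q \<in> M" "q \<in> U \<inter> W" for q
  proof -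
    have 1: "(\<Psi> has_derivative frechet_derivative \<Psi> (at (\<Phi> q))) (at (\<Phi> q))"
      using smooth_on_has_derivative[OF smooth_Psi] Phi_mem q by blast
    have 2: "(g has_derivative frechet_derivative g (at q)) (at (\<Psi> (\<Phi> q)))"
      using smooth_on_has_derivative[OF g(3)] Psi_Phi q by simp
    have "frechet_derivative ?h (at (\<Phi> q)) = (\<lambda>v. frechet_derivative g (at q) (frechet_derivative \<Psi> (at (\<Phi> q)) v))"
      using frechet_derivative_at[OF diff_chain_at[OF 1 2]] by (simp add: o_def)
    moreover have "frechet_derivative \<Psi> (at (\<Phi> q)) a \<in> tangent M q" using tangent_slice q a by auto
    ultimately show ?thesis using mdiff_extension[OF g(3) q(1)] q f g(4) by auto
  qed
  \<comment> \<open>The inner \<open>frechet_derivative \<Phi> (at p)\<close> translates tangent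
    vectors to chart coordinates; on coordinate vectors it cancels by
    \<open>derivative_Phi_Psi\<close>.\<close>
  let ?D = "\<lambda>v. frechet_derivative (\<lambda>y. frechet_derivative ?h (at y) a) (at (\<Phi> p)) (frechet_derivative \<Phi> (at p) v)"
  have "((\<lambda>q. frechet_derivative ?h (at (\<Phi> q)) a) has_derivative ?D) (at p)"
    using diff_chain_at[OF smooth_on_has_derivative[OF smooth_Phi p(2)] smooth_on_has_derivative[OF dh mem[of p]]] p g(2)
    by (simp add: o_def)
  then have "((\<lambda>q. frechet_derivative ?h (at (\<Phi> q)) a) has_derivative ?D) (at p within M)"
    by (rule has_derivative_at_withinI)
  moreover have "\<forall>\<^sub>F q in at p within M.
      frechet_derivative ?h (at (\<Phi> q)) a = mdiff M f q (frechet_derivative \<Psi> (at (\<Phi> q)) a)"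
    unfolding eventually_at_topological using eq smooth_on_open[OF smooth_Phi] g(1,2) p(2)
    by (intro exI[of _ "U \<inter> W"]) auto
  ultimately have "((\<lambda>q. mdiff M f q (frechet_derivative \<Psi> (at (\<Phi> q)) a)) has_derivative ?D) (at p within M)"
    by (rule has_derivative_transform_eventually) (use eq p g in auto)
  from that[OF this] derivative_Phi_Psi[OF p(2)] show thesis by simp
qed

end

lemma submanifold_chart:
  fixes M :: "'e::euclidean_space set"
  assumes "submanifold k M" "p \<in> M"
  obtains U V S \<Phi> \<Psi> where "slice_chart M U V S \<Phi> \<Psi>" "p \<in> U" "dim S = k"
proof -
  obtain U V and \<Phi> :: "'e \<Rightarrow> 'e" and S where *: "open U" "p \<in> U" "open V" "smooth_on U \<Phi>"
      "smooth_on V (inv_into U \<Phi>)" "bij_betw \<Phi> U V" "subspace S" "dim S = k"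
      "\<Phi> ` (M \<inter> U) = V \<inter> S"
    using assms unfolding submanifold_def by metis
  have inj: "inj_on \<Phi> U" and im: "\<Phi> ` U = V" using *(6) by (auto simp: bij_betw_def)
  have "slice_chart M U V S \<Phi> (inv_into U \<Phi>)"
  proof
    show "\<Phi> q \<in> S \<longleftrightarrow> q \<in> M" if "q \<in> U" for q
    proof
      assume "\<Phi> q \<in> S"
      then have "\<Phi> q \<in> \<Phi> ` (M \<inter> U)" using *(9) im that by auto
      then show "q \<in> M" using inj that by (auto dest: inj_onD)
    next
      assume "q \<in> M"
      then show "\<Phi> q \<in> S" using *(9) that by blast
    qed
  qed (use * inj im in \<open>auto simp: inv_into_into f_inv_into_f\<close>)
  then show thesis using that * by blast
qed

lemma subspace_tangent: "submanifold k M \<Longrightarrow> p \<in> M \<Longrightarrow> subspace (tangent M p)"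
  by (metis submanifold_chart slice_chart.subspace_tangent_slice)

lemma dim_tangent: "submanifold k M \<Longrightarrow> p \<in> M \<Longrightarrow> dim (tangent M p) = k"
  by (metis submanifold_chart slice_chart.dim_tangent_slice)

lemma linear_mdiff:
  assumes "submanifold k M" "p \<in> M" "msmooth M f" "u \<in> tangent M p" "v \<in> tangent M p"
  shows "mdiff M f p (u + v) = mdiff M f p u + mdiff M f p v"
    and "mdiff M f p (c *\<^sub>R v) = c *\<^sub>R mdiff M f p v"
proof -
  obtain D where D: "(f has_derivative D) (at p within M)" "\<And>v. v \<in> tangent M p \<Longrightarrow> mdiff M f p v = D v"
    using msmooth_has_derivative[OF assms(3,2)] by blast
  have sub: "u + v \<in> tangent M p" "c *\<^sub>R v \<in> tangent M p"
    using subspace_tangent[OF assms(1,2)] assms(4,5) by (auto intro: subspace_add subspace_scale)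
  show "mdiff M f p (u + v) = mdiff M f p u + mdiff M f p v" "mdiff M f p (c *\<^sub>R v) = c *\<^sub>R mdiff M f p v"
    using D sub assms has_derivative_linear[OF D(1)] by (auto simp: linear_add linear_cmul)
qed

text \<open>Coordinate fields of a slice chart commute, so second derivatives along them are symmetric.\<close>

lemma commuting_extension:
  fixes M :: "'e::euclidean_space set"
  assumes "submanifold k M" "p \<in> M" "X \<in> tangent M p" "Y \<in> tangent M p"
  obtains U Xh Yh where "open U" "p \<in> U" "Xh p = X" "Yh p = Y"
    "\<And>q. q \<in> M \<inter> U \<Longrightarrow> Xh q \<in> tangent M q" "\<And>q. q \<in> M \<inter> U \<Longrightarrow> Yh q \<in> tangent M q"
    "\<And>f :: 'e \<Rightarrow> 'e. msmooth M f \<Longrightarrow> \<exists>D E. ((\<lambda>q. mdiff M f q (Xh q)) has_derivative D) (at p within M) \<and>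
        ((\<lambda>q. mdiff M f q (Yh q)) has_derivative E) (at p within M) \<and> D Y = E X"
proof -
  obtain U V S \<Phi> \<Psi> where C: "slice_chart M U V S \<Phi> \<Psi>" "p \<in> U" "dim S = k"
    by (rule submanifold_chart[OF assms(1,2)])
  interpret slice_chart M U V S \<Phi> \<Psi> by (rule C(1))
  obtain a b where a: "a \<in> S" "X = frechet_derivative \<Psi> (at (\<Phi> p)) a"
    and b: "b \<in> S" "Y = frechet_derivative \<Psi> (at (\<Phi> p)) b"
    using assms tangent_slice[OF assms(2) C(2)] by auto
  show thesis
  proof (rule that[of U "\<lambda>q. frechet_derivative \<Psi> (at (\<Phi> q)) a" "\<lambda>q. frechet_derivative \<Psi> (at (\<Phi> q)) b"])
    fix f :: "'e \<Rightarrow> 'e" assume f: "msmooth M f"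
    then obtain W g where g: "open W" "p \<in> W" "smooth_on W g" "\<And>q. q \<in> M \<Longrightarrow> q \<in> W \<Longrightarrow> g q = f q"
      using msmoothE assms(2) by blast
    let ?V = "{y \<in> V. \<Psi> y \<in> W}"
    have opV: "open ?V" by (rule smooth_on_open_vimage[OF smooth_Psi g(1)])
    have h: "smooth_on ?V (\<lambda>y. g (\<Psi> y))"
      using opV by (intro smooth_on_compose[OF g(3)] smooth_on_subset[OF smooth_Psi]) auto
    have mem: "\<Phi> p \<in> ?V" using Phi_mem Psi_Phi C(2) g by auto
    obtain D where D: "((\<lambda>q. mdiff M f q (frechet_derivative \<Psi> (at (\<Phi> q)) a)) has_derivative D) (at p within M)"
      "D Y = frechet_derivative (\<lambda>y. frechet_derivative (\<lambda>y. g (\<Psi> y)) (at y) a) (at (\<Phi> p)) b"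
      unfolding b(2) by (rule coordinate_derivative[OF assms(2) C(2) f g a(1) b(1)])
    obtain E where E: "((\<lambda>q. mdiff M f q (frechet_derivative \<Psi> (at (\<Phi> q)) b)) has_derivative E) (at p within M)"
      "E X = frechet_derivative (\<lambda>y. frechet_derivative (\<lambda>y. g (\<Psi> y)) (at y) b) (at (\<Phi> p)) a"
      unfolding a(2) by (rule coordinate_derivative[OF assms(2) C(2) f g b(1) a(1)])
    have "D Y = E X" unfolding D(2) E(2) by (rule second_derivative_symmetric[OF h mem])
    then show "\<exists>D E. ((\<lambda>q. mdiff M f q (frechet_derivative \<Psi> (at (\<Phi> q)) a)) has_derivative D) (at p within M) \<and>
        ((\<lambda>q. mdiff M f q (frechet_derivative \<Psi> (at (\<Phi> q)) b)) has_derivative E) (at p within M) \<and> D Y = E X"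
      using D(1) E(1) by blast
  qed (use a b C smooth_on_open[OF smooth_Phi] tangent_slice in auto)
qed

text \<open>Connectedness reduces this to local constancy. In a slice chart a small ball meets
  \<open>S\<close> in a convex set, on which a function with zero derivative is constant.\<close>

lemma mdiff_zero_imp_constant:
  assumes "submanifold k M" "connected M" "msmooth M f"
    and zero: "\<And>q v. q \<in> M \<Longrightarrow> v \<in> tangent M q \<Longrightarrow> mdiff M f q v = 0"
    and "p \<in> M" "q \<in> M"
  shows "f p = f q"
proof (rule connected_local_const[OF assms(2,5,6)], intro ballI)
  fix p assume p: "p \<in> M"
  obtain U V S \<Phi> \<Psi> where C: "slice_chart M U V S \<Phi> \<Psi>" "p \<in> U" "dim S = k"
    by (rule submanifold_chart[OF assms(1) p])
  interpret slice_chart M U V S \<Phi> \<Psi> by (rule C(1))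
  obtain W g where g: "open W" "p \<in> W" "smooth_on W g" "\<And>q. q \<in> M \<Longrightarrow> q \<in> W \<Longrightarrow> g q = f q"
    using msmoothE[OF assms(3) p] by blast
  let ?V = "{y \<in> V. \<Psi> y \<in> W}"
  have opV: "open ?V" by (rule smooth_on_open_vimage[OF smooth_Psi g(1)])
  have "\<Phi> p \<in> ?V" using Phi_mem Psi_Phi C(2) g by auto
  then obtain r where r: "r > 0" "ball (\<Phi> p) r \<subseteq> ?V" using opV open_contains_ball by blast
  let ?B = "ball (\<Phi> p) r \<inter> S"
  have conv: "convex ?B" using subspace_S subspace_imp_convex by (intro convex_Int) auto
  have inM: "\<Psi> y \<in> M" "\<Psi> y \<in> U" "\<Psi> y \<in> W" if "y \<in> ?B" for y
    using that r slice[of "\<Psi> y"] Phi_Psi[of y] Psi_mem[of y] by auto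
  have "((\<lambda>y. f (\<Psi> y)) has_derivative (\<lambda>h. 0)) (at y within ?B)" if y: "y \<in> ?B" for y
  proof -
    let ?D = "\<lambda>v. frechet_derivative g (at (\<Psi> y)) (frechet_derivative \<Psi> (at y) v)"
    have yV: "y \<in> V" using y r by auto
    have "((\<lambda>y. g (\<Psi> y)) has_derivative ?D) (at y)"
      using diff_chain_at[OF smooth_on_has_derivative[OF smooth_Psi yV]
          smooth_on_has_derivative[OF g(3) inM(3)[OF y]]] by (simp add: o_def)
    then have "((\<lambda>y. g (\<Psi> y)) has_derivative ?D) (at y within ?B)" by (rule has_derivative_at_withinI)
    then have D: "((\<lambda>y. f (\<Psi> y)) has_derivative ?D) (at y within ?B)"
      by (rule has_derivative_transform[OF y, rotated]) (use g(4) inM in auto)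
    \<comment> \<open>A derivative within \<open>?B\<close> is tested only on differences of points
      of \<open>?B\<close>. Vanishing on these lets the zero map replace \<open>?D\<close>, which
      may be nonzero transversally to \<open>S\<close>.\<close>
    have "?D (z - y) = 0" if "z \<in> ?B" for z
    proof -
      have "z - y \<in> S" using that y subspace_S by (auto intro: subspace_diff)
      then have "frechet_derivative \<Psi> (at y) (z - y) \<in> tangent M (\<Psi> y)"
        using tangent_slice[OF inM(1,2)[OF y]] Phi_Psi[OF yV] by auto
      then show ?thesis
        using mdiff_extension[OF g(3) inM(1)[OF y] inM(3)[OF y] _ assms(3)] zero[OF inM(1)[OF y]] g(4) by auto
    qed
    then show ?thesis
      using D unfolding has_derivative_within'
      by (auto simp: bounded_linear_zero)
  qed
  then obtain c where c: "\<And>y. y \<in> ?B \<Longrightarrow> f (\<Psi> y) = c"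
    using has_derivative_zero_constant[OF conv] by blast
  let ?O = "{q \<in> U. \<Phi> q \<in> ball (\<Phi> p) r}"
  have "f q = c" if "q \<in> M" "q \<in> ?O" for q
    using c[of "\<Phi> q"] that slice[of q] Psi_Phi[of q] by auto
  moreover have "p \<in> ?O" using C r by auto
  moreover have "open ?O" by (rule smooth_on_open_vimage[OF smooth_Phi]) simp
  ultimately show "\<forall>\<^sub>F b in at p within M. f p = f b"
    unfolding eventually_at_topological using p by (intro exI[of _ ?O]) auto
qed

lemma mdiff_cong:
  assumes "\<And>q. q \<in> M \<Longrightarrow> f q = g q"
  shows "mdiff M f p v = mdiff M g p v"
proof -
  have "(\<forall>q\<in>M \<inter> U. h q = f q) \<longleftrightarrow> (\<forall>q\<in>M \<inter> U. h q = g q)" for U h using assms by auto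
  then show ?thesis by (simp only: mdiff_def)
qed

lemma tangent_derivative_local_eq:
  assumes "(f has_derivative D) (at p within M)" "(g has_derivative E) (at p within M)"
    and "open U" "p \<in> U" "p \<in> M" "\<And>q. q \<in> M \<inter> U \<Longrightarrow> f q = g q" "v \<in> tangent M p"
  shows "D v = E v"
proof -
  have "\<forall>\<^sub>F q in at p within M. f q = g q"
    unfolding eventually_at_topological using assms(3,4,6) by blast
  then have "(g has_derivative D) (at p within M)"
    using has_derivative_transform_eventually[OF assms(1)] assms(4,5,6) by blast
  then show ?thesis by (rule tangent_derivative_unique[OF assms(7) _ assms(2)])
qed

subsection \<open>Orthogonal projections depending smoothly on a parameter\<close>

definition orth_proj :: "'a::euclidean_space set \<Rightarrow> 'a \<Rightarrow> 'a" where
  "orth_proj S c = (THE y. y \<in> S \<and> (\<forall>w\<in>S. (c - y) \<bullet> w = 0))"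

lemma orth_proj_eqI:
  assumes "subspace S" "y \<in> S" "\<And>w. w \<in> S \<Longrightarrow> (c - y) \<bullet> w = 0"
  shows "orth_proj S c = y"
  unfolding orth_proj_def
proof (rule the_equality)
  fix z assume z: "z \<in> S \<and> (\<forall>w\<in>S. (c - z) \<bullet> w = 0)"
  then have "z - y \<in> S" using assms by (simp add: subspace_diff)
  then have "(c - y) \<bullet> (z - y) = 0" "(c - z) \<bullet> (z - y) = 0" using z assms(3) by auto
  then have "(z - y) \<bullet> (z - y) = 0" by (simp add: inner_diff_left)
  then show "z = y" by simp
qed (use assms in auto)

lemma orth_proj:
  assumes "subspace S"
  shows orth_proj_mem: "orth_proj S c \<in> S" and orth_proj_orth: "w \<in> S \<Longrightarrow> (c - orth_proj S c) \<bullet> w = 0"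
proof -
  have sp: "span S = S" using assms by (simp only: span_eq_iff)
  obtain y z where yz: "y \<in> span S" "\<And>w. w \<in> span S \<Longrightarrow> orthogonal z w" "c = y + z"
    using orthogonal_subspace_decomp_exists[of S c] by metis
  then have "orth_proj S c = y"
    by (intro orth_proj_eqI[OF assms]) (auto simp: sp orthogonal_def)
  then show "orth_proj S c \<in> S" "w \<in> S \<Longrightarrow> (c - orth_proj S c) \<bullet> w = 0"
    using yz by (auto simp: sp orthogonal_def)
qed

lemma orth_proj_in: "subspace S \<Longrightarrow> c \<in> S \<Longrightarrow> orth_proj S c = c"
  by (rule orth_proj_eqI) auto

lemma orth_proj_perp: "subspace S \<Longrightarrow> (\<And>w. w \<in> S \<Longrightarrow> c \<bullet> w = 0) \<Longrightarrow> orth_proj S c = 0"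
  by (rule orth_proj_eqI) (auto intro: subspace_0)

lemma linear_orth_proj:
  assumes "subspace S"
  shows "linear (orth_proj S)"
proof (rule linearI)
  fix a b and c :: real
  have "(a + b - (orth_proj S a + orth_proj S b)) \<bullet> w = 0" if "w \<in> S" for w
    using orth_proj_orth[OF assms that, of a] orth_proj_orth[OF assms that, of b]
    by (simp add: inner_diff_left inner_add_left)
  then show "orth_proj S (a + b) = orth_proj S a + orth_proj S b"
    by (intro orth_proj_eqI assms subspace_add orth_proj_mem)
  have "(c *\<^sub>R b - c *\<^sub>R orth_proj S b) \<bullet> w = 0" if "w \<in> S" for w
    using orth_proj_orth[OF assms that, of b] by (simp add: inner_diff_left)
  then show "orth_proj S (c *\<^sub>R b) = c *\<^sub>R orth_proj S b"
    by (intro orth_proj_eqI assms subspace_scale orth_proj_mem)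
qed

text \<open>An explicit formula from which smooth dependence on a parameter can be read off. The
  vectors are indexed by labels in \<open>B\<close>, since the frame will move with the point while
  the labels stay fixed.\<close>

lemma orth_proj_orthogonal_basis:
  assumes S: "subspace S" and B: "finite B" "card B = dim S"
    and v: "\<And>e. e \<in> B \<Longrightarrow> v e \<in> S" "\<And>e. e \<in> B \<Longrightarrow> v e \<noteq> 0"
      "\<And>e e'. e \<in> B \<Longrightarrow> e' \<in> B \<Longrightarrow> e \<noteq> e' \<Longrightarrow> v e \<bullet> v e' = 0"
  shows "orth_proj S c = (\<Sum>e\<in>B. ((c \<bullet> v e) / (v e \<bullet> v e)) *\<^sub>R v e)" (is "_ = ?y")
proof (rule orth_proj_eqI[OF S])
  show "?y \<in> S" by (intro subspace_sum subspace_scale S v)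
  have inj: "inj_on v B" using v(2,3) by (metis inj_onI inner_eq_zero_iff)
  have "independent (v ` B)"
  proof (rule pairwise_orthogonal_independent)
    show "pairwise orthogonal (v ` B)"
      unfolding pairwise_def orthogonal_def by (auto intro!: v(3))
    show "0 \<notin> v ` B" using v(2) by (metis imageE)
  qed
  \<comment> \<open>Independence together with the right cardinality gives spanning.\<close>
  then have span: "S \<subseteq> span (v ` B)"
    using card_ge_dim_independent[of "v ` B" S] v(1) B card_image[OF inj] by auto
  have *: "(c - ?y) \<bullet> v e = 0" if "e \<in> B" for e
  proof -
    have "?y \<bullet> v e = (\<Sum>e'\<in>B. ((c \<bullet> v e') / (v e' \<bullet> v e')) * (v e' \<bullet> v e))" by (simp add: inner_sum_left)
    also have "\<dots> = (\<Sum>e'\<in>B. if e' = e then c \<bullet> v e else 0)"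
      using that v(2,3) by (intro sum.cong) auto
    also have "\<dots> = c \<bullet> v e" using that B(1) by simp
    finally show ?thesis by (simp add: inner_diff_left)
  qed
  fix w assume "w \<in> S"
  then have "w \<in> span (v ` B)" using span by auto
  then have "orthogonal (c - ?y) w"
    by (rule orthogonal_to_span) (use * in \<open>auto simp: orthogonal_def\<close>)
  then show "(c - ?y) \<bullet> w = 0" by (simp add: orthogonal_def)
qed

text \<open>The frame is already orthogonal at \<open>p\<close>, so there all corrections vanish and
  each \<open>v e p\<close> is still \<open>e\<close>. Hence no vector degenerates at
  \<open>p\<close>, nor, by continuity, nearby.\<close>

lemma smooth_gram_schmidt:
  fixes u :: "'b::euclidean_space \<Rightarrow> 'a::euclidean_space \<Rightarrow> 'b"
  assumes "finite B" "open U" "p \<in> U" "\<And>e. e \<in> B \<Longrightarrow> smooth_on U (u e)" "\<And>e. e \<in> B \<Longrightarrow> u e p = e"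
    "0 \<notin> B" "pairwise orthogonal B"
  shows "\<exists>W v. open W \<and> p \<in> W \<and> W \<subseteq> U \<and> (\<forall>e\<in>B. smooth_on W (v e) \<and> v e p = e \<and>
      (\<forall>q\<in>W. v e q \<noteq> 0 \<and> v e q \<in> span ((\<lambda>e. u e q) ` B) \<and> (\<forall>e'\<in>B. e \<noteq> e' \<longrightarrow> v e q \<bullet> v e' q = 0)))"
  using assms(1,4-)
proof (induction B rule: finite_induct)
  case empty
  then show ?case using assms(2,3) by blast
next
  case (insert x B)
  have "\<exists>W v. open W \<and> p \<in> W \<and> W \<subseteq> U \<and> (\<forall>e\<in>B. smooth_on W (v e) \<and> v e p = e \<and>
      (\<forall>q\<in>W. v e q \<noteq> 0 \<and> v e q \<in> span ((\<lambda>e. u e q) ` B) \<and> (\<forall>e'\<in>B. e \<noteq> e' \<longrightarrow> v e q \<bullet> v e' q = 0)))"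
    using insert.prems by (intro insert.IH) (auto simp: pairwise_insert)
  then obtain W v where W: "open W" "p \<in> W" "W \<subseteq> U"
    and *: "\<forall>e\<in>B. smooth_on W (v e) \<and> v e p = e \<and>
      (\<forall>q\<in>W. v e q \<noteq> 0 \<and> v e q \<in> span ((\<lambda>e. u e q) ` B) \<and> (\<forall>e'\<in>B. e \<noteq> e' \<longrightarrow> v e q \<bullet> v e' q = 0))"
    by blast
  then have v: "\<And>e. e \<in> B \<Longrightarrow> smooth_on W (v e)" "\<And>e. e \<in> B \<Longrightarrow> v e p = e"
      "\<And>e q. e \<in> B \<Longrightarrow> q \<in> W \<Longrightarrow> v e q \<noteq> 0"
      "\<And>e q. e \<in> B \<Longrightarrow> q \<in> W \<Longrightarrow> v e q \<in> span ((\<lambda>e. u e q) ` B)"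
      "\<And>e e' q. e \<in> B \<Longrightarrow> e' \<in> B \<Longrightarrow> q \<in> W \<Longrightarrow> e \<noteq> e' \<Longrightarrow> v e q \<bullet> v e' q = 0"
    by blast+
  define y where "y q = u x q - (\<Sum>e\<in>B. ((u x q \<bullet> v e q) / (v e q \<bullet> v e q)) *\<^sub>R v e q)" for q
  have y: "smooth_on W y" unfolding y_def[abs_def]
    using insert.prems(1)[of x] W v(1,3)
    by (intro smooth_on_diff smooth_on_sum smooth_on_scaleR smooth_on_divide smooth_on_inner)
       (auto intro: smooth_on_subset)
  have yp: "y p = x"
  proof -
    have "(u x p \<bullet> v e p) / (v e p \<bullet> v e p) = 0" if "e \<in> B" for e
      using insert.prems(2,4) insert.hyps(2) v(2)[OF that] that by (auto simp: pairwise_insert orthogonal_def)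
    then have "(\<Sum>e\<in>B. ((u x p \<bullet> v e p) / (v e p \<bullet> v e p)) *\<^sub>R v e p) = 0"
      by (intro sum.neutral) simp
    then show ?thesis using insert.prems(2)[of x] by (simp add: y_def)
  qed
  have yorth: "y q \<bullet> v e q = 0" if "e \<in> B" "q \<in> W" for e q
  proof -
    have "(\<Sum>e\<in>B. ((u x q \<bullet> v e q) / (v e q \<bullet> v e q)) *\<^sub>R v e q) \<bullet> v e q
        = (\<Sum>e'\<in>B. ((u x q \<bullet> v e' q) / (v e' q \<bullet> v e' q)) * (v e' q \<bullet> v e q))" by (simp add: inner_sum_left)
    also have "\<dots> = (\<Sum>e'\<in>B. if e' = e then u x q \<bullet> v e q else 0)"
      using that v(3,5) by (intro sum.cong) auto
    also have "\<dots> = u x q \<bullet> v e q" using that insert.hyps(1) by simp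
    finally show ?thesis by (simp add: y_def inner_diff_left)
  qed
  have spanB: "span ((\<lambda>e. u e q) ` B) \<subseteq> span ((\<lambda>e. u e q) ` insert x B)" for q
    by (rule span_mono) auto
  have yspan: "y q \<in> span ((\<lambda>e. u e q) ` insert x B)" if "q \<in> W" for q
    unfolding y_def using that v(4) spanB[of q]
    by (intro span_diff span_sum span_scale) (auto intro: span_base)
  \<comment> \<open>The neighbourhood shrinks to where the new vector is nonzero; it keeps
    \<open>p\<close> because \<open>y p = x\<close> and \<open>x\<close> is nonzero.\<close>
  define W' where "W' = {q \<in> W. y q \<in> - {0}}"
  have W': "open W'" "p \<in> W'" "W' \<subseteq> W"
    unfolding W'_def using smooth_on_open_vimage[OF y, of "- {0}"] W(2) yp insert.prems(3) by auto
  let ?v = "v(x := y)"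
  have "smooth_on W' (?v e)" if "e \<in> insert x B" for e
    using that W' y v(1) insert.hyps(2) by (auto intro: smooth_on_subset)
  moreover have "?v e p = e" if "e \<in> insert x B" for e
    using that yp v(2) by auto
  moreover have "?v e q \<noteq> 0" if "e \<in> insert x B" "q \<in> W'" for e q
    using that v(3) by (auto simp: W'_def)
  moreover have "?v e q \<in> span ((\<lambda>e. u e q) ` insert x B)" if "e \<in> insert x B" "q \<in> W'" for e q
    using that W'(3) v(4)[of e q] spanB[of q] yspan[of q] by (cases "e = x") (auto simp del: image_insert)
  moreover have "?v e q \<bullet> ?v e' q = 0" if "e \<in> insert x B" "e' \<in> insert x B" "e \<noteq> e'" "q \<in> W'" for e e' q
    using that W'(3) v(5)[of e e' q] yorth[of _ q] by (auto simp: inner_commute)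
  ultimately show ?case using W' W(3)
    by (intro exI[of _ W'] exI[of _ ?v] conjI ballI impI) (auto simp del: fun_upd_apply image_insert)
qed

subsection \<open>Horizontal geometry of the Heisenberg group\<close>

text \<open>Multiplication by i when the pair \<open>(a, b)\<close> is read as a + ib; it represents
  the CR structure in the parallel frame.\<close>

definition Jc :: "(real^'n) \<times> (real^'n) \<Rightarrow> (real^('n::finite)) \<times> (real^'n)" where
  "Jc c = (- snd c, fst c)"

lemma linear_Jc: "linear Jc"
  by (auto simp: Jc_def intro!: linearI)

lemma Jc_Jc [simp]: "Jc (Jc c) = - c"
  by (simp add: Jc_def prod_eq_iff)

lemma Jc_inner_Jc [simp]: "Jc a \<bullet> Jc b = a \<bullet> b"
  by (simp add: Jc_def inner_prod_def)

lemma inner_Jc_left: "Jc a \<bullet> b = - (a \<bullet> Jc b)"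
  by (simp add: Jc_def inner_prod_def inner_commute)

lemma linear_comps: "linear comps"
  by (auto simp: comps_def hx_def hy_def intro!: linearI)

lemma linear_ht: "linear ht"
  by (auto simp: ht_def intro!: linearI)

lemmas bounded_linear_comps = linear_conv_bounded_linear[THEN iffD1, OF linear_comps]
lemmas bounded_linear_ht = linear_conv_bounded_linear[THEN iffD1, OF linear_ht]
lemmas bounded_linear_Jc = linear_conv_bounded_linear[THEN iffD1, OF linear_Jc]

lemma heis_eqI: "comps v = comps w \<Longrightarrow> ht v = ht w \<Longrightarrow> v = w"
  by (simp add: comps_def hx_def hy_def ht_def prod_eq_iff)

text \<open>In this form the contact form is dt plus the pairing of \<open>Jc\<close> z with dz, so
  its exterior derivative is twice the bilinear form \<open>Jc a \<bullet> b\<close>.\<close>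

lemma Theta_altdef: "Theta q v = ht v + Jc (comps q) \<bullet> comps v"
  by (simp add: Theta_def Jc_def comps_def inner_prod_def)

lemma levi_altdef: "levi v w = comps v \<bullet> comps w"
  by (simp add: levi_def comps_def inner_prod_def)

lemma comps_hvec [simp]: "comps (hvec q c) = c"
  by (simp add: comps_def hvec_def hx_def hy_def)

lemma ht_hvec: "ht (hvec q c) = - (Jc (comps q) \<bullet> c)"
  by (simp add: comps_def hvec_def hx_def hy_def ht_def Jc_def inner_prod_def)

lemma linear_hvec: "linear (hvec q)"
  by (auto simp: hvec_def inner_add_right algebra_simps intro!: linearI)

lemma hvec_in_xi [simp]: "hvec q c \<in> xi q"
  by (simp add: xi_def Theta_altdef ht_hvec)

lemma hvec_comps: "v \<in> xi q \<Longrightarrow> hvec q (comps v) = v"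
  by (rule heis_eqI) (auto simp: xi_def Theta_altdef ht_hvec)

lemma comps_Jst [simp]: "comps (Jst q v) = Jc (comps v)"
  by (simp add: Jst_def Jc_def comps_def hvec_def hx_def hy_def)

lemma Jst_altdef: "Jst q v = hvec q (Jc (comps v))"
  by (simp add: Jst_def Jc_def comps_def)

lemma comps_Treeb [simp]: "comps Treeb = 0"
  by (simp add: comps_def Treeb_def hx_def hy_def prod_eq_iff)

lemma Theta_Treeb [simp]: "Theta q Treeb = 1"
  by (simp add: Theta_altdef) (simp add: Treeb_def ht_def)

lemma linear_Theta: "linear (Theta q)"
proof (rule linearI)
  fix v w :: "'a heis" and c :: real
  show "Theta q (v + w) = Theta q v + Theta q w" "Theta q (c *\<^sub>R v) = c *\<^sub>R Theta q v"
    by (simp_all add: Theta_altdef linear_add[OF linear_ht] linear_add[OF linear_comps] linear_cmul[OF linear_ht]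
      linear_cmul[OF linear_comps] inner_add_right distrib_left)
qed

lemma subspace_xi: "subspace (xi q)"
  by (simp add: subspace_def xi_def linear_0[OF linear_Theta] linear_add[OF linear_Theta] linear_cmul[OF linear_Theta]
      del: split_paired_All)

text \<open>The contact space of \<open>M\<close> in frame components: a subspace of one fixed
  vector space, so that different base points, and \<open>M\<close> with \<open>N\<close>, can be
  compared.\<close>

definition hor :: "('n::finite) heis set \<Rightarrow> 'n heis \<Rightarrow> ((real^'n) \<times> (real^'n)) set" where
  "hor M q = comps ` xihat M q"

lemma hor_iff: "c \<in> hor M q \<longleftrightarrow> hvec q c \<in> tangent M q"
proof
  assume "c \<in> hor M q"
  then obtain v where "v \<in> xihat M q" "c = comps v" by (auto simp: hor_def)
  then show "hvec q c \<in> tangent M q" using hvec_comps[of v q] by (auto simp: xihat_def)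
next
  assume "hvec q c \<in> tangent M q"
  then have "hvec q c \<in> xihat M q" by (simp add: xihat_def)
  then show "c \<in> hor M q" unfolding hor_def by (metis comps_hvec imageI)
qed

lemma hvec_in_xihat: "hvec q c \<in> xihat M q \<longleftrightarrow> c \<in> hor M q"
  by (simp add: hor_iff xihat_def)

lemma hvec_in_xiperp: "hvec q c \<in> xiperp M q \<longleftrightarrow> (\<forall>w\<in>hor M q. c \<bullet> w = 0)"
  by (auto simp: xiperp_def hor_def levi_altdef)

lemma xiperpD: "v \<in> xiperp M q \<Longrightarrow> w \<in> hor M q \<Longrightarrow> comps v \<bullet> w = 0"
  and xiperp_hvec: "v \<in> xiperp M q \<Longrightarrow> hvec q (comps v) = v"
  using hvec_in_xiperp[of q "comps v" M] by (auto simp: xiperp_def hvec_comps)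

section \<open>Contact space, normal space and Reeb field of a pseudohermitian submanifold\<close>

locale psh_manifold =
  fixes M :: "('n::finite) heis set" and m :: nat
  assumes psh: "psh_submanifold m M"
begin

lemma submanifold: "submanifold (2*m+1) M"
  using psh by (simp add: psh_submanifold_def)

lemmas subspace_tangent = subspace_tangent[OF submanifold]
lemmas dim_tangent = dim_tangent[OF submanifold]

lemma dim_xihat: "q \<in> M \<Longrightarrow> dim (xihat M q) = 2*m"
  and Jst_tangent: "q \<in> M \<Longrightarrow> v \<in> xihat M q \<Longrightarrow> Jst q v \<in> tangent M q"
  using psh unfolding psh_submanifold_def by blast+

lemma subspace_xihat: "q \<in> M \<Longrightarrow> subspace (xihat M q)"
  unfolding xihat_def using subspace_tangent subspace_xi by (intro subspace_inter)

lemma subspace_hor: "q \<in> M \<Longrightarrow> subspace (hor M q)"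
  unfolding hor_def by (intro linear_subspace_image[OF linear_comps] subspace_xihat)

lemma dim_hor: "q \<in> M \<Longrightarrow> dim (hor M q) = 2*m"
proof -
  assume q: "q \<in> M"
  have sp: "span (xihat M q) = xihat M q" using subspace_xihat[OF q] by (simp only: span_eq_iff)
  have "inj_on comps (span (xihat M q))"
    unfolding sp by (rule inj_onI) (metis IntD2 hvec_comps xihat_def)
  then show "dim (hor M q) = 2*m"
    using dim_image_eq[OF linear_comps, of "xihat M q"] dim_xihat[OF q] by (simp only: hor_def)
qed

lemma Jc_hor: "q \<in> M \<Longrightarrow> c \<in> hor M q \<Longrightarrow> Jc c \<in> hor M q"
  using Jst_tangent[of q "hvec q c"] hvec_in_xihat[of q c M] Jst_altdef[of q "hvec q c"] by (simp add: hor_iff)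

lemma Jc_perp: "q \<in> M \<Longrightarrow> (\<And>w. w \<in> hor M q \<Longrightarrow> c \<bullet> w = 0) \<Longrightarrow> w \<in> hor M q \<Longrightarrow> Jc c \<bullet> w = 0"
  by (simp add: inner_Jc_left Jc_hor)

text \<open>Dimension count: a tangent space of dimension 2m+1 cannot lie in \<open>xi q\<close>,
  since its horizontal part has dimension 2m.\<close>

lemma transversal:
  assumes "q \<in> M"
  obtains w where "w \<in> tangent M q" "Theta q w = 1"
proof -
  have "\<not> tangent M q \<subseteq> xi q"
  proof
    assume "tangent M q \<subseteq> xi q"
    then have "xihat M q = tangent M q" by (auto simp: xihat_def)
    then show False using dim_tangent[OF assms] dim_xihat[OF assms] by simp
  qed
  then obtain w where w: "w \<in> tangent M q" "Theta q w \<noteq> 0" by (auto simp: xi_def)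
  show thesis
    using that[of "(1 / Theta q w) *\<^sub>R w"] w subspace_tangent[OF assms]
    by (simp add: subspace_scale linear_cmul[OF linear_Theta])
qed

text \<open>Existence: a tangent vector with contact value 1, minus its part in the contact space of
  \<open>M\<close>, has the form \<open>Treeb + n\<close> with \<open>n\<close> normal. Uniqueness:
  the difference of two candidates lies in \<open>hor M q\<close> and is orthogonal to it.\<close>

lemma nu:
  assumes "q \<in> M"
  shows nu_xiperp: "nu M q \<in> xiperp M q" and nu_tangent: "Treeb + nu M q \<in> tangent M q"
    and nu_unique: "v \<in> xiperp M q \<Longrightarrow> Treeb + v \<in> tangent M q \<Longrightarrow> v = nu M q"
proof -
  note S = subspace_hor[OF assms]
  obtain w where w: "w \<in> tangent M q" "Theta q w = 1" using transversal[OF assms] .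
  define n where "n = hvec q (comps w - orth_proj (hor M q) (comps w))"
  have "n \<in> xiperp M q" unfolding n_def hvec_in_xiperp using orth_proj_orth[OF S] by blast
  moreover have "Treeb + n = w - hvec q (orth_proj (hor M q) (comps w))"
    using w(2)
    by (intro heis_eqI) (simp_all add: n_def linear_add[OF linear_comps] linear_diff[OF linear_comps]
        linear_add[OF linear_ht] linear_diff[OF linear_ht] ht_hvec Theta_altdef inner_diff_right, simp add: Treeb_def ht_def)
  moreover have "\<dots> \<in> tangent M q"
    using subspace_tangent[OF assms] w orth_proj_mem[OF S] by (intro subspace_diff) (auto simp: hor_iff)
  ultimately have ex: "n \<in> xiperp M q \<and> Treeb + n \<in> tangent M q" by simp
  have uniq: "a = b" if "a \<in> xiperp M q \<and> Treeb + a \<in> tangent M q" "b \<in> xiperp M q \<and> Treeb + b \<in> tangent M q" for a b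
  proof -
    have ab: "hvec q (comps a) = a" "hvec q (comps b) = b"
      using that xiperp_hvec[of a M q] xiperp_hvec[of b M q] by blast+
    have "(Treeb + a) - (Treeb + b) \<in> tangent M q" using that subspace_tangent[OF assms] by (intro subspace_diff) auto
    then have "hvec q (comps a - comps b) \<in> tangent M q" by (simp add: linear_diff[OF linear_hvec] ab)
    then have "comps a - comps b \<in> hor M q" by (simp add: hor_iff)
    then have "comps a \<bullet> (comps a - comps b) = 0" "comps b \<bullet> (comps a - comps b) = 0"
      using that xiperpD[of _ M q] by blast+
    then have "(comps a - comps b) \<bullet> (comps a - comps b) = 0" by (simp only: inner_diff_left)
    then have "comps a = comps b" by simp
    then show "a = b" using ab by metis
  qed
  have nu: "nu M q \<in> xiperp M q \<and> Treeb + nu M q \<in> tangent M q"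
    unfolding nu_def by (rule theI[of "\<lambda>v. v \<in> xiperp M q \<and> Treeb + v \<in> tangent M q", OF ex]) (use uniq ex in blast)
  show "nu M q \<in> xiperp M q" "Treeb + nu M q \<in> tangent M q" using nu by auto
  show "v \<in> xiperp M q \<Longrightarrow> Treeb + v \<in> tangent M q \<Longrightarrow> v = nu M q" using uniq nu by blast
qed

text \<open>The Levi metric is the Euclidean inner product of components, so the described
  projection is the Euclidean one.\<close>

lemma pi_perp_eq:
  assumes "q \<in> M"
  shows "pi_perp M q v = hvec q (comps v - orth_proj (hor M q) (comps v))"
proof -
  note S = subspace_hor[OF assms]
  let ?w = "hvec q (comps v - orth_proj (hor M q) (comps v))"
  have w: "?w \<in> xiperp M q" unfolding hvec_in_xiperp using orth_proj_orth[OF S] by blast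
  have w2: "levi (v - ?w) s = 0" if "s \<in> xiperp M q" for s
    using xiperpD[OF that orth_proj_mem[OF S]] by (simp add: levi_altdef linear_diff[OF linear_comps] inner_commute)
  show ?thesis unfolding pi_perp_def
  proof (rule the_equality)
    show "?w \<in> xiperp M q \<and> (\<forall>s\<in>xiperp M q. levi (v - ?w) s = 0)" using w w2 by blast
    fix z assume z: "z \<in> xiperp M q \<and> (\<forall>s\<in>xiperp M q. levi (v - z) s = 0)"
    define d where "d = comps z - comps ?w"
    have d: "hvec q d \<in> xiperp M q"
      unfolding hvec_in_xiperp d_def using z xiperpD[of z M q] xiperpD[OF w] by (simp only: inner_diff_left) simp
    have "levi (v - z) (hvec q d) = 0" "levi (v - ?w) (hvec q d) = 0"
      using z d w2[OF d] by blast+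
    then have "d \<bullet> d = 0"
      by (simp add: levi_altdef linear_diff[OF linear_comps] inner_diff_left d_def)
    then have "comps z = comps ?w" by (simp add: d_def)
    then show "z = ?w" using xiperp_hvec[of z M q] z by simp
  qed
qed

text \<open>Tangent vectors at \<open>p\<close> are extended with constant chart coefficients; the
  extension is then made horizontal by subtracting a multiple of a transversal field.\<close>

lemma local_horizontal_frame:
  assumes p: "p \<in> M"
  obtains U u where "open U" "p \<in> U" "\<And>c. c \<in> hor M p \<Longrightarrow> smooth_on U (u c)" "\<And>c. c \<in> hor M p \<Longrightarrow> u c p = c"
    "\<And>c q. c \<in> hor M p \<Longrightarrow> q \<in> M \<Longrightarrow> q \<in> U \<Longrightarrow> u c q \<in> hor M q"
proof -
  obtain U V S \<Phi> \<Psi> where C: "slice_chart M U V S \<Phi> \<Psi>" "p \<in> U" "dim S = 2*m+1"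
    by (rule submanifold_chart[OF submanifold p])
  interpret slice_chart M U V S \<Phi> \<Psi> by (rule C(1))
  define W where "W v q = frechet_derivative \<Psi> (at (\<Phi> q)) (frechet_derivative \<Phi> (at p) v)" for v q
  have Wp: "W v p = v" for v unfolding W_def by (rule derivative_Psi_Phi[OF C(2)])
  have Wsm: "smooth_on U (W v)" for v unfolding W_def by (rule smooth_coordinate_field)
  have Wtan: "W v q \<in> tangent M q" if "v \<in> tangent M p" "q \<in> M" "q \<in> U" for v q
    using that tangent_slice[OF p C(2)] tangent_slice[of q] derivative_Phi_Psi[OF C(2)] by (auto simp: W_def)
  obtain w where w: "w \<in> tangent M p" "Theta p w = 1" using transversal[OF p] .
  have Th: "smooth_on U (\<lambda>q. Theta q (W v q))" for v
    unfolding Theta_altdef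
    by (intro smooth_on_add smooth_on_inner smooth_on_bounded_linear[OF bounded_linear_ht]
        smooth_on_bounded_linear[OF bounded_linear_comps] smooth_on_bounded_linear[OF bounded_linear_Jc] Wsm
        smooth_on_ident smooth_on_open[OF Wsm])
  define U' where "U' = {q \<in> U. Theta q (W w q) \<in> - {0}}"
  have U': "open U'" "p \<in> U'" "U' \<subseteq> U"
    unfolding U'_def using smooth_on_open_vimage[OF Th[of w], of "- {0}"] C(2) w Wp[of w] by auto
  \<comment> \<open>The subtracted term cancels the value of the contact form. At \<open>p\<close>
    it is zero already, because \<open>hvec p c\<close> is horizontal.\<close>
  define Y where "Y c q = W (hvec p c) q - (Theta q (W (hvec p c) q) / Theta q (W w q)) *\<^sub>R W w q" for c q
  have Ysm: "smooth_on U' (Y c)" for c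
    unfolding Y_def using U'
    by (intro smooth_on_diff smooth_on_scaleR smooth_on_divide smooth_on_subset[OF Wsm] smooth_on_subset[OF Th])
       (auto simp: U'_def)
  show thesis
  proof (rule that[of U' "\<lambda>c q. comps (Y c q)"])
    show "open U'" "p \<in> U'" by fact+
    show "smooth_on U' (\<lambda>q. comps (Y c q))" for c
      by (rule smooth_on_bounded_linear[OF bounded_linear_comps Ysm])
    fix c assume c: "c \<in> hor M p"
    have "Theta p (hvec p c) = 0" using hvec_in_xi[of p c] by (simp add: xi_def)
    then show "comps (Y c p) = c" by (simp add: Y_def Wp)
    fix q assume q: "q \<in> M" "q \<in> U'"
    have "Y c q \<in> tangent M q" unfolding Y_def
      using q U' c w subspace_tangent[OF q(1)] by (intro subspace_diff subspace_scale Wtan) (auto simp: hor_iff)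
    moreover have "Y c q \<in> xi q"
      using q(2) by (auto simp: Y_def xi_def U'_def linear_diff[OF linear_Theta] linear_cmul[OF linear_Theta])
    ultimately show "comps (Y c q) \<in> hor M q" by (auto simp: hor_def xihat_def)
  qed
qed

text \<open>Since \<open>hor M q\<close> has the same dimension at every point of \<open>M\<close>,
  the Gram-Schmidt frame started from an orthonormal basis at \<open>p\<close> remains a basis
  nearby, and the projection formula in this frame is smooth.\<close>

lemma msmooth_orth_proj: "msmooth M (\<lambda>q. orth_proj (hor M q) c)"
proof (rule msmoothI)
  fix p assume p: "p \<in> M"
  obtain U u where U: "open U" "p \<in> U" "\<And>c. c \<in> hor M p \<Longrightarrow> smooth_on U (u c)" "\<And>c. c \<in> hor M p \<Longrightarrow> u c p = c"
    "\<And>c q. c \<in> hor M p \<Longrightarrow> q \<in> M \<Longrightarrow> q \<in> U \<Longrightarrow> u c q \<in> hor M q"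
    using local_horizontal_frame[OF p] by blast
  obtain B where B: "B \<subseteq> hor M p" "pairwise orthogonal B" "\<And>x. x \<in> B \<Longrightarrow> norm x = 1"
     "independent B" "card B = dim (hor M p)" "span B = hor M p"
    using orthonormal_basis_subspace[OF subspace_hor[OF p]] by metis
  have "0 \<notin> B" using B(3)[of 0] by auto
  have fin: "finite B" using B(4) independent_imp_finite by blast
  have "\<exists>W v. open W \<and> p \<in> W \<and> W \<subseteq> U \<and> (\<forall>e\<in>B. smooth_on W (v e) \<and> v e p = e \<and>
      (\<forall>q\<in>W. v e q \<noteq> 0 \<and> v e q \<in> span ((\<lambda>e. u e q) ` B) \<and> (\<forall>e'\<in>B. e \<noteq> e' \<longrightarrow> v e q \<bullet> v e' q = 0)))"
    by (rule smooth_gram_schmidt[OF fin U(1,2)]) (use B(1,2) \<open>0 \<notin> B\<close> U(3,4) in blast)+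
  then obtain W v where W: "open W" "p \<in> W" "W \<subseteq> U"
    and *: "\<forall>e\<in>B. smooth_on W (v e) \<and> v e p = e \<and>
      (\<forall>q\<in>W. v e q \<noteq> 0 \<and> v e q \<in> span ((\<lambda>e. u e q) ` B) \<and> (\<forall>e'\<in>B. e \<noteq> e' \<longrightarrow> v e q \<bullet> v e' q = 0))"
    by blast
  then have v: "\<And>e. e \<in> B \<Longrightarrow> smooth_on W (v e)"
      "\<And>e q. e \<in> B \<Longrightarrow> q \<in> W \<Longrightarrow> v e q \<noteq> 0"
      "\<And>e q. e \<in> B \<Longrightarrow> q \<in> W \<Longrightarrow> v e q \<in> span ((\<lambda>e. u e q) ` B)"
      "\<And>e e' q. e \<in> B \<Longrightarrow> e' \<in> B \<Longrightarrow> q \<in> W \<Longrightarrow> e \<noteq> e' \<Longrightarrow> v e q \<bullet> v e' q = 0"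
    by blast+
  have "smooth_on W (\<lambda>q. \<Sum>e\<in>B. ((c \<bullet> v e q) / (v e q \<bullet> v e q)) *\<^sub>R v e q)"
    using W v(1,2)
    by (intro smooth_on_sum smooth_on_scaleR smooth_on_divide smooth_on_inner smooth_on_const) auto
  moreover have "(\<Sum>e\<in>B. ((c \<bullet> v e q) / (v e q \<bullet> v e q)) *\<^sub>R v e q) = orth_proj (hor M q) c"
    if "q \<in> M \<inter> W" for q
  proof (rule orth_proj_orthogonal_basis[symmetric])
    show "subspace (hor M q)" using that subspace_hor by auto
    have "span ((\<lambda>e. u e q) ` B) \<subseteq> hor M q"
      by (rule span_minimal[OF _ \<open>subspace (hor M q)\<close>]) (use U(5) B(1) W(3) that in blast)
    then show "v e q \<in> hor M q" if "e \<in> B" for e using v(3) that \<open>q \<in> M \<inter> W\<close> by blast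
    show "card B = dim (hor M q)" using B(5) dim_hor p that by auto
  qed (use fin v that in blast)+
  ultimately show "\<exists>U g. p \<in> U \<and> smooth_on U g \<and> (\<forall>q\<in>M \<inter> U. g q = orth_proj (hor M q) c)"
    using W(2) by blast
qed

end

text \<open>The second summand comes from the moving base point of the form; antisymmetrized, it
  becomes the exterior derivative of the contact form.\<close>

lemma has_derivative_Theta:
  assumes "(f has_derivative f') (at p within M)" "(W has_derivative D) (at p within M)"
  shows "((\<lambda>q. Theta (f q) (W q)) has_derivative
    (\<lambda>v. Theta (f p) (D v) + Jc (comps (f' v)) \<bullet> comps (W p))) (at p within M)"
proof -
  have 1: "((\<lambda>q. ht (W q)) has_derivative (\<lambda>v. ht (D v))) (at p within M)"
    by (rule bounded_linear.has_derivative[OF bounded_linear_ht assms(2)])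
  have 2: "((\<lambda>q. comps (W q)) has_derivative (\<lambda>v. comps (D v))) (at p within M)"
    by (rule bounded_linear.has_derivative[OF bounded_linear_comps assms(2)])
  have 3: "((\<lambda>q. Jc (comps (f q))) has_derivative (\<lambda>v. Jc (comps (f' v)))) (at p within M)"
    by (intro bounded_linear.has_derivative[OF bounded_linear_Jc] bounded_linear.has_derivative[OF bounded_linear_comps] assms)
  have "((\<lambda>q. ht (W q) + Jc (comps (f q)) \<bullet> comps (W q)) has_derivative
      (\<lambda>v. ht (D v) + (Jc (comps (f p)) \<bullet> comps (D v) + Jc (comps (f' v)) \<bullet> comps (W p)))) (at p within M)"
    by (intro has_derivative_add 1 has_derivative_inner 2 3)
  then show ?thesis by (simp only: Theta_altdef add.assoc)
qed

lemma msmooth_hvec: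
  assumes "msmooth M c"
  shows "msmooth M (\<lambda>q. hvec q (c q))"
proof -
  have eq: "hvec q c = (fst c, snd c, 0) + (- (Jc (comps q) \<bullet> c)) *\<^sub>R Treeb" for q :: "'a heis" and c
    by (simp add: hvec_def Treeb_def Jc_def comps_def inner_prod_def)
  have "linear (\<lambda>c :: (real^'a) \<times> (real^'a). (fst c, snd c, 0::real))"
    by (rule linearI) simp_all
  then have L: "bounded_linear (\<lambda>c :: (real^'a) \<times> (real^'a). (fst c, snd c, 0::real))"
    by (simp add: linear_conv_bounded_linear)
  have "msmooth M (\<lambda>q. Jc (comps q) \<bullet> c q)"
    by (intro msmooth_inner assms msmooth_bounded_linear[OF bounded_linear_Jc]
        msmooth_bounded_linear[OF bounded_linear_comps] msmooth_ident)
  then have "msmooth M (\<lambda>q. (- (Jc (comps q) \<bullet> c q)) *\<^sub>R (Treeb :: 'a heis))"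
    by (rule msmooth_bounded_linear[rotated])
       (intro bounded_linear_minus bounded_linear_compose[OF bounded_linear_scaleR_left] bounded_linear_ident)
  then show ?thesis unfolding eq
    by (intro msmooth_add msmooth_bounded_linear[OF L] assms)
qed

lemma comps_cases:
  obtains a :: "('n::finite) heis" where "comps a = c" "ht a = t"
  by (rule that[of "(fst c, snd c, t)"]) (simp_all add: comps_def ht_def hx_def hy_def)

section \<open>Normal sections and the second fundamental form\<close>

context psh_manifold
begin

text \<open>With \<open>c\<close> fixed this is a global smooth normal field. If \<open>c\<close> is
  normal at \<open>p\<close> the field extends it, by \<open>perp_eq\<close>, so connection and
  second fundamental form can be evaluated on it.\<close>

definition perp :: "(real^'n) \<times> (real^'n) \<Rightarrow> 'n heis \<Rightarrow> (real^'n) \<times> (real^'n)" where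
  "perp c q = c - orth_proj (hor M q) c"

lemma msmooth_perp: "msmooth M (perp c)"
  unfolding perp_def[abs_def] by (intro msmooth_diff msmooth_const msmooth_orth_proj)

lemma perp_orth: "q \<in> M \<Longrightarrow> w \<in> hor M q \<Longrightarrow> perp c q \<bullet> w = 0"
  unfolding perp_def by (rule orth_proj_orth[OF subspace_hor])

lemma hvec_perp: "q \<in> M \<Longrightarrow> hvec q (perp c q) \<in> xiperp M q"
  unfolding hvec_in_xiperp using perp_orth by blast

lemma perp_eq: "q \<in> M \<Longrightarrow> (\<And>w. w \<in> hor M q \<Longrightarrow> c \<bullet> w = 0) \<Longrightarrow> perp c q = c"
  using orth_proj_perp[OF subspace_hor, of q c] by (simp add: perp_def)

lemma section_perp: "section_of M (xiperp M) (\<lambda>q. hvec q (perp c q))"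
  unfolding section_of_def using msmooth_hvec[OF msmooth_perp] hvec_perp by blast

lemma section_orth_proj: "section_of M (xihat M) (\<lambda>q. hvec q (orth_proj (hor M q) c))"
  unfolding section_of_def hvec_in_xihat
  using msmooth_hvec[OF msmooth_orth_proj] orth_proj_mem[OF subspace_hor] by blast

text \<open>Projection onto a \<open>Jc\<close>-invariant subspace is complex linear, because
  \<open>Jc\<close> is skew for the inner product.\<close>

lemma orth_proj_Jc:
  assumes "q \<in> M"
  shows "orth_proj (hor M q) (Jc c) = Jc (orth_proj (hor M q) c)"
proof (rule orth_proj_eqI[OF subspace_hor[OF assms]])
  note S = subspace_hor[OF assms]
  show "Jc (orth_proj (hor M q) c) \<in> hor M q" using Jc_hor[OF assms] orth_proj_mem[OF S] by blast
  fix w assume "w \<in> hor M q"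
  then have "(c - orth_proj (hor M q) c) \<bullet> Jc w = 0" using Jc_hor[OF assms] orth_proj_orth[OF S] by blast
  then show "(Jc c - Jc (orth_proj (hor M q) c)) \<bullet> w = 0"
    by (simp add: inner_Jc_left flip: linear_diff[OF linear_Jc])
qed

text \<open>The second fundamental form is read off from derivatives of normal fields alone, which
  eliminates the choice of the extension of \<open>Y\<close> in its definition.\<close>

lemma levi_II:
  assumes p: "p \<in> M" and X: "X \<in> xihat M p" and Y: "Y \<in> xihat M p"
    and n1: "msmooth M n1" "\<And>q w. q \<in> M \<Longrightarrow> w \<in> hor M q \<Longrightarrow> n1 q \<bullet> w = 0"
    and n2: "msmooth M n2" "\<And>q w. q \<in> M \<Longrightarrow> w \<in> hor M q \<Longrightarrow> n2 q \<bullet> w = 0"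
    and n12: "n2 p = Jc (n1 p)"
  shows "levi (II M p X Y) (hvec p (n1 p))
    = - (comps Y \<bullet> mdiff M n1 p X + comps Y \<bullet> mdiff M n2 p (Jst p X)) / 2"
proof -
  define Yh where "Yh = (SOME Yh. section_of M (xihat M) Yh \<and> Yh p = Y)"
  have "comps Y \<in> hor M p" using Y by (simp add: hor_def)
  \<comment> \<open>The projected constant vector \<open>comps Y\<close> shows that some extension
    exists, so the choice inside \<open>II\<close> is a genuine section through
    \<open>Y\<close>.\<close>
  then have "hvec p (orth_proj (hor M p) (comps Y)) = Y"
    using Y hvec_comps[of Y p] by (simp add: orth_proj_in[OF subspace_hor[OF p]] xihat_def)
  then have "\<exists>Yh. section_of M (xihat M) Yh \<and> Yh p = Y"
    using section_orth_proj[of "comps Y"] by blast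
  then have "section_of M (xihat M) Yh \<and> Yh p = Y" unfolding Yh_def by (rule someI_ex)
  then have Yh: "msmooth M Yh" "\<And>q. q \<in> M \<Longrightarrow> Yh q \<in> xihat M q" "Yh p = Y"
    unfolding section_of_def by blast+
  define y where "y q = comps (Yh q)" for q
  have y: "msmooth M y" "y p = comps Y" "\<And>q. q \<in> M \<Longrightarrow> y q \<in> hor M q"
    using Yh unfolding y_def[abs_def] hor_def by (auto intro: msmooth_bounded_linear[OF bounded_linear_comps])
  obtain Dy where Dy: "(y has_derivative Dy) (at p within M)" "\<And>v. v \<in> tangent M p \<Longrightarrow> mdiff M y p v = Dy v"
    using msmooth_has_derivative[OF y(1) p] by blast
  \<comment> \<open>Differentiating the vanishing product of a contact field with a normal field
    moves the derivative to the normal field; only the value \<open>Y\<close> of the chosen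
    extension survives.\<close>
  have orth: "Dy v \<bullet> n p = - (comps Y \<bullet> mdiff M n p v)"
    if n: "msmooth M n" "\<And>q w. q \<in> M \<Longrightarrow> w \<in> hor M q \<Longrightarrow> n q \<bullet> w = 0" and v: "v \<in> tangent M p" for n v
  proof -
    obtain D where D: "(n has_derivative D) (at p within M)" "\<And>v. v \<in> tangent M p \<Longrightarrow> mdiff M n p v = D v"
      using msmooth_has_derivative[OF n(1) p] by blast
    have "((\<lambda>q. y q \<bullet> n q) has_derivative (\<lambda>v. y p \<bullet> D v + Dy v \<bullet> n p)) (at p within M)"
      by (rule has_derivative_inner[OF Dy(1) D(1)])
    from tangent_derivative_local_eq[OF this has_derivative_const[of 0] open_UNIV _ p _ v]
    have "y p \<bullet> D v + Dy v \<bullet> n p = 0" using n(2) y(3) by (simp add: inner_commute)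
    then show ?thesis using D(2)[OF v] y(2) by simp
  qed
  have Xt: "X \<in> tangent M p" using X by (simp add: xihat_def)
  have JXt: "Jst p X \<in> tangent M p" by (rule Jst_tangent[OF p X])
  have nab: "comps (nabla M Yh p v) = Dy v" if "v \<in> tangent M p" for v
    using Dy(2)[OF that] by (simp add: nabla_def y_def[abs_def])
  define Z where "Z = nabla M Yh p X - Jst p (nabla M Yh p (Jst p X))"
  have Z: "comps Z = Dy X - Jc (Dy (Jst p X))"
    by (simp add: Z_def linear_diff[OF linear_comps] nab Xt JXt)
  have "comps (II M p X Y) = (1/2) *\<^sub>R (comps Z - orth_proj (hor M p) (comps Z))"
    by (simp add: II_def Let_def Yh_def[symmetric] Z_def[symmetric] pi_perp_eq[OF p] linear_cmul[OF linear_comps])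
  moreover have "orth_proj (hor M p) (comps Z) \<bullet> n1 p = 0"
    using n1(2)[OF p orth_proj_mem[OF subspace_hor[OF p]]] by (simp add: inner_commute)
  ultimately have "levi (II M p X Y) (hvec p (n1 p)) = (comps Z \<bullet> n1 p) / 2"
    by (simp add: levi_altdef inner_diff_left)
  \<comment> \<open>Moving \<open>Jc\<close> across the inner product costs a sign and turns
    \<open>n1 p\<close> into \<open>n2 p\<close>; this is why a second normal field is
    needed.\<close>
  also have "comps Z \<bullet> n1 p = Dy X \<bullet> n1 p + Dy (Jst p X) \<bullet> n2 p"
    by (simp add: Z inner_diff_left inner_Jc_left n12)
  finally show ?thesis using orth[OF n1 Xt] orth[OF n2 JXt] by simp
qed

end

text \<open>The columns of \<open>U\<close> are the images of the real standard vectors, read as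
  complex vectors. Their hermitian products have real part \<open>a \<bullet> b\<close> and
  imaginary part \<open>- (a \<bullet> Jc b)\<close>, and \<open>A\<close> preserves both.\<close>

lemma isometry_imp_unitary:
  fixes A :: "(real^('n::finite)) \<times> (real^'n) \<Rightarrow> (real^'n) \<times> (real^'n)"
  assumes lin: "linear A" and iso: "\<And>a b. A a \<bullet> A b = a \<bullet> b" and J: "\<And>a. A (Jc a) = Jc (A a)"
  obtains U where "unitary_mat U" "\<And>q. comps (rot U q) = A (comps q)" "\<And>q. ht (rot U q) = ht q"
proof -
  define E :: "'n \<Rightarrow> (real^'n) \<times> (real^'n)" where "E j = (axis j 1, 0)" for j
  define U where "U = (\<chi> i j. Complex (fst (A (E j)) $ i) (snd (A (E j)) $ i))"
  have EE: "E i \<bullet> E j = (if i = j then 1 else 0)" for i j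
    by (simp add: E_def inner_axis_axis)
  have EJ: "E i \<bullet> Jc (E j) = 0" for i j
    by (simp add: E_def Jc_def)
  have "((\<chi> i j. cnj (U $ j $ i)) ** U) $ i $ j = mat 1 $ i $ j" for i j
  proof -
    have "((\<chi> i j. cnj (U $ j $ i)) ** U) $ i $ j = Complex (A (E i) \<bullet> A (E j)) (- (A (E i) \<bullet> Jc (A (E j))))"
      by (simp add: matrix_matrix_mult_def U_def complex_eq_iff inner_prod_def inner_vec_def sum.distrib Jc_def
          sum_negf sum_subtractf algebra_simps)
    also have "\<dots> = mat 1 $ i $ j"
      by (simp only: iso J[symmetric] EE EJ) (simp add: mat_def complex_eq_iff)
    finally show ?thesis .
  qed
  then have "unitary_mat U" by (simp add: unitary_mat_def vec_eq_iff)
  moreover have "comps (rot U q) = A (comps q)" for q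
  proof -
    \<comment> \<open>The \<open>E j\<close> together with the \<open>Jc (E j)\<close> form the real
      standard basis, so complex linearity determines \<open>A\<close> from its values on the
      \<open>E j\<close>.\<close>
    have "comps q = (\<Sum>j\<in>UNIV. (hx q $ j) *\<^sub>R E j + (hy q $ j) *\<^sub>R Jc (E j))"
      by (simp add: comps_def E_def Jc_def prod_eq_iff fst_sum snd_sum vec_eq_iff axis_def if_distrib cong: if_cong)
    then have "A (comps q) = (\<Sum>j\<in>UNIV. (hx q $ j) *\<^sub>R A (E j) + (hy q $ j) *\<^sub>R Jc (A (E j)))"
      by (simp add: linear_sum[OF lin] linear_add[OF lin] linear_cmul[OF lin] J)
    then show ?thesis
      by (simp add: rot_def Let_def comps_def[of "(_, _)"] hx_def[of "(_, _)"] hy_def[of "(_, _)"] prod_eq_iff vec_eq_iff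
          matrix_vector_mult_def U_def fst_sum snd_sum Jc_def mult.commute)
  qed
  moreover have "ht (rot U q) = ht q" for q by (simp add: rot_def Let_def ht_def)
  ultimately show thesis by (rule that)
qed

subsection \<open>Rigidity\<close>

text \<open>\<open>F\<close> acts on real representatives of (1,0)-vectors, and \<open>F_J\<close>
  expresses its complex linearity. \<open>II_eq\<close> holds for \<open>v\<close> and for
  \<open>Jst p v\<close> alike, so real Levi products carry the whole hermitian pairing.\<close>

locale psh_congruence = M: psh_manifold M m + N: psh_manifold N m
  for M N :: "('n::finite) heis set" and m :: nat +
  fixes \<phi> :: "'n heis \<Rightarrow> 'n heis" and F :: "'n heis \<Rightarrow> 'n heis \<Rightarrow> 'n heis"
  assumes bij: "bij_betw \<phi> M N" and smooth_phi: "msmooth M \<phi>" and smooth_inv: "msmooth N (inv_into M \<phi>)"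
    and phi_J: "p \<in> M \<Longrightarrow> v \<in> xihat M p \<Longrightarrow> mdiff M \<phi> p (Jst p v) = Jst (\<phi> p) (mdiff M \<phi> p v)"
    and phi_Theta: "p \<in> M \<Longrightarrow> v \<in> tangent M p \<Longrightarrow> Theta (\<phi> p) (mdiff M \<phi> p v) = Theta p v"
    and F_mem: "p \<in> M \<Longrightarrow> v \<in> xiperp M p \<Longrightarrow> F p v \<in> xiperp N (\<phi> p)"
    and F_add: "p \<in> M \<Longrightarrow> v \<in> xiperp M p \<Longrightarrow> w \<in> xiperp M p \<Longrightarrow> F p (v + w) = F p v + F p w"
    and F_scale: "p \<in> M \<Longrightarrow> v \<in> xiperp M p \<Longrightarrow> F p (c *\<^sub>R v) = c *\<^sub>R F p v"
    and F_J: "p \<in> M \<Longrightarrow> v \<in> xiperp M p \<Longrightarrow> F p (Jst p v) = Jst (\<phi> p) (F p v)"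
    and F_levi: "p \<in> M \<Longrightarrow> v \<in> xiperp M p \<Longrightarrow> w \<in> xiperp M p \<Longrightarrow> levi (F p v) (F p w) = levi v w"
    and smooth_F: "section_of M (xiperp M) V \<Longrightarrow> msmooth M (\<lambda>p. F p (V p))"
    and II_eq: "p \<in> M \<Longrightarrow> X \<in> xihat M p \<Longrightarrow> Y \<in> xihat M p \<Longrightarrow> v \<in> xiperp M p \<Longrightarrow>
      levi (II M p X Y) v = levi (II N (\<phi> p) (mdiff M \<phi> p X) (mdiff M \<phi> p Y)) (F p v)"
    and nabla_perp_eq: "section_of M (xiperp M) V \<Longrightarrow> p \<in> M \<Longrightarrow> X \<in> tangent M p \<Longrightarrow>
      F p (nabla_perp M V p X)
        = nabla_perp N (\<lambda>q. F (inv_into M \<phi> q) (V (inv_into M \<phi> q))) (\<phi> p) (mdiff M \<phi> p X)"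
    and F_nu: "p \<in> M \<Longrightarrow> F p (nu M p) = nu N (\<phi> p)"
begin

abbreviation dphi :: "'n heis \<Rightarrow> 'n heis \<Rightarrow> 'n heis" where "dphi \<equiv> mdiff M \<phi>"

lemma phi_image: "\<phi> ` M = N" and phi_mem: "p \<in> M \<Longrightarrow> \<phi> p \<in> N"
  and inv_phi: "p \<in> M \<Longrightarrow> inv_into M \<phi> (\<phi> p) = p" and inv_mem: "inv_into M \<phi> ` N \<subseteq> M"
  using bij by (auto simp: bij_betw_def inv_into_into)

lemma dphi_tangent: "p \<in> M \<Longrightarrow> X \<in> tangent M p \<Longrightarrow> dphi p X \<in> tangent N (\<phi> p)"
  using mdiff_in_tangent[OF smooth_phi] phi_image by blast

lemma dphi_xihat: "p \<in> M \<Longrightarrow> X \<in> xihat M p \<Longrightarrow> dphi p X \<in> xihat N (\<phi> p)"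
  using dphi_tangent[of p X] phi_Theta[of p X] by (simp add: xihat_def xi_def)

lemma dphi_linear:
  assumes "p \<in> M" "u \<in> tangent M p" "v \<in> tangent M p"
  shows "dphi p (u + v) = dphi p u + dphi p v" "dphi p (c *\<^sub>R v) = c *\<^sub>R dphi p v"
  using linear_mdiff[OF M.submanifold assms(1) smooth_phi assms(2,3)] by blast+

text \<open>The contact form determines its differential, hence the Levi metric and the Reeb field.\<close>

lemma dphi_symplectic:
  assumes p: "p \<in> M" and X: "X \<in> tangent M p" and Y: "Y \<in> tangent M p"
  shows "Jc (comps (dphi p X)) \<bullet> comps (dphi p Y) = Jc (comps X) \<bullet> comps Y"
proof -
  obtain U Xh Yh where U: "open U" "p \<in> U" "Xh p = X" "Yh p = Y"
    and tan: "\<And>q. q \<in> M \<inter> U \<Longrightarrow> Xh q \<in> tangent M q" "\<And>q. q \<in> M \<inter> U \<Longrightarrow> Yh q \<in> tangent M q"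
    and comm: "\<And>f :: 'n heis \<Rightarrow> 'n heis. msmooth M f \<Longrightarrow>
        \<exists>D E. ((\<lambda>q. mdiff M f q (Xh q)) has_derivative D) (at p within M) \<and>
        ((\<lambda>q. mdiff M f q (Yh q)) has_derivative E) (at p within M) \<and> D Y = E X"
    using commuting_extension[OF M.submanifold p X Y] by blast
  obtain D E where DE: "((\<lambda>q. dphi q (Xh q)) has_derivative D) (at p within M)"
      "((\<lambda>q. dphi q (Yh q)) has_derivative E) (at p within M)" "D Y = E X"
    using comm[OF smooth_phi] by blast
  \<comment> \<open>Applied to the identity map, the same fields yield their own derivatives:
    \<open>D0 Y = E0 X\<close> says that they commute at \<open>p\<close>.\<close>
  obtain D0 E0 where DE0: "((\<lambda>q. mdiff M (\<lambda>x. x) q (Xh q)) has_derivative D0) (at p within M)"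
      "((\<lambda>q. mdiff M (\<lambda>x. x) q (Yh q)) has_derivative E0) (at p within M)" "D0 Y = E0 X"
    using comm[OF msmooth_ident] by blast
  obtain f' where f': "(\<phi> has_derivative f') (at p within M)" "\<And>v. v \<in> tangent M p \<Longrightarrow> dphi p v = f' v"
    using msmooth_has_derivative[OF smooth_phi p] by blast
  \<comment> \<open>Differentiates the invariance of the contact form along the field
    \<open>W\<close> in direction \<open>v\<close>.\<close>
  have *: "Theta (\<phi> p) (D v) + Jc (comps (dphi p v)) \<bullet> comps (dphi p (W p)) = Theta p (D0 v) + Jc (comps v) \<bullet> comps (W p)"
    if D: "((\<lambda>q. dphi q (W q)) has_derivative D) (at p within M)"
      and D0: "((\<lambda>q. mdiff M (\<lambda>x. x) q (W q)) has_derivative D0) (at p within M)"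
      and W: "\<And>q. q \<in> M \<inter> U \<Longrightarrow> W q \<in> tangent M q" and v: "v \<in> tangent M p" for D D0 W v
  proof -
    have id: "mdiff M (\<lambda>x. x) q (W q) = W q" if "q \<in> M \<inter> U" for q using mdiff_ident W that by blast
    have "Theta (\<phi> q) (dphi q (W q)) = Theta q (mdiff M (\<lambda>x. x) q (W q))" if "q \<in> M \<inter> U" for q
      unfolding id[OF that] using phi_Theta W that by blast
    from tangent_derivative_local_eq[OF has_derivative_Theta[OF f'(1) D]
        has_derivative_Theta[OF has_derivative_ident D0] U(1,2) p this v]
    show ?thesis using id[of p] f'(2)[OF v] p U(2) by simp
  qed
  have "Theta (\<phi> p) (D Y) + Jc (comps (dphi p Y)) \<bullet> comps (dphi p X) = Theta p (D0 Y) + Jc (comps Y) \<bullet> comps X"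
    using *[OF DE(1) DE0(1) tan(1) Y] U(3) by simp
  moreover have "Theta (\<phi> p) (E X) + Jc (comps (dphi p X)) \<bullet> comps (dphi p Y) = Theta p (E0 X) + Jc (comps X) \<bullet> comps Y"
    using *[OF DE(2) DE0(2) tan(2) X] U(4) by simp
  moreover have "Jc a \<bullet> b = - (Jc b \<bullet> a)" for a b :: "(real^'n) \<times> (real^'n)"
    by (simp only: inner_Jc_left[of a b] inner_commute[of a "Jc b"])
  then have "Jc (comps (dphi p Y)) \<bullet> comps (dphi p X) = - (Jc (comps (dphi p X)) \<bullet> comps (dphi p Y))"
     "Jc (comps Y) \<bullet> comps X = - (Jc (comps X) \<bullet> comps Y)" by blast+
  \<comment> \<open>Subtracting the two identities cancels the \<open>Theta\<close> terms, by
    symmetry of the second derivatives; skewness of the remaining form leaves twice the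
    claim.\<close>
  ultimately show ?thesis unfolding DE(3) DE0(3) by linarith
qed

text \<open>The unitary frame change relating \<open>M\<close> at \<open>p\<close> to \<open>N\<close> at \<open>\<phi> p\<close>, in the parallel frame of
  the Heisenberg group: the differential of \<open>\<phi>\<close> on the contact part and \<open>F\<close> on the normal part.\<close>

definition A :: "'n heis \<Rightarrow> (real^'n) \<times> (real^'n) \<Rightarrow> (real^'n) \<times> (real^'n)" where
  "A p c = comps (dphi p (hvec p (orth_proj (hor M p) c))) + comps (F p (hvec p (M.perp c p)))"

definition L :: "'n heis \<Rightarrow> (real^'n) \<times> (real^'n) \<Rightarrow> (real^'n) \<times> (real^'n)" where
  "L p c = comps (dphi p (hvec p c))"

definition G :: "'n heis \<Rightarrow> (real^'n) \<times> (real^'n) \<Rightarrow> (real^'n) \<times> (real^'n)" where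
  "G p c = comps (F p (hvec p c))"

lemma A_eq: "A p c = L p (orth_proj (hor M p) c) + G p (M.perp c p)"
  by (simp add: A_def L_def G_def)

section \<open>Pointwise properties of the frame change\<close>

context
  fixes p assumes p: "p \<in> M"
begin

lemma L_hor: "c \<in> hor M p \<Longrightarrow> L p c \<in> hor N (\<phi> p)"
  unfolding L_def using dphi_xihat[OF p, of "hvec p c"] hvec_in_xihat[of p c M]
  by (simp add: hor_def)

lemma L_add: "c \<in> hor M p \<Longrightarrow> d \<in> hor M p \<Longrightarrow> L p (c + d) = L p c + L p d"
  unfolding L_def using dphi_linear(1)[OF p, of "hvec p c" "hvec p d"]
  by (simp add: hor_iff linear_add[OF linear_hvec] linear_add[OF linear_comps])

lemma L_scale: "c \<in> hor M p \<Longrightarrow> L p (r *\<^sub>R c) = r *\<^sub>R L p c"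
  unfolding L_def using dphi_linear(2)[OF p, of "hvec p c" "hvec p c"]
  by (simp add: hor_iff linear_cmul[OF linear_hvec] linear_cmul[OF linear_comps])

lemma L_Jc: "c \<in> hor M p \<Longrightarrow> L p (Jc c) = Jc (L p c)"
  unfolding L_def using phi_J[OF p, of "hvec p c"] Jst_altdef[of p "hvec p c"]
  by (simp add: hvec_in_xihat)

text \<open>The Levi metric is the symplectic form with one argument rotated by \<open>Jc\<close>,
  and \<open>L p\<close> respects both.\<close>

lemma L_inner: "c \<in> hor M p \<Longrightarrow> d \<in> hor M p \<Longrightarrow> L p c \<bullet> L p d = c \<bullet> d"
proof -
  assume c: "c \<in> hor M p" and d: "d \<in> hor M p"
  have Jc': "Jc c \<in> hor M p" by (rule M.Jc_hor[OF p c])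
  have "Jc (L p (Jc c)) \<bullet> L p d = Jc (Jc c) \<bullet> d"
    unfolding L_def using dphi_symplectic[OF p, of "hvec p (Jc c)" "hvec p d"] Jc' d by (simp add: hor_iff)
  then show "L p c \<bullet> L p d = c \<bullet> d" by (simp add: L_Jc[OF c])
qed

lemma G_perp: "hvec p c \<in> xiperp M p \<Longrightarrow> hvec (\<phi> p) (G p c) \<in> xiperp N (\<phi> p)"
  and F_hvec: "hvec p c \<in> xiperp M p \<Longrightarrow> F p (hvec p c) = hvec (\<phi> p) (G p c)"
  unfolding G_def using F_mem[OF p, of "hvec p c"] xiperp_hvec[of "F p (hvec p c)" N "\<phi> p"] by simp_all

lemma G_add: "hvec p c \<in> xiperp M p \<Longrightarrow> hvec p d \<in> xiperp M p \<Longrightarrow> G p (c + d) = G p c + G p d"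
  unfolding G_def by (simp add: linear_add[OF linear_hvec] F_add[OF p] linear_add[OF linear_comps])

lemma G_scale: "hvec p c \<in> xiperp M p \<Longrightarrow> G p (r *\<^sub>R c) = r *\<^sub>R G p c"
  unfolding G_def by (simp add: linear_cmul[OF linear_hvec] F_scale[OF p] linear_cmul[OF linear_comps])

lemma G_Jc: "hvec p c \<in> xiperp M p \<Longrightarrow> G p (Jc c) = Jc (G p c)"
  unfolding G_def using F_J[OF p, of "hvec p c"] Jst_altdef[of p "hvec p c"] by simp

lemma G_inner: "hvec p c \<in> xiperp M p \<Longrightarrow> hvec p d \<in> xiperp M p \<Longrightarrow> G p c \<bullet> G p d = c \<bullet> d"
  unfolding G_def using F_levi[OF p, of "hvec p c" "hvec p d"] by (simp add: levi_altdef)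

lemma linear_perp: "linear (\<lambda>c. M.perp c p)"
  unfolding M.perp_def by (intro linear_compose_sub linear_ident linear_orth_proj[OF M.subspace_hor[OF p]])

lemma proj_hor: "orth_proj (hor M p) c \<in> hor M p"
  by (rule orth_proj_mem[OF M.subspace_hor[OF p]])

lemmas linear_proj = linear_orth_proj[OF M.subspace_hor[OF p]]
lemmas perp_xiperp = M.hvec_perp[OF p]

lemma linear_A: "linear (A p)"
proof (rule linearI)
  fix c d and r :: real
  show "A p (c + d) = A p c + A p d"
    unfolding A_eq linear_add[OF linear_proj] linear_add[OF linear_perp]
    by (simp add: L_add[OF proj_hor proj_hor] G_add[OF perp_xiperp perp_xiperp])
  show "A p (r *\<^sub>R c) = r *\<^sub>R A p c"
    unfolding A_eq linear_cmul[OF linear_proj] linear_cmul[OF linear_perp]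
    by (simp add: L_scale[OF proj_hor] G_scale[OF perp_xiperp] scaleR_add_right)
qed

lemma L_orth_G: "c \<in> hor M p \<Longrightarrow> hvec p d \<in> xiperp M p \<Longrightarrow> L p c \<bullet> G p d = 0"
  using xiperpD[OF G_perp, of d "L p c"] L_hor[of c] by (simp add: inner_commute)

lemma hor_orth: "c \<in> hor M p \<Longrightarrow> hvec p d \<in> xiperp M p \<Longrightarrow> c \<bullet> d = 0"
  using xiperpD[of "hvec p d" M p c] by (simp add: inner_commute)

lemma decomp: "c = orth_proj (hor M p) c + M.perp c p"
  by (simp add: M.perp_def)

lemma A_inner: "A p c \<bullet> A p d = c \<bullet> d"
proof -
  have "A p c \<bullet> A p d = orth_proj (hor M p) c \<bullet> orth_proj (hor M p) d + M.perp c p \<bullet> M.perp d p"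
    unfolding A_eq
    using L_orth_G[OF proj_hor perp_xiperp, of c d] L_orth_G[OF proj_hor perp_xiperp, of d c]
    by (simp add: inner_add_left inner_add_right L_inner[OF proj_hor proj_hor] G_inner[OF perp_xiperp perp_xiperp] inner_commute)
  also have "\<dots> = (orth_proj (hor M p) c + M.perp c p) \<bullet> (orth_proj (hor M p) d + M.perp d p)"
    using hor_orth[OF proj_hor perp_xiperp, of c d] hor_orth[OF proj_hor perp_xiperp, of d c]
    by (simp add: inner_add_left inner_add_right inner_commute)
  finally show ?thesis by (simp only: decomp[symmetric])
qed

lemma A_Jc: "A p (Jc c) = Jc (A p c)"
proof -
  have "M.perp (Jc c) p = Jc (M.perp c p)"
    by (simp add: M.perp_def M.orth_proj_Jc[OF p] linear_diff[OF linear_Jc])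
  then show ?thesis
    unfolding A_eq by (simp add: M.orth_proj_Jc[OF p] L_Jc[OF proj_hor] G_Jc[OF perp_xiperp] linear_add[OF linear_Jc])
qed

lemma A_hor: "c \<in> hor M p \<Longrightarrow> A p c = L p c"
  and A_hor_mem: "c \<in> hor M p \<Longrightarrow> A p c \<in> hor N (\<phi> p)"
proof -
  assume c: "c \<in> hor M p"
  have "G p 0 = 0" using G_scale[of 0 0] perp_xiperp[of 0] linear_0[OF linear_perp] by simp
  then show "A p c = L p c" using c
    by (simp add: A_eq M.perp_def orth_proj_in[OF M.subspace_hor[OF p] c])
  then show "A p c \<in> hor N (\<phi> p)" using L_hor[OF c] by simp
qed

lemma F_A: "hvec p c \<in> xiperp M p \<Longrightarrow> F p (hvec p c) = hvec (\<phi> p) (A p c)"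
  and A_perp_mem: "hvec p c \<in> xiperp M p \<Longrightarrow> hvec (\<phi> p) (A p c) \<in> xiperp N (\<phi> p)"
proof -
  assume c: "hvec p c \<in> xiperp M p"
  have "orth_proj (hor M p) c = 0"
    using c by (intro orth_proj_perp[OF M.subspace_hor[OF p]]) (simp add: hvec_in_xiperp)
  moreover have "L p 0 = 0" using L_scale[of 0 0] subspace_0[OF M.subspace_hor[OF p]] by simp
  ultimately have "A p c = G p c" by (simp add: A_eq M.perp_def)
  then show "F p (hvec p c) = hvec (\<phi> p) (A p c)" "hvec (\<phi> p) (A p c) \<in> xiperp N (\<phi> p)"
    using F_hvec[OF c] G_perp[OF c] by simp_all
qed

lemma inj_A: "inj (A p)"
proof (rule injI)
  fix c d assume "A p c = A p d"
  then have "A p (c - d) \<bullet> A p (c - d) = 0" by (simp add: linear_diff[OF linear_A])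
  then have "(c - d) \<bullet> (c - d) = 0" unfolding A_inner .
  then show "c = d" by simp
qed

text \<open>Inclusion plus equal dimension 2m, as an isometry is injective.\<close>

lemma A_image_hor: "A p ` hor M p = hor N (\<phi> p)"
proof (rule subspace_dim_equal)
  show "subspace (A p ` hor M p)" by (rule linear_subspace_image[OF linear_A M.subspace_hor[OF p]])
  show "subspace (hor N (\<phi> p))" by (rule N.subspace_hor[OF phi_mem[OF p]])
  show "A p ` hor M p \<subseteq> hor N (\<phi> p)" using A_hor_mem by blast
  show "dim (hor N (\<phi> p)) \<le> dim (A p ` hor M p)"
    using dim_image_eq[OF linear_A, of "hor M p"] inj_A M.dim_hor[OF p] N.dim_hor[OF phi_mem[OF p]]
    by (metis inj_on_subset order_refl subset_UNIV)
qed

text \<open>\<open>A p\<close> sends contact part to contact part and normal part to normal part,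
  hence intertwines the projections.\<close>

lemma orth_proj_A: "orth_proj (hor N (\<phi> p)) (A p c) = A p (orth_proj (hor M p) c)"
proof (rule orth_proj_eqI[OF N.subspace_hor[OF phi_mem[OF p]]])
  show "A p (orth_proj (hor M p) c) \<in> hor N (\<phi> p)" by (rule A_hor_mem[OF proj_hor])
  fix w assume "w \<in> hor N (\<phi> p)"
  then have "A p (M.perp c p) \<bullet> w = 0" using xiperpD[OF A_perp_mem[OF perp_xiperp]] by simp
  then show "(A p c - A p (orth_proj (hor M p) c)) \<bullet> w = 0"
    by (simp add: M.perp_def linear_diff[OF linear_A])
qed

text \<open>The Reeb field is determined by contact value 1 and symplectic orthogonality to the
  contact space. Both survive \<open>dphi\<close>, so the image is the Reeb field of
  \<open>N\<close>. \<open>Treeb\<close> has no horizontal components, and \<open>F_nu\<close>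
  identifies the rest.\<close>

lemma dphi_reeb: "comps (dphi p (Treeb + nu M p)) = A p (comps (nu M p))"
proof -
  define R where "R = dphi p (Treeb + nu M p)"
  have nuM: "nu M p \<in> xiperp M p" "Treeb + nu M p \<in> tangent M p" using M.nu_xiperp[OF p] M.nu_tangent[OF p] .
  have nuh: "hvec p (comps (nu M p)) = nu M p" by (rule xiperp_hvec[OF nuM(1)])
  have Rt: "R \<in> tangent N (\<phi> p)" unfolding R_def by (rule dphi_tangent[OF p nuM(2)])
  have "Theta p (nu M p) = 0" using nuM(1) by (simp add: xiperp_def xi_def)
  then have "Theta (\<phi> p) R = 1"
    unfolding R_def using phi_Theta[OF p nuM(2)] by (simp add: linear_add[OF linear_Theta])
  then have "R - Treeb \<in> xi (\<phi> p)" by (simp add: xi_def linear_diff[OF linear_Theta])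
  then have h: "hvec (\<phi> p) (comps R) = R - Treeb"
    using hvec_comps[of "R - Treeb" "\<phi> p"] by (simp add: linear_diff[OF linear_comps])
  have "comps R \<bullet> w = 0" if w: "w \<in> hor N (\<phi> p)" for w
  proof -
    obtain c where c: "c \<in> hor M p" "w = A p c" using w unfolding A_image_hor[symmetric] by blast
    \<comment> \<open>The symplectic form is tested on \<open>Jc c\<close>, so that the two
      occurrences of \<open>Jc\<close> cancel and leave the inner product with
      \<open>w\<close>.\<close>
    have Jc': "Jc c \<in> hor M p" by (rule M.Jc_hor[OF p c(1)])
    have "Jc (comps R) \<bullet> L p (Jc c) = Jc (comps (nu M p)) \<bullet> Jc c"
      unfolding R_def L_def using dphi_symplectic[OF p nuM(2), of "hvec p (Jc c)"] Jc'
      by (simp add: hor_iff linear_add[OF linear_comps])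
    then have "comps R \<bullet> w = comps (nu M p) \<bullet> c" by (simp add: L_Jc[OF c(1)] A_hor[OF c(1)] c(2))
    then show ?thesis using xiperpD[OF nuM(1) c(1)] by simp
  qed
  then have "hvec (\<phi> p) (comps R) \<in> xiperp N (\<phi> p)" by (simp only: hvec_in_xiperp) blast
  then have "R - Treeb = nu N (\<phi> p)"
    using N.nu_unique[OF phi_mem[OF p], of "R - Treeb"] h Rt by simp
  then have "hvec (\<phi> p) (comps R) = hvec (\<phi> p) (A p (comps (nu M p)))"
    using F_nu[OF p] F_A[of "comps (nu M p)"] nuM(1) h by (simp add: nuh)
  then show ?thesis unfolding R_def by (metis comps_hvec)
qed

text \<open>A tangent vector is a contact vector plus a multiple of the Reeb vector.
  \<open>A p\<close> agrees with the differential on the first by construction and on the second by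
  \<open>dphi_reeb\<close>.\<close>

lemma comps_dphi:
  assumes X: "X \<in> tangent M p"
  shows "comps (dphi p X) = A p (comps X)"
proof -
  have nuM: "nu M p \<in> xiperp M p" "Treeb + nu M p \<in> tangent M p" using M.nu_xiperp[OF p] M.nu_tangent[OF p] .
  have Th: "Theta p (nu M p) = 0" using nuM(1) by (simp add: xiperp_def xi_def)
  define r where "r = Theta p X"
  define H where "H = X - r *\<^sub>R (Treeb + nu M p)"
  have Ht: "H \<in> tangent M p" and rt: "r *\<^sub>R (Treeb + nu M p) \<in> tangent M p"
    unfolding H_def using M.subspace_tangent[OF p] X nuM(2) by (auto intro: subspace_diff subspace_scale)
  have "H \<in> xi p"
    by (simp add: H_def xi_def linear_diff[OF linear_Theta] linear_cmul[OF linear_Theta] linear_add[OF linear_Theta] Th r_def)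
  then have Hh: "hvec p (comps H) = H" "comps H \<in> hor M p" using hvec_comps[of H p] Ht by (auto simp: hor_def xihat_def)
  have X_eq: "X = H + r *\<^sub>R (Treeb + nu M p)" by (simp add: H_def)
  have "comps (dphi p X) = comps (dphi p H) + r *\<^sub>R comps (dphi p (Treeb + nu M p))"
    unfolding X_eq dphi_linear(1)[OF p Ht rt] dphi_linear(2)[OF p nuM(2) nuM(2)]
    by (simp add: linear_add[OF linear_comps] linear_cmul[OF linear_comps])
  also have "comps (dphi p H) = A p (comps H)" using A_hor[OF Hh(2)] by (simp add: L_def Hh(1))
  also have "A p (comps H) + r *\<^sub>R comps (dphi p (Treeb + nu M p)) = A p (comps X)"
    unfolding dphi_reeb X_eq
    by (simp add: linear_add[OF linear_comps] linear_cmul[OF linear_comps] linear_add[OF linear_A] linear_cmul[OF linear_A])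
  finally show ?thesis .
qed

end

section \<open>The derivative of the frame change\<close>

lemma msmooth_A: "msmooth M (\<lambda>q. A q c)"
proof -
  have "msmooth M (\<lambda>q. dphi q (hvec q (orth_proj (hor M q) c)))"
    by (rule msmooth_mdiff_field[OF smooth_phi msmooth_hvec[OF M.msmooth_orth_proj]])
       (use orth_proj_mem[OF M.subspace_hor] hor_iff in blast)
  moreover have "msmooth M (\<lambda>q. F q (hvec q (M.perp c q)))"
    by (rule smooth_F[OF M.section_perp])
  ultimately show ?thesis unfolding A_def
    by (intro msmooth_add msmooth_bounded_linear[OF bounded_linear_comps])
qed

text \<open>The directional derivative of the linear-map-valued function \<open>A\<close>, applied
  to \<open>c\<close>. The sum over \<open>Basis\<close> gives linearity in \<open>c\<close> at
  once; \<open>has_derivative_A\<close> identifies it with the derivative for constant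
  \<open>c\<close>.\<close>

definition dA :: "'n heis \<Rightarrow> 'n heis \<Rightarrow> (real^'n) \<times> (real^'n) \<Rightarrow> (real^'n) \<times> (real^'n)" where
  "dA p v c = (\<Sum>b\<in>Basis. (c \<bullet> b) *\<^sub>R mdiff M (\<lambda>q. A q b) p v)"

lemma linear_dA: "linear (dA p v)"
  by (rule linearI) (simp_all add: dA_def inner_add_left scaleR_add_left sum.distrib scaleR_sum_right)

text \<open>Asks only for differentiability of \<open>W\<close> at \<open>p\<close>, which is all
  that \<open>commuting_extension\<close> provides for its fields.\<close>

lemma A_product_rule:
  assumes p: "p \<in> M" and W: "(W has_derivative D) (at p within M)"
  obtains E where "((\<lambda>q. A q (W q)) has_derivative E) (at p within M)"
    "\<And>v. v \<in> tangent M p \<Longrightarrow> E v = dA p v (W p) + A p (D v)"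
proof -
  have "\<exists>D. ((\<lambda>q. A q b) has_derivative D) (at p within M) \<and> (\<forall>v\<in>tangent M p. mdiff M (\<lambda>q. A q b) p v = D v)" for b
    by (rule msmooth_has_derivative[OF msmooth_A[of b] p]) blast
  then obtain DA where DA: "\<And>b. ((\<lambda>q. A q b) has_derivative DA b) (at p within M)"
    "\<And>b v. v \<in> tangent M p \<Longrightarrow> mdiff M (\<lambda>q. A q b) p v = DA b v"
    by metis
  let ?E = "\<lambda>v. \<Sum>b\<in>Basis. (W p \<bullet> b) *\<^sub>R DA b v + (D v \<bullet> b) *\<^sub>R A p b"
  have "((\<lambda>q. \<Sum>b\<in>Basis. (W q \<bullet> b) *\<^sub>R A q b) has_derivative ?E) (at p within M)"
    by (intro has_derivative_sum has_derivative_scaleR has_derivative_inner_left W DA(1))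
  then have "((\<lambda>q. A q (W q)) has_derivative ?E) (at p within M)"
    by (rule has_derivative_transform[OF p, rotated]) (rule linear_basis_expansion[OF linear_A])
  moreover have "?E v = dA p v (W p) + A p (D v)" if "v \<in> tangent M p" for v
    unfolding linear_basis_expansion[OF linear_A[OF p], of "D v"] dA_def
    by (simp add: sum.distrib DA(2)[OF that])
  ultimately show thesis by (rule that)
qed

context
  fixes p assumes p: "p \<in> M"
begin

lemma has_derivative_A:
  obtains E where "((\<lambda>q. A q c) has_derivative E) (at p within M)" "\<And>v. v \<in> tangent M p \<Longrightarrow> E v = dA p v c"
proof -
  obtain E where E: "((\<lambda>q. A q c) has_derivative E) (at p within M)"
    "\<And>v. v \<in> tangent M p \<Longrightarrow> E v = dA p v c + A p 0"
    using A_product_rule[OF p has_derivative_const[of c]] by blast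
  then show thesis using that linear_0[OF linear_A[OF p]] by simp
qed

text \<open>The integrability condition \<open>dA \<and> dz = 0\<close>, obtained from \<open>dz' = A dz\<close>.\<close>

lemma dA_symmetric:
  assumes X: "X \<in> tangent M p" and Y: "Y \<in> tangent M p"
  shows "dA p Y (comps X) = dA p X (comps Y)"
proof -
  obtain U Xh Yh where U: "open U" "p \<in> U" "Xh p = X" "Yh p = Y"
    and tan: "\<And>q. q \<in> M \<inter> U \<Longrightarrow> Xh q \<in> tangent M q" "\<And>q. q \<in> M \<inter> U \<Longrightarrow> Yh q \<in> tangent M q"
    and comm: "\<And>f :: 'n heis \<Rightarrow> 'n heis. msmooth M f \<Longrightarrow>
        \<exists>D E. ((\<lambda>q. mdiff M f q (Xh q)) has_derivative D) (at p within M) \<and>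
        ((\<lambda>q. mdiff M f q (Yh q)) has_derivative E) (at p within M) \<and> D Y = E X"
    using commuting_extension[OF M.submanifold p X Y] by blast
  obtain D E where DE: "((\<lambda>q. dphi q (Xh q)) has_derivative D) (at p within M)"
      "((\<lambda>q. dphi q (Yh q)) has_derivative E) (at p within M)" "D Y = E X"
    using comm[OF smooth_phi] by blast
  obtain D0 E0 where DE0: "((\<lambda>q. mdiff M (\<lambda>x. x) q (Xh q)) has_derivative D0) (at p within M)"
      "((\<lambda>q. mdiff M (\<lambda>x. x) q (Yh q)) has_derivative E0) (at p within M)" "D0 Y = E0 X"
    using comm[OF msmooth_ident] by blast
  \<comment> \<open>Product rule applied to \<open>comps_dphi\<close> along the field
    \<open>W\<close>. Equality of the second derivatives, of \<open>\<phi>\<close> and of the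
    identity, then leaves only the \<open>dA\<close> terms.\<close>
  have *: "comps (D v) = dA p v (comps (W p)) + A p (comps (D0 v))"
    if D: "((\<lambda>q. dphi q (W q)) has_derivative D) (at p within M)"
      and D0: "((\<lambda>q. mdiff M (\<lambda>x. x) q (W q)) has_derivative D0) (at p within M)"
      and W: "\<And>q. q \<in> M \<inter> U \<Longrightarrow> W q \<in> tangent M q" and v: "v \<in> tangent M p" for D D0 W v
  proof -
    have id: "mdiff M (\<lambda>x. x) q (W q) = W q" if "q \<in> M \<inter> U" for q using mdiff_ident W that by blast
    have eq: "comps (dphi q (W q)) = A q (comps (mdiff M (\<lambda>x. x) q (W q)))" if "q \<in> M \<inter> U" for q
      unfolding id[OF that] using comps_dphi W that by blast
    obtain E where E: "((\<lambda>q. A q (comps (mdiff M (\<lambda>x. x) q (W q)))) has_derivative E) (at p within M)"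
      "\<And>v. v \<in> tangent M p \<Longrightarrow> E v = dA p v (comps (mdiff M (\<lambda>x. x) p (W p))) + A p (comps (D0 v))"
      using A_product_rule[OF p bounded_linear.has_derivative[OF bounded_linear_comps D0]] by blast
    from tangent_derivative_local_eq[OF bounded_linear.has_derivative[OF bounded_linear_comps D] E(1) U(1,2) p eq v]
    show ?thesis using E(2)[OF v] id[of p] p U(2) by simp
  qed
  have "comps (D Y) = dA p Y (comps X) + A p (comps (D0 Y))"
    using *[OF DE(1) DE0(1) tan(1) Y] U(3) by simp
  moreover have "comps (E X) = dA p X (comps Y) + A p (comps (E0 X))"
    using *[OF DE(2) DE0(2) tan(2) X] U(4) by simp
  ultimately show ?thesis using DE(3) DE0(3) by simp
qed

text \<open>Infinitesimal form of \<open>A_inner\<close>: the product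
  \<open>A q c \<bullet> A q d\<close> does not depend on \<open>q\<close>.\<close>

lemma dA_skew:
  assumes v: "v \<in> tangent M p"
  shows "dA p v c \<bullet> A p d = - (dA p v d \<bullet> A p c)"
proof -
  obtain E where E: "((\<lambda>q. A q c) has_derivative E) (at p within M)" "E v = dA p v c"
    using has_derivative_A v by metis
  obtain E' where E': "((\<lambda>q. A q d) has_derivative E') (at p within M)" "E' v = dA p v d"
    using has_derivative_A v by metis
  have "A p c \<bullet> E' v + E v \<bullet> A p d = 0"
    by (rule tangent_derivative_local_eq[OF has_derivative_inner[OF E(1) E'(1)] has_derivative_const[of "c \<bullet> d"]
          open_UNIV _ p _ v]) (simp_all add: A_inner)
  then show ?thesis using E(2) E'(2) by (simp add: inner_commute)
qed

lemma dA_Jc: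
  assumes v: "v \<in> tangent M p"
  shows "dA p v (Jc c) = Jc (dA p v c)"
proof -
  obtain E where E: "((\<lambda>q. A q c) has_derivative E) (at p within M)" "E v = dA p v c"
    using has_derivative_A v by metis
  obtain E' where E': "((\<lambda>q. A q (Jc c)) has_derivative E') (at p within M)" "E' v = dA p v (Jc c)"
    using has_derivative_A v by metis
  have "E' v = Jc (E v)"
    by (rule tangent_derivative_local_eq[OF E'(1) bounded_linear.has_derivative[OF bounded_linear_Jc E(1)]
          open_UNIV _ p _ v]) (simp_all add: A_Jc)
  then show ?thesis using E(2) E'(2) by simp
qed

text \<open>Transports a normal field of \<open>M\<close> to one of \<open>N\<close>. Its derivative
  is the transported derivative plus a \<open>dA\<close> term, so comparing the geometry of both
  sides isolates \<open>dA\<close>.\<close>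

lemma normal_field_transport:
  fixes V
  defines "n \<equiv> (\<lambda>r. A (inv_into M \<phi> r) (M.perp V (inv_into M \<phi> r)))"
  shows "msmooth N n" "X \<in> tangent M p \<Longrightarrow>
      mdiff N n (\<phi> p) (dphi p X) = dA p X (M.perp V p) + A p (mdiff M (M.perp V) p X)"
proof -
  have "msmooth M (\<lambda>q. comps (F q (hvec q (M.perp V q))))"
    by (intro msmooth_bounded_linear[OF bounded_linear_comps] smooth_F[OF M.section_perp])
  \<comment> \<open>Smoothness is taken from \<open>smooth_F\<close>, since on normal vectors
    \<open>F\<close> and \<open>A\<close> coincide.\<close>
  then have sm: "msmooth M (\<lambda>q. A q (M.perp V q))"
    by (rule msmooth_cong) (simp add: F_A[OF _ M.hvec_perp])
  show n: "msmooth N n"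
    unfolding n_def using msmooth_compose[OF sm smooth_inv inv_mem] .
  assume X: "X \<in> tangent M p"
  obtain D where D: "(M.perp V has_derivative D) (at p within M)" "mdiff M (M.perp V) p X = D X"
    using msmooth_has_derivative[OF M.msmooth_perp p] X by metis
  obtain E where E: "((\<lambda>q. A q (M.perp V q)) has_derivative E) (at p within M)"
    "E X = dA p X (M.perp V p) + A p (D X)"
    using A_product_rule[OF p D(1)] X by metis
  have "mdiff N n (\<phi> p) (dphi p X) = mdiff M (\<lambda>q. n (\<phi> q)) p X"
    using mdiff_compose[OF n smooth_phi _ p X] phi_image by simp
  also have "\<dots> = mdiff M (\<lambda>q. A q (M.perp V q)) p X"
    by (rule mdiff_cong) (simp add: n_def inv_phi)
  also have "\<dots> = E X" by (rule mdiff_eqI[OF sm p E(1) X])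
  finally show "mdiff N n (\<phi> p) (dphi p X) = dA p X (M.perp V p) + A p (mdiff M (M.perp V) p X)"
    using E(2) D(2) by simp
qed

text \<open>Both normal connections project the derivative of the same transported field. As
  \<open>A\<close> intertwines the projections, the terms without \<open>dA\<close> cancel, and
  \<open>dA p X V\<close> lies in the contact space of \<open>N\<close>.\<close>

lemma dA_normal:
  assumes X: "X \<in> tangent M p" and V: "hvec p V \<in> xiperp M p" and W: "hvec p W \<in> xiperp M p"
  shows "dA p X V \<bullet> A p W = 0"
proof -
  have Vp: "M.perp V p = V" using V by (intro M.perp_eq[OF p]) (simp add: hvec_in_xiperp)
  define D where "D = mdiff M (M.perp V) p X"
  have "comps (F p (nabla_perp M (\<lambda>q. hvec q (M.perp V q)) p X)) = A p (D - orth_proj (hor M p) D)"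
    using F_A[OF p M.hvec_perp[OF p, of D]]
    by (simp add: nabla_perp_def nabla_def M.pi_perp_eq[OF p] D_def[symmetric] M.perp_def[of D p])
  moreover have "comps (nabla_perp N (\<lambda>q. F (inv_into M \<phi> q) (hvec (inv_into M \<phi> q) (M.perp V (inv_into M \<phi> q))))
      (\<phi> p) (dphi p X)) = (dA p X V + A p D) - orth_proj (hor N (\<phi> p)) (dA p X V + A p D)"
  proof -
    have "mdiff N (\<lambda>r. comps (F (inv_into M \<phi> r) (hvec (inv_into M \<phi> r) (M.perp V (inv_into M \<phi> r))))) (\<phi> p) (dphi p X)
      = mdiff N (\<lambda>r. A (inv_into M \<phi> r) (M.perp V (inv_into M \<phi> r))) (\<phi> p) (dphi p X)"
    proof (rule mdiff_cong)
      fix r assume "r \<in> N"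
      then have "inv_into M \<phi> r \<in> M" using inv_mem by blast
      then show "comps (F (inv_into M \<phi> r) (hvec (inv_into M \<phi> r) (M.perp V (inv_into M \<phi> r))))
          = A (inv_into M \<phi> r) (M.perp V (inv_into M \<phi> r))" by (simp add: F_A[OF _ M.hvec_perp])
    qed
    then show ?thesis
      using normal_field_transport(2)[OF X, of V]
      by (simp add: nabla_perp_def nabla_def N.pi_perp_eq[OF phi_mem[OF p]] Vp D_def)
  qed
  ultimately have "A p (D - orth_proj (hor M p) D)
      = (dA p X V + A p D) - orth_proj (hor N (\<phi> p)) (dA p X V + A p D)"
    using nabla_perp_eq[OF M.section_perp p X, of V] by simp
  also have "\<dots> = dA p X V + A p D - orth_proj (hor N (\<phi> p)) (dA p X V) - A p (orth_proj (hor M p) D)"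
    by (simp add: linear_add[OF linear_orth_proj[OF N.subspace_hor[OF phi_mem[OF p]]]] orth_proj_A[OF p])
  finally have "dA p X V = orth_proj (hor N (\<phi> p)) (dA p X V)"
    by (simp add: linear_diff[OF linear_A[OF p]])
  then have "dA p X V \<in> hor N (\<phi> p)" using orth_proj_mem[OF N.subspace_hor[OF phi_mem[OF p]]] by metis
  then show ?thesis using xiperpD[OF A_perp_mem[OF p W], of "dA p X V"] by (simp add: inner_commute)
qed

text \<open>Compares \<open>levi_II\<close> for a normal field with its transport; the terms without
  \<open>dA\<close> cancel because \<open>A p\<close> is an isometry. The sum over \<open>x\<close>
  and \<open>Jc x\<close> remains, since \<open>II\<close> sees only the complex linear part of the
  derivative.\<close>

lemma dA_II:
  assumes x: "x \<in> hor M p" and y: "y \<in> hor M p" and V: "hvec p V \<in> xiperp M p"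
  shows "dA p (hvec p x) V \<bullet> A p y + dA p (hvec p (Jc x)) (Jc V) \<bullet> A p y = 0"
proof -
  have V0: "\<And>w. w \<in> hor M p \<Longrightarrow> V \<bullet> w = 0" using V by (simp add: hvec_in_xiperp)
  have Vp: "M.perp V p = V" "M.perp (Jc V) p = Jc V"
    using V0 M.Jc_perp[OF p V0] by (auto intro!: M.perp_eq[OF p])
  let ?n = "\<lambda>V r. A (inv_into M \<phi> r) (M.perp V (inv_into M \<phi> r))"
  have xt: "hvec p x \<in> xihat M p" "hvec p y \<in> xihat M p" "hvec p x \<in> tangent M p" "hvec p (Jc x) \<in> tangent M p"
    using x y M.Jc_hor[OF p x] by (simp_all add: hvec_in_xihat hor_iff)
  \<comment> \<open>The transported field is normal along all of \<open>N\<close>, as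
    \<open>levi_II\<close> requires, not just at \<open>\<phi> p\<close>.\<close>
  have perpN: "?n V r \<bullet> w = 0" if "r \<in> N" "w \<in> hor N r" for V r w
  proof -
    have r: "inv_into M \<phi> r \<in> M" "\<phi> (inv_into M \<phi> r) = r"
      using that(1) inv_mem phi_image by (auto simp: f_inv_into_f)
    show ?thesis using xiperpD[OF A_perp_mem[OF r(1) M.hvec_perp[OF r(1)]]] that(2) r(2) by simp
  qed
  have np: "?n V (\<phi> p) = A p V" "?n (Jc V) (\<phi> p) = Jc (A p V)"
    by (simp_all add: inv_phi[OF p] Vp A_Jc[OF p])
  have "levi (II M p (hvec p x) (hvec p y)) (hvec p V)
      = - (y \<bullet> mdiff M (M.perp V) p (hvec p x) + y \<bullet> mdiff M (M.perp (Jc V)) p (hvec p (Jc x))) / 2"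
    using M.levi_II[OF p xt(1,2) M.msmooth_perp[of V] M.perp_orth M.msmooth_perp[of "Jc V"] M.perp_orth]
    by (simp add: Vp Jst_altdef)
  moreover have "levi (II N (\<phi> p) (dphi p (hvec p x)) (dphi p (hvec p y))) (hvec (\<phi> p) (A p V))
      = - (A p y \<bullet> mdiff N (?n V) (\<phi> p) (dphi p (hvec p x))
        + A p y \<bullet> mdiff N (?n (Jc V)) (\<phi> p) (dphi p (hvec p (Jc x)))) / 2"
  proof -
    have "comps (dphi p (hvec p y)) = A p y" using A_hor[OF p y] by (simp add: L_def)
    moreover have "Jst (\<phi> p) (dphi p (hvec p x)) = dphi p (hvec p (Jc x))"
      using phi_J[OF p xt(1)] by (simp add: Jst_altdef[of p])
    ultimately show ?thesis
      using N.levi_II[OF phi_mem[OF p] dphi_xihat[OF p xt(1)] dphi_xihat[OF p xt(2)]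
        normal_field_transport(1)[of V] perpN normal_field_transport(1)[of "Jc V"] perpN] np by simp
  qed
  moreover have "levi (II M p (hvec p x) (hvec p y)) (hvec p V)
      = levi (II N (\<phi> p) (dphi p (hvec p x)) (dphi p (hvec p y))) (hvec (\<phi> p) (A p V))"
    using II_eq[OF p xt(1,2) V] F_A[OF p V] by simp
  ultimately have "y \<bullet> mdiff M (M.perp V) p (hvec p x) + y \<bullet> mdiff M (M.perp (Jc V)) p (hvec p (Jc x))
     = A p y \<bullet> (dA p (hvec p x) V + A p (mdiff M (M.perp V) p (hvec p x)))
      + A p y \<bullet> (dA p (hvec p (Jc x)) (Jc V) + A p (mdiff M (M.perp (Jc V)) p (hvec p (Jc x))))"
    by (simp add: normal_field_transport(2)[OF xt(3), of V] normal_field_transport(2)[OF xt(4), of "Jc V"] Vp)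
  then show ?thesis by (simp add: inner_add_right A_inner[OF p] inner_commute)
qed

text \<open>On a normal vector, skewness disposes of the contact component of \<open>dA\<close> and
  \<open>dA_normal\<close> of the normal one. Testing against all \<open>A p d\<close> is enough,
  since \<open>A p\<close> is surjective.\<close>

lemma dA_eq_zeroI:
  assumes X: "X \<in> tangent M p" and hor: "\<And>y. y \<in> hor M p \<Longrightarrow> dA p X y = 0"
  shows "dA p X c = 0"
proof -
  let ?V = "M.perp c p"
  have "dA p X ?V \<bullet> A p d = 0" for d
  proof -
    have "dA p X ?V \<bullet> A p d = dA p X ?V \<bullet> A p (orth_proj (hor M p) d) + dA p X ?V \<bullet> A p (M.perp d p)"
      by (simp only: inner_add_right[symmetric] linear_add[OF linear_A[OF p], symmetric] decomp[OF p, symmetric])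
    also have "\<dots> = 0"
      using dA_skew[OF X, of ?V "orth_proj (hor M p) d"] hor[OF proj_hor[OF p], of d]
        dA_normal[OF X M.hvec_perp[OF p] M.hvec_perp[OF p], of c d] by simp
    finally show ?thesis .
  qed
  moreover obtain d where "A p d = dA p X ?V"
    using linear_injective_imp_surjective[OF linear_A[OF p] inj_A[OF p]] by (metis surjD)
  ultimately have "dA p X ?V = 0" by (metis inner_eq_zero_iff)
  then show ?thesis
    using hor[OF proj_hor[OF p], of c] linear_add[OF linear_dA, of p X "orth_proj (hor M p) c" ?V]
      decomp[OF p, of c] by simp
qed

text \<open>On \<open>hor\<close> the form \<open>\<langle>dA x y, A z\<rangle>\<close> is symmetric in \<open>x, y\<close>. Its contact part is skew in
  \<open>y, z\<close>, so it vanishes by the Koszul argument; its normal part is linear in \<open>y\<close> and, by equality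
  of the second fundamental forms, antilinear in \<open>x\<close>, so it vanishes as well.\<close>

lemma dA_hor:
  assumes x: "x \<in> hor M p"
  shows "dA p (hvec p x) c = 0"
proof -
  define \<omega> where "\<omega> x y z = dA p (hvec p x) y \<bullet> A p z" for x y z
  have sym: "\<omega> x y z = \<omega> y x z" if "x \<in> hor M p" "y \<in> hor M p" for x y z
    unfolding \<omega>_def using dA_symmetric[of "hvec p x" "hvec p y"] that by (simp add: hor_iff)
  have skew: "\<omega> x y z = - \<omega> x z y" if "x \<in> hor M p" for x y z
    unfolding \<omega>_def using dA_skew[of "hvec p x" y z] that by (simp add: hor_iff)
  have tan: "\<omega> x y z = 0" if "x \<in> hor M p" "y \<in> hor M p" "z \<in> hor M p" for x y z
    \<comment> \<open>Alternating three symmetric and three skew exchanges returns to the starting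
      arguments with the opposite sign.\<close>
    using sym[of x y z] skew[of y x z] sym[of y z x] skew[of z y x] sym[of z x y] skew[of x z y] that by linarith
  have nor: "\<omega> x y V = 0" if x: "x \<in> hor M p" and y: "y \<in> hor M p" and V: "hvec p V \<in> xiperp M p" for x y V
  proof -
    have Jx: "Jc x \<in> hor M p" by (rule M.Jc_hor[OF p x])
    \<comment> \<open>\<open>dA_Jc\<close> gives complex linearity in the second argument only;
      symmetry carries it to the first. The two terms of \<open>dA_II\<close> are therefore equal,
      and their sum is zero.\<close>
    have "\<omega> (Jc x) y (Jc V) = \<omega> y (Jc x) (Jc V)" by (rule sym[OF Jx y])
    also have "\<dots> = \<omega> y x V"
      unfolding \<omega>_def using dA_Jc[of "hvec p y" x] y by (simp add: hor_iff A_Jc[OF p])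
    also have "\<dots> = \<omega> x y V" by (rule sym[OF y x])
    finally have "\<omega> (Jc x) y (Jc V) = \<omega> x y V" .
    moreover have "\<omega> x V y + \<omega> (Jc x) (Jc V) y = 0"
      unfolding \<omega>_def by (rule dA_II[OF x y V])
    ultimately show ?thesis using skew[OF x, of V y] skew[OF Jx, of "Jc V" y] by linarith
  qed
  have xt: "hvec p x \<in> tangent M p" using x by (simp add: hor_iff)
  have "dA p (hvec p x) y = 0" if y: "y \<in> hor M p" for y
  proof -
    \<comment> \<open>By surjectivity the vector itself is of the form \<open>A p d\<close>, so the
      pairing computed next is its squared norm.\<close>
    obtain d where d: "A p d = dA p (hvec p x) y"
      using linear_injective_imp_surjective[OF linear_A[OF p] inj_A[OF p]] by (metis surjD)
    have "dA p (hvec p x) y \<bullet> A p d = \<omega> x y (orth_proj (hor M p) d) + \<omega> x y (M.perp d p)"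
      unfolding \<omega>_def
      by (simp only: inner_add_right[symmetric] linear_add[OF linear_A[OF p], symmetric] decomp[OF p, symmetric])
    also have "\<dots> = 0" using tan[OF x y proj_hor[OF p]] nor[OF x y M.hvec_perp[OF p]] by simp
    finally show ?thesis by (simp add: d)
  qed
  then show ?thesis by (rule dA_eq_zeroI[OF xt])
qed

text \<open>Covers the Reeb direction: \<open>dA_symmetric\<close> exchanges \<open>X\<close> with a
  contact vector \<open>y\<close>, and differentiation in direction \<open>y\<close> kills every
  vector, including \<open>comps X\<close>.\<close>

lemma dA_zero:
  assumes X: "X \<in> tangent M p"
  shows "dA p X c = 0"
proof (rule dA_eq_zeroI[OF X])
  fix y assume y: "y \<in> hor M p"
  then have "dA p X (comps (hvec p y)) = dA p (hvec p y) (comps X)"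
    by (intro dA_symmetric X) (simp add: hor_iff)
  then show "dA p X y = 0" using dA_hor[OF y] by simp
qed

end

section \<open>Integration to a rigid motion\<close>

lemma A_constant:
  assumes "connected M" "p \<in> M" "q \<in> M"
  shows "A p c = A q c"
proof (rule mdiff_zero_imp_constant[OF M.submanifold assms(1) msmooth_A _ assms(2,3)])
  fix q v assume q: "q \<in> M" and v: "v \<in> tangent M q"
  obtain E where "((\<lambda>q. A q c) has_derivative E) (at q within M)" "E v = dA q v c"
    using has_derivative_A[OF q] v by metis
  then show "mdiff M (\<lambda>q. A q c) q v = 0"
    using mdiff_eqI[OF msmooth_A q _ v] dA_zero[OF q v] by simp
qed

lemma congruent:
  assumes conn: "connected M" and p: "p \<in> M"
  shows "\<exists>g\<in>PSH. g ` M = N"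
proof -
  obtain U where U: "unitary_mat U" "\<And>q. comps (rot U q) = A p (comps q)" "\<And>q. ht (rot U q) = ht q"
    using isometry_imp_unitary[OF linear_A[OF p] A_inner[OF p] A_Jc[OF p]] by blast
  have bl: "bounded_linear (A p)" using linear_A[OF p] by (simp add: linear_conv_bounded_linear)
  have dcomps: "comps (dphi q v) = A p (comps v)" if "q \<in> M" "v \<in> tangent M q" for q v
    using comps_dphi[OF that] A_constant[OF conn that(1) p] by simp
  \<comment> \<open>The horizontal part of the left translation: the constant by which
    \<open>\<phi>\<close> and the rotation differ in the coordinates z.\<close>
  define c where "c = comps (\<phi> p) - A p (comps p)"
  have c: "comps (\<phi> q) = c + A p (comps q)" if q: "q \<in> M" for q
  proof -
    have sm: "msmooth M (\<lambda>q. comps (\<phi> q) - A p (comps q))"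
      by (intro msmooth_diff msmooth_bounded_linear[OF bounded_linear_comps] msmooth_bounded_linear[OF bl]
          smooth_phi msmooth_ident)
    have "comps (\<phi> q) - A p (comps q) = comps (\<phi> p) - A p (comps p)"
    proof (rule mdiff_zero_imp_constant[OF M.submanifold conn sm _ q p])
      fix q v assume q: "q \<in> M" and v: "v \<in> tangent M q"
      obtain D where D: "(\<phi> has_derivative D) (at q within M)" "dphi q v = D v"
        using msmooth_has_derivative[OF smooth_phi q] v by metis
      have "((\<lambda>q. comps (\<phi> q) - A p (comps q)) has_derivative (\<lambda>v. comps (D v) - A p (comps v))) (at q within M)"
        by (intro has_derivative_diff bounded_linear.has_derivative[OF bounded_linear_comps]
            bounded_linear.has_derivative[OF bl] D(1) has_derivative_ident)
      from mdiff_eqI[OF sm q this v] show "mdiff M (\<lambda>q. comps (\<phi> q) - A p (comps q)) q v = 0"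
        using dcomps[OF q v] D(2) by simp
    qed
    then show ?thesis by (simp add: c_def algebra_simps)
  qed
  \<comment> \<open>Left translation by an element with components \<open>c\<close> and height
    \<open>t\<close> sends height s over \<open>A p z\<close> to \<open>t\<close> + s -
    \<open>Jc c \<bullet> A p z\<close>; this is that relation solved for \<open>t\<close>.\<close>
  define t where "t = ht (\<phi> p) - ht p + Jc c \<bullet> A p (comps p)"
  have t: "ht (\<phi> q) - ht q + Jc c \<bullet> A p (comps q) = t" if q: "q \<in> M" for q
  proof -
    have sm: "msmooth M (\<lambda>q. ht (\<phi> q) - ht q + Jc c \<bullet> A p (comps q))"
      by (intro msmooth_add msmooth_diff msmooth_inner msmooth_const msmooth_bounded_linear[OF bounded_linear_ht]
          msmooth_bounded_linear[OF bounded_linear_comps] msmooth_bounded_linear[OF bl] smooth_phi msmooth_ident)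
    show ?thesis unfolding t_def
    proof (rule mdiff_zero_imp_constant[OF M.submanifold conn sm _ q p])
      fix q v assume q: "q \<in> M" and v: "v \<in> tangent M q"
      obtain D where D: "(\<phi> has_derivative D) (at q within M)" "dphi q v = D v"
        using msmooth_has_derivative[OF smooth_phi q] v by metis
      have "((\<lambda>q. ht (\<phi> q) - ht q + Jc c \<bullet> A p (comps q)) has_derivative
          (\<lambda>v. ht (D v) - ht v + Jc c \<bullet> A p (comps v))) (at q within M)"
        by (intro has_derivative_add has_derivative_diff has_derivative_inner_right
            bounded_linear.has_derivative[OF bounded_linear_comps] bounded_linear.has_derivative[OF bounded_linear_ht]
            bounded_linear.has_derivative[OF bl] D(1) has_derivative_ident)
      from mdiff_eqI[OF sm q this v]
      have "mdiff M (\<lambda>q. ht (\<phi> q) - ht q + Jc c \<bullet> A p (comps q)) q v = ht (dphi q v) - ht v + Jc c \<bullet> A p (comps v)"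
        using D(2) by simp
      \<comment> \<open>In the contact form at \<open>\<phi> q\<close> the rotation part of
        \<open>comps (\<phi> q)\<close> reproduces the form at \<open>q\<close>; the translation
        part \<open>c\<close> contributes the correction term in \<open>t\<close>.\<close>
      also have "\<dots> = 0"
        using phi_Theta[OF q v]
        by (simp add: Theta_altdef c[OF q] dcomps[OF q v] linear_add[OF linear_Jc] inner_add_left
            A_inner[OF p] flip: A_Jc[OF p])
      finally show "mdiff M (\<lambda>q. ht (\<phi> q) - ht q + Jc c \<bullet> A p (comps q)) q v = 0" .
    qed
  qed
  obtain a :: "'n heis" where a: "comps a = c" "ht a = t" by (rule comps_cases)
  have comps_mult: "comps (heis_mult a q) = comps a + comps q" for q
    by (simp add: heis_mult_def comps_def hx_def hy_def)
  have ht_mult: "ht (heis_mult a q) = ht a + ht q - Jc (comps a) \<bullet> comps q" for q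
    by (simp add: heis_mult_def comps_def Jc_def inner_prod_def) (simp add: ht_def)
  have "heis_mult a (rot U q) = \<phi> q" if q: "q \<in> M" for q
    by (rule heis_eqI) (use c[OF q] t[OF q] in \<open>simp_all add: comps_mult ht_mult U a\<close>)
  then have "(\<lambda>q. heis_mult a (rot U q)) ` M = N" using phi_image by (metis (no_types, lifting) image_cong)
  moreover have "(\<lambda>q. heis_mult a (rot U q)) \<in> PSH" unfolding PSH_def using U(1) by blast
  ultimately show ?thesis by blast
qed

end

theorem theorem5p2:
  fixes M N :: "('n::finite) heis set" and m :: nat
    and \<phi> :: "'n heis \<Rightarrow> 'n heis" and F :: "'n heis \<Rightarrow> 'n heis \<Rightarrow> 'n heis"
  assumes "1 \<le> m" and "m \<le> CARD('n)"
    and "psh_submanifold m M" and "psh_submanifold m N"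
    and "simply_connected M" and "simply_connected N"
    and "bij_betw \<phi> M N" and "msmooth M \<phi>" and "msmooth N (inv_into M \<phi>)"
    and "\<forall>p\<in>M. \<forall>v\<in>xihat M p. mdiff M \<phi> p (Jst p v) = Jst (\<phi> p) (mdiff M \<phi> p v)"
    and "\<forall>p\<in>M. \<forall>v\<in>tangent M p. Theta (\<phi> p) (mdiff M \<phi> p v) = Theta p v"
    and "\<forall>p\<in>M. F p ` xiperp M p = xiperp N (\<phi> p)
            \<and> (\<forall>v\<in>xiperp M p. \<forall>w\<in>xiperp M p. F p (v + w) = F p v + F p w)
            \<and> (\<forall>c. \<forall>v\<in>xiperp M p. F p (c *\<^sub>R v) = c *\<^sub>R F p v)
            \<and> (\<forall>v\<in>xiperp M p. F p (Jst p v) = Jst (\<phi> p) (F p v))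
            \<and> (\<forall>v\<in>xiperp M p. \<forall>w\<in>xiperp M p. levi (F p v) (F p w) = levi v w)"
    and "\<forall>V. section_of M (xiperp M) V \<longrightarrow> msmooth M (\<lambda>p. F p (V p))"
    and "\<forall>p\<in>M. \<forall>X\<in>xihat M p. \<forall>Y\<in>xihat M p. \<forall>V\<in>xiperp M p.
            levi (II M p X Y) V = levi (II N (\<phi> p) (mdiff M \<phi> p X) (mdiff M \<phi> p Y)) (F p V)"
    and "\<forall>V. section_of M (xiperp M) V \<longrightarrow> (\<forall>p\<in>M. \<forall>X\<in>tangent M p.
            F p (nabla_perp M V p X)
              = nabla_perp N (\<lambda>q. F (inv_into M \<phi> q) (V (inv_into M \<phi> q))) (\<phi> p) (mdiff M \<phi> p X))"
    and "\<forall>p\<in>M. F p (nu M p) = nu N (\<phi> p)"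
  shows "\<exists>g\<in>PSH. g ` M = N"
proof (cases "M = {}")
  case True
  then have "N = {}" using assms(7) by (simp add: bij_betw_def)
  \<comment> \<open>With no base point to define a rotation from, the identity isometry supplies a
    unitary matrix, and any rigid motion maps the empty set to itself.\<close>
  obtain U :: "complex^'n^'n" where "unitary_mat U"
    by (rule isometry_imp_unitary[OF linear_ident refl refl]) (rule that)
  then have "(\<lambda>q. heis_mult 0 (rot U q)) \<in> (PSH :: ('n heis \<Rightarrow> 'n heis) set)" unfolding PSH_def by blast
  then show ?thesis using \<open>M = {}\<close> \<open>N = {}\<close> by blast
next
  case False
  interpret psh_congruence M N m \<phi> F
  proof (intro psh_congruence.intro psh_manifold.intro psh_congruence_axioms.intro)
    show "psh_submanifold m M" "psh_submanifold m N" "bij_betw \<phi> M N" "msmooth M \<phi>" "msmooth N (inv_into M \<phi>)"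
      by fact+
    fix V assume "section_of M (xiperp M) V"
    then show "msmooth M (\<lambda>p. F p (V p))" by (rule assms(13)[rule_format])
  next
    fix V p X assume "section_of M (xiperp M) V" "p \<in> M" "X \<in> tangent M p"
    then show "F p (nabla_perp M V p X)
        = nabla_perp N (\<lambda>q. F (inv_into M \<phi> q) (V (inv_into M \<phi> q))) (\<phi> p) (mdiff M \<phi> p X)"
      by (rule assms(15)[rule_format])
  next
    fix p assume p: "p \<in> M"
    note F = bspec[OF assms(12) p]
    show "F p (nu M p) = nu N (\<phi> p)" by (rule bspec[OF assms(16) p])
    fix v
    show "v \<in> xihat M p \<Longrightarrow> mdiff M \<phi> p (Jst p v) = Jst (\<phi> p) (mdiff M \<phi> p v)"
      by (rule bspec[OF bspec[OF assms(10) p]])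
    show "v \<in> tangent M p \<Longrightarrow> Theta (\<phi> p) (mdiff M \<phi> p v) = Theta p v"
      by (rule bspec[OF bspec[OF assms(11) p]])
    show "v \<in> xiperp M p \<Longrightarrow> F p v \<in> xiperp N (\<phi> p)" using F by blast
    show "v \<in> xiperp M p \<Longrightarrow> F p (Jst p v) = Jst (\<phi> p) (F p v)" using F by simp
    show "v \<in> xiperp M p \<Longrightarrow> F p (c *\<^sub>R v) = c *\<^sub>R F p v" for c using F by simp
    fix w
    show "v \<in> xiperp M p \<Longrightarrow> w \<in> xiperp M p \<Longrightarrow> F p (v + w) = F p v + F p w"
      "v \<in> xiperp M p \<Longrightarrow> w \<in> xiperp M p \<Longrightarrow> levi (F p v) (F p w) = levi v w"
      using F by simp_all
  next
    fix p X Y v assume "p \<in> M" "X \<in> xihat M p" "Y \<in> xihat M p" "v \<in> xiperp M p"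
    then show "levi (II M p X Y) v = levi (II N (\<phi> p) (mdiff M \<phi> p X) (mdiff M \<phi> p Y)) (F p v)"
      by (rule assms(14)[rule_format])
  qed
  obtain p where "p \<in> M" using False by blast
  moreover have "connected M"
    using assms(5) simply_connected_imp_path_connected path_connected_imp_connected by blast
  ultimately show ?thesis by (rule congruent[rotated])
qed

end
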